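(* There is a polynomial time algorithm that decides whether a given digraph $D$ whose unique strong component with more than one vertex is a subdivision of a trivault has a dicycle $B$ in $D$ and a cycle $C$ in $\mathrm{UG}(D)$ with $V(B)\cap V(C)=\emptyset$, and finds such $B,C$ if they exist.
   Context: Digraphs are finite, loops and multiple arcs allowed; a dicycle is a directed cycle, a cycle is a cycle of $\mathrm{UG}(D)$; a subdivision replaces arcs by dipaths with new internal vertices. A trivault is obtained from six disjoint digraphs $R_i,L_i$ ($i\in\{0,1,2\}$), where each $R_i$ is either a nontrivial out-star with root $b_i$ or a $(b_i,x_i)$-dipath, and each $L_i$ is either a nontrivial in-star with root $c_i$ or a $(y_i,c_i)$-dipath, as follows: (i) for each $i$ either add a single arc from $c_i$ to $b_i$ or identify $b_i$ and $c_i$; (ii) for distinct $i,j$, if $R_i$ is a nontrivial out-star and $L_j$ a nontrivial in-star, add a single arc from each leaf of $R_i$ to $c_j$ and from $b_i$ to every leaf of $L_j$, and any number (possibly $0$) of arcs from $b_i$ to $c_j$; (iii) for distinct $i,j$, if $R_i$ is a nontrivial out-star and $L_j$ a path, select $v\in V(L_j)$, add a single arc from each leaf of $R_i$ to $v$, at least one arc from $b_i$ to $y_j$, and any number (possibly $0$) of arcs from $b_i$ to each $z\in L_j[y_j,v]$; (iv) for distinct $i,j$, if $R_i$ is a path and $L_j$ a nontrivial in-star, select $v\in V(R_i)$, add a single arc from $v$ to each leaf of $L_j$, at least one arc from $x_i$ to $c_j$, and any number (possibly $0$) of arcs from each $z\in R_i[v,x_i]$ to $c_j$; (v) for distinct $i,j$,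 if $R_i,L_j$ are both paths, add at least one arc from $x_i$ to some vertex of $L_j$, at least one arc from some vertex of $R_i$ to $y_j$, and any number (possibly $0$) of arcs from each $z\in V(R_i)$ to each $w\in V(L_j)$. Here $P[x,y]$ denotes the subpath of $P$ from $x$ to $y$. *)

theory Defs
  imports
    "Graph_Theory.Digraph_Component"
    "HOL-Computational_Algebra.Polynomial"
begin

section \<open>Algorithms and their running time\<close>

text \<open>
  The machine model is a unit-cost random access machine over the natural numbers with addition and
  (truncated) subtraction as its only arithmetic operations, given as a structured
  language. Without multiplication, the numbers occurring in a run of \<open>t\<close> steps have \<open>O(t + log N)\<close>
  bits, where \<open>N\<close> bounds the input numbers and the literals of the program, so that polynomial
  time on this machine coincides with polynomial time on Turing machines.
  A program has finitely many registers and finitely many unbounded arrays, both named by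
  numerals occurring in the program text. An expression is part of the program text, so that its
  evaluation amounts to a constant number of machine operations and is charged together with the
  command or test it occurs in.
\<close>

datatype aexp =
    Num nat
  | Reg nat
  | Cell nat aexp  \<comment> \<open>\<open>Cell A e\<close> is the entry with index \<open>e\<close> of the array \<open>A\<close>\<close>
  | Plus aexp aexp
  | Minus aexp aexp

datatype bexp =
    Less aexp aexp
  | Equal aexp aexp
  | Neg bexp
  | Conj bexp bexp

datatype com =
    Skip
  | Set nat aexp  \<comment> \<open>write a register\<close>
  | Store nat aexp aexp  \<comment> \<open>\<open>Store A e1 e2\<close> writes \<open>e2\<close> to the entry with index \<open>e1\<close> of the array \<open>A\<close>\<close>
  | Seq com com
  | Cond bexp com com
  | While bexp com

record state =
  reg :: "nat \<Rightarrow> nat"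
  arr :: "nat \<Rightarrow> nat \<Rightarrow> nat"

primrec aval :: "aexp \<Rightarrow> state \<Rightarrow> nat" where
  "aval (Num k) s = k"
| "aval (Reg x) s = reg s x"
| "aval (Cell A e) s = arr s A (aval e s)"
| "aval (Plus e1 e2) s = aval e1 s + aval e2 s"
| "aval (Minus e1 e2) s = aval e1 s - aval e2 s"

primrec bval :: "bexp \<Rightarrow> state \<Rightarrow> bool" where
  "bval (Less e1 e2) s \<longleftrightarrow> aval e1 s < aval e2 s"
| "bval (Equal e1 e2) s \<longleftrightarrow> aval e1 s = aval e2 s"
| "bval (Neg b) s \<longleftrightarrow> \<not> bval b s"
| "bval (Conj b1 b2) s \<longleftrightarrow> bval b1 s \<and> bval b2 s"

text \<open>\<open>exec c s t s'\<close>: started in \<open>s\<close>, the program \<open>c\<close> halts in \<open>s'\<close> after exactly \<open>t\<close> steps.\<close>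

inductive exec :: "com \<Rightarrow> state \<Rightarrow> nat \<Rightarrow> state \<Rightarrow> bool" where
  Skip: "exec Skip s 1 s"
| Set: "exec (Set x e) s 1 (s\<lparr>reg := (reg s)(x := aval e s)\<rparr>)"
| Store: "exec (Store A e1 e2) s 1
    (s\<lparr>arr := (arr s)(A := (arr s A)(aval e1 s := aval e2 s))\<rparr>)"
| Seq: "exec c1 s t1 s1 \<Longrightarrow> exec c2 s1 t2 s2 \<Longrightarrow> exec (Seq c1 c2) s (t1 + t2) s2"
| CondTrue: "bval b s \<Longrightarrow> exec c1 s t s' \<Longrightarrow> exec (Cond b c1 c2) s (Suc t) s'"
| CondFalse: "\<not> bval b s \<Longrightarrow> exec c2 s t s' \<Longrightarrow> exec (Cond b c1 c2) s (Suc t) s'"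
| WhileFalse: "\<not> bval b s \<Longrightarrow> exec (While b c) s 1 s"
| WhileTrue: "bval b s \<Longrightarrow> exec c s t1 s1 \<Longrightarrow> exec (While b c) s1 t2 s2 \<Longrightarrow>
    exec (While b c) s (Suc (t1 + t2)) s2"

inductive_cases exec_SkipE: "exec Skip s t s'"
inductive_cases exec_SetE: "exec (Set x e) s t s'"
inductive_cases exec_StoreE: "exec (Store A e1 e2) s t s'"
inductive_cases exec_SeqE: "exec (Seq c1 c2) s t s'"
inductive_cases exec_CondE: "exec (Cond b c1 c2) s t s'"
inductive_cases exec_WhileE: "exec (While b c) s t s'"

lemma exec_deterministic:
  assumes "exec c s t s'" and "exec c s u s''"
  shows "t = u \<and> s' = s''"
  using assms
proof (induction arbitrary: u s'' rule: exec.induct)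
  case Skip
  then show ?case by (auto elim: exec_SkipE)
next
  case Set
  then show ?case by (auto elim: exec_SetE)
next
  case Store
  then show ?case by (auto elim: exec_StoreE)
next
  case Seq
  from Seq.prems show ?case by (rule exec_SeqE) (use Seq.IH in blast)
next
  case CondTrue
  from CondTrue.prems show ?case by (rule exec_CondE) (use CondTrue in blast)+
next
  case CondFalse
  from CondFalse.prems show ?case by (rule exec_CondE) (use CondFalse in blast)+
next
  case WhileFalse
  from WhileFalse.prems show ?case by (rule exec_WhileE) (use WhileFalse in auto)
next
  case WhileTrue
  from WhileTrue.prems show ?case by (rule exec_WhileE) (use WhileTrue in blast)+
qed

text \<open>
  A finite digraph is presented as an arc list \<open>es\<close> over the vertices \<open>0, \<dots>, n - 1\<close>; the arcs are
  the positions in the list, so that parallel arcs and loops are possible. Up to isomorphism, every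
  finite digraph arises in this way. Its size is \<open>n + length es\<close>.
\<close>

definition digraph_of :: "nat \<Rightarrow> (nat \<times> nat) list \<Rightarrow> (nat, nat) pre_digraph" where
  "digraph_of n es =
    \<lparr>verts = {..<n}, arcs = {..<length es}, tail = (\<lambda>a. fst (es ! a)), head = (\<lambda>a. snd (es ! a))\<rparr>"

text \<open>
  Registers 0 and 1 initially hold the numbers of vertices and arcs, arrays 0 and 1 the tails and
  heads of the arcs; all else is 0.
\<close>

definition input_state :: "nat \<Rightarrow> (nat \<times> nat) list \<Rightarrow> state" where
  "input_state n es =
    \<lparr>reg = (\<lambda>_. 0)(0 := n, 1 := length es),
     arr = (\<lambda>_ _. 0)
       (0 := (\<lambda>a. if a < length es then fst (es ! a) else 0),
        1 := (\<lambda>a. if a < length es then snd (es ! a) else 0))\<rparr>"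

definition array_prefix :: "state \<Rightarrow> nat \<Rightarrow> nat \<Rightarrow> nat list" where
  "array_prefix s A k = map (arr s A) [0..<k]"

section \<open>Underlying graphs and cycles\<close>

record ('v, 'e) ugraph =
  uverts :: "'v set"
  uedges :: "'e set"
  uends :: "'e \<Rightarrow> 'v set"

text \<open>Orientations are dropped, multiplicities are not: the edges are the arcs of the digraph.\<close>

definition UG :: "('v, 'e) pre_digraph \<Rightarrow> ('v, 'e) ugraph" where
  "UG D = \<lparr>uverts = verts D, uedges = arcs D, uends = (\<lambda>e. {tail D e, head D e})\<rparr>"

text \<open>
  Cycles of length 1 are loops, and cycles of length 2 consist of two distinct edges with the
  same ends.
\<close>

definition ucycle :: "('v, 'e) ugraph \<Rightarrow> 'v list \<Rightarrow> 'e list \<Rightarrow> bool" where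
  "ucycle U vs fs \<longleftrightarrow>
     fs \<noteq> [] \<and> length vs = length fs \<and> distinct vs \<and> distinct fs \<and>
     set vs \<subseteq> uverts U \<and> set fs \<subseteq> uedges U \<and>
     (\<forall>i<length fs. uends U (fs ! i) = {vs ! i, vs ! (Suc i mod length fs)})"

text \<open>
  Dicycles are given by their arcs, as in \<^const>\<open>pre_digraph.cycle\<close>; every vertex of a dicycle is the
  tail of one of its arcs.
\<close>

definition disjoint_dicycle_cycle ::
    "('v, 'e) pre_digraph \<Rightarrow> 'e list \<Rightarrow> 'v list \<Rightarrow> 'e list \<Rightarrow> bool" where
  "disjoint_dicycle_cycle D B vs fs \<longleftrightarrow>
     pre_digraph.cycle D B \<and> ucycle (UG D) vs fs \<and> tail D ` set B \<inter> set vs = {}"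

section \<open>Trivaults and subdivisions\<close>

text \<open>
  \<open>H\<close> arises (up to isomorphism) from \<open>T\<close> by replacing each arc \<open>a\<close> by the dipath \<open>P a\<close>.
\<close>

definition is_subdivision_of ::
    "('w, 'f) pre_digraph \<Rightarrow> ('v, 'e) pre_digraph \<Rightarrow> bool" where
  "is_subdivision_of H T \<longleftrightarrow>
     wf_digraph H \<and> wf_digraph T \<and>
     (\<exists>\<phi> P. let inner = (\<lambda>a. tl (butlast (pre_digraph.awalk_verts H (\<phi> (tail T a)) (P a)))) in
        inj_on \<phi> (verts T) \<and>
        (\<forall>a\<in>arcs T.
           P a \<noteq> [] \<and> pre_digraph.awalk H (\<phi> (tail T a)) (P a) (\<phi> (head T a)) \<and>
           distinct (inner a) \<and> set (inner a) \<inter> \<phi> ` verts T = {}) \<and>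
        (\<forall>a\<in>arcs T. \<forall>a'\<in>arcs T. a \<noteq> a' \<longrightarrow>
           set (inner a) \<inter> set (inner a') = {} \<and> set (P a) \<inter> set (P a') = {}) \<and>
        verts H = \<phi> ` verts T \<union> (\<Union>a\<in>arcs T. set (inner a)) \<and>
        arcs H = (\<Union>a\<in>arcs T. set (P a)))"

definition nontrivial_out_star :: "('v, 'e) pre_digraph \<Rightarrow> 'v \<Rightarrow> bool" where
  "nontrivial_out_star G r \<longleftrightarrow>
     wf_digraph G \<and> r \<in> verts G \<and> verts G \<noteq> {r} \<and>
     (\<forall>a\<in>arcs G. tail G a = r) \<and> bij_betw (head G) (arcs G) (verts G - {r})"

definition nontrivial_in_star :: "('v, 'e) pre_digraph \<Rightarrow> 'v \<Rightarrow> bool" where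
  "nontrivial_in_star G r \<longleftrightarrow>
     wf_digraph G \<and> r \<in> verts G \<and> verts G \<noteq> {r} \<and>
     (\<forall>a\<in>arcs G. head G a = r) \<and> bij_betw (tail G) (arcs G) (verts G - {r})"

text \<open>The digraph \<open>G\<close> is a dipath from \<open>u\<close> to \<open>v\<close>, possibly with the single vertex \<open>u = v\<close>.\<close>

definition is_dipath :: "('v, 'e) pre_digraph \<Rightarrow> 'v \<Rightarrow> 'v \<Rightarrow> bool" where
  "is_dipath G u v \<longleftrightarrow> wf_digraph G \<and>
     (\<exists>p. pre_digraph.apath G u p v \<and>
        verts G = set (pre_digraph.awalk_verts G u p) \<and> arcs G = set p)"

text \<open>The vertices of the subpath \<open>P[u,v]\<close> of a dipath \<open>P\<close>.\<close>

definition subpath_verts :: "('v, 'e) pre_digraph \<Rightarrow> 'v \<Rightarrow> 'v \<Rightarrow> 'v set" where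
  "subpath_verts P u v =
     {z. \<exists>p. pre_digraph.apath P u p v \<and> z \<in> set (pre_digraph.awalk_verts P u p)}"

definition arc_count :: "('v, 'e) pre_digraph \<Rightarrow> 'v \<Rightarrow> 'v \<Rightarrow> nat" where
  "arc_count T u w = card {a \<in> arcs T. tail T a = u \<and> head T a = w}"

text \<open>
  The rules for the arcs of \<open>T\<close> from a part \<open>R\<close> to a part \<open>L\<close>. Arcs that a rule does not mention
  are absent; pairs of vertices with any number of arcs are unconstrained.
\<close>

definition star_to_star where
  "star_to_star T R b L c \<longleftrightarrow>
     (\<forall>u\<in>verts R - {b}. arc_count T u c = 1) \<and>
     (\<forall>w\<in>verts L - {c}. arc_count T b w = 1) \<and>
     (\<forall>u\<in>verts R - {b}. \<forall>w\<in>verts L - {c}. arc_count T u w = 0)"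

definition star_to_path where
  "star_to_path T R b L y \<longleftrightarrow>
     (\<exists>v\<in>verts L.
        (\<forall>u\<in>verts R - {b}. arc_count T u v = 1 \<and> (\<forall>w\<in>verts L - {v}. arc_count T u w = 0)) \<and>
        arc_count T b y \<ge> 1 \<and>
        (\<forall>w\<in>verts L - subpath_verts L y v. arc_count T b w = 0))"

definition path_to_star where
  "path_to_star T R x L c \<longleftrightarrow>
     (\<exists>v\<in>verts R.
        (\<forall>w\<in>verts L - {c}. arc_count T v w = 1 \<and> (\<forall>u\<in>verts R - {v}. arc_count T u w = 0)) \<and>
        arc_count T x c \<ge> 1 \<and>
        (\<forall>u\<in>verts R - subpath_verts R v x. arc_count T u c = 0))"

text \<open>A single arc from \<open>x\<close> to \<open>y\<close> serves both purposes.\<close>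

definition path_to_path where
  "path_to_path T R x L y \<longleftrightarrow>
     (\<exists>w\<in>verts L. arc_count T x w \<ge> 1) \<and> (\<exists>u\<in>verts R. arc_count T u y \<ge> 1)"

text \<open>
  The parts \<open>R i\<close>, \<open>L i\<close> are subdigraphs of the finished trivault \<open>T\<close>, where \<open>R i\<close> and \<open>L i\<close>
  overlap in the vertex \<open>b i = c i\<close> if these two are identified. The flags \<open>\<rho>\<close> and \<open>\<sigma>\<close> record
  which parts are used as stars; \<open>x i\<close> (\<open>y i\<close>) matters only if \<open>R i\<close> (\<open>L i\<close>) is used as a path.
  The equation for \<open>arcs T\<close> says that there are no arcs besides those of the parts, the arcs from
  \<open>c i\<close> to \<open>b i\<close>, and arcs from \<open>R i\<close> to \<open>L j\<close> with \<open>i \<noteq> j\<close>.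
\<close>

definition trivault :: "('v, 'e) pre_digraph \<Rightarrow> bool" where
  "trivault T \<longleftrightarrow> fin_digraph T \<and>
    (\<exists>(R :: nat \<Rightarrow> ('v, 'e) pre_digraph) (L :: nat \<Rightarrow> ('v, 'e) pre_digraph)
        (b :: nat \<Rightarrow> 'v) (c :: nat \<Rightarrow> 'v) (x :: nat \<Rightarrow> 'v) (y :: nat \<Rightarrow> 'v)
        (\<rho> :: nat \<Rightarrow> bool) (\<sigma> :: nat \<Rightarrow> bool).
       (\<forall>i<3. subgraph (R i) T \<and> subgraph (L i) T \<and>
          (if \<rho> i then nontrivial_out_star (R i) (b i) else is_dipath (R i) (b i) (x i)) \<and>
          (if \<sigma> i then nontrivial_in_star (L i) (c i) else is_dipath (L i) (y i) (c i)) \<and>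
          (verts (R i) \<inter> verts (L i) = {} \<and> arc_count T (c i) (b i) = 1 \<or>
           b i = c i \<and> verts (R i) \<inter> verts (L i) = {b i})) \<and>
       (\<forall>i<3. \<forall>j<3. i \<noteq> j \<longrightarrow>
          (verts (R i) \<union> verts (L i)) \<inter> (verts (R j) \<union> verts (L j)) = {} \<and>
          (if \<rho> i
           then if \<sigma> j then star_to_star T (R i) (b i) (L j) (c j)
                else star_to_path T (R i) (b i) (L j) (y j)
           else if \<sigma> j then path_to_star T (R i) (x i) (L j) (c j)
                else path_to_path T (R i) (x i) (L j) (y j))) \<and>
       verts T = (\<Union>i<3. verts (R i) \<union> verts (L i)) \<and>
       arcs T =
         (\<Union>i<3. arcs (R i) \<union> arcs (L i)) \<union>
         (\<Union>i<3. {a \<in> arcs T. b i \<noteq> c i \<and> tail T a = c i \<and> head T a = b i}) \<union>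
         (\<Union>i<3. \<Union>j\<in>{..<3} - {i}. {a \<in> arcs T. tail T a \<in> verts (R i) \<and> head T a \<in> verts (L j)}))"

text \<open>
  Since \<open>T\<close> is finite, it is no restriction that its vertices and arcs are natural numbers.
\<close>

definition unique_component_trivault :: "('v, 'e) pre_digraph \<Rightarrow> bool" where
  "unique_component_trivault D \<longleftrightarrow>
     (\<exists>S. {S' \<in> pre_digraph.sccs D. card (verts S') > 1} = {S} \<and>
        (\<exists>T :: (nat, nat) pre_digraph. trivault T \<and> is_subdivision_of S T))"

end

theory Submission
  imports Defs
begin

text \<open>
  In a subdivision of a trivault, colour a vertex red if it lies on (the subdivision of) some \<open>R i\<close>
  but is not its root \<open>b i\<close>, and blue if it is neither red nor a root. A blue vertex has out-degree at
  most one, with no arc to a red vertex, and a red vertex has in-degree at most one. Hence a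
  dicycle splits at its arcs that leave the red vertices and the roots into at most three segments,
  each of which runs through blue vertices to a root and then through red vertices, and every
  simple path with the same ends as a segment stays on the dicycle.

  The algorithm therefore runs through all choices of three pairs of vertices, joins each pair by
  some simple path, and asks whether the vertices \<open>W\<close> of these paths induce a dicycle and the
  underlying graph has a cycle avoiding \<open>W\<close>. Both questions amount to searching, for some arc, a
  path from its head to its tail. Dicycles outside the nontrivial strong component are loops, for
  which the three pairs can be chosen trivially.
\<close>

section \<open>Reasoning about programs\<close>

text \<open>The program never sees the trivault: neither its parts nor the colours belong to the
  input, and only the ends of the segments are guessed. Hence the joining paths are arbitrary. What
  makes every choice harmless is that little is demanded of \<open>W\<close>: it has to lie inside
  the vertex set of the wanted dicycle, so that the wanted cycle still avoids it, and it has to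
  contain some dicycle, possibly a different one. The number three is the number of roots. A segment
  that starts blue must reach a root, because no arc leads from blue to red, and behind the root
  each red vertex can be entered in only one way. A dicycle without roots is all blue or all red,
  and is forced in one direction throughout. In the trivault, blue vertices have out-degree at most
  one because they lie on in-stars or dipaths ending in \<open>c i\<close>, and the arcs between
  different parts all leave some \<open>R i\<close>, except for the single arc from
  \<open>c i\<close> to \<open>b i\<close>. A positive answer certifies itself; the trivault is
  needed only to justify a negative one.\<close>

definition runs :: "com \<Rightarrow> state \<Rightarrow> (state \<Rightarrow> nat \<Rightarrow> bool) \<Rightarrow> bool" where
  "runs c s Q \<longleftrightarrow> (\<exists>t s'. exec c s t s' \<and> Q s' t)"

text \<open>\<open>runs\<close> is a weakest precondition for total correctness that also tracks the
  exact number of steps. Being existential in the run, it composes, so the rules for loop-free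
  commands are equations and simplification computes preconditions.\<close>

lemma runs_Skip [simp]: "runs Skip s Q \<longleftrightarrow> Q s 1"
  unfolding runs_def by (auto intro: exec.Skip[simplified] elim: exec_SkipE)

lemma runs_Set [simp]: "runs (Set x e) s Q \<longleftrightarrow> Q (s\<lparr>reg := (reg s)(x := aval e s)\<rparr>) 1"
  unfolding runs_def by (auto intro: exec.Set[simplified] elim: exec_SetE)

lemma runs_Store [simp]:
  "runs (Store A e1 e2) s Q \<longleftrightarrow>
    Q (s\<lparr>arr := (arr s)(A := (arr s A)(aval e1 s := aval e2 s))\<rparr>) 1"
  unfolding runs_def by (auto intro: exec.Store[simplified] elim: exec_StoreE)

lemma runs_Seq [simp]:
  "runs (Seq c1 c2) s Q \<longleftrightarrow> runs c1 s (\<lambda>s1 t1. runs c2 s1 (\<lambda>s2 t2. Q s2 (t1 + t2)))"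
  unfolding runs_def by (fast intro: exec.Seq elim: exec_SeqE)

lemma runs_Cond [simp]:
  "runs (Cond b c1 c2) s Q \<longleftrightarrow>
    (if bval b s then runs c1 s (\<lambda>s' t. Q s' (Suc t)) else runs c2 s (\<lambda>s' t. Q s' (Suc t)))"
  unfolding runs_def by (auto intro: exec.CondTrue exec.CondFalse elim!: exec_CondE)

text \<open>A single unfolding of the loop, kept out of the simp set because rewriting with it would
  not terminate.\<close>

lemma runs_While:
  "runs (While b c) s Q \<longleftrightarrow>
    (if bval b s then runs c s (\<lambda>s1 t1. runs (While b c) s1 (\<lambda>s2 t2. Q s2 (Suc (t1 + t2))))
     else Q s 1)"
  (is "_ \<longleftrightarrow> ?R")
proof
  assume "runs (While b c) s Q"
  then obtain t s' where e: "exec (While b c) s t s'" "Q s' t"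
    by (auto simp: runs_def)
  from e(1) show ?R
    by (rule exec_WhileE) (use e(2) in \<open>auto simp: runs_def\<close>)
next
  assume R: ?R
  show "runs (While b c) s Q"
  proof (cases "bval b s")
    case True
    with R show ?thesis
      unfolding runs_def by (auto dest: exec.WhileTrue)
  next
    case False
    then have "exec (While b c) s 1 s" by (rule exec.WhileFalse)
    with R False show ?thesis
      unfolding runs_def by auto
  qed
qed

section \<open>What a program can write\<close>

primrec wregs :: "com \<Rightarrow> nat set" where
  "wregs Skip = {}"
| "wregs (Set x e) = {x}"
| "wregs (Store A e1 e2) = {}"
| "wregs (Seq c1 c2) = wregs c1 \<union> wregs c2"
| "wregs (Cond b c1 c2) = wregs c1 \<union> wregs c2"
| "wregs (While b c) = wregs c"

primrec warrs :: "com \<Rightarrow> nat set" where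
  "warrs Skip = {}"
| "warrs (Set x e) = {}"
| "warrs (Store A e1 e2) = {A}"
| "warrs (Seq c1 c2) = warrs c1 \<union> warrs c2"
| "warrs (Cond b c1 c2) = warrs c1 \<union> warrs c2"
| "warrs (While b c) = warrs c"

text \<open>A syntactic frame condition. Arrays are tracked as a whole, because the indices of the
  written entries are known only at run time.\<close>

definition frame :: "com \<Rightarrow> state \<Rightarrow> state \<Rightarrow> bool" where
  "frame c s s' \<longleftrightarrow>
    (\<forall>x. x \<notin> wregs c \<longrightarrow> reg s' x = reg s x) \<and> (\<forall>A. A \<notin> warrs c \<longrightarrow> arr s' A = arr s A)"

lemma frame_refl: "frame c s s"
  by (simp add: frame_def)

lemma frame_trans: "frame c s s1 \<Longrightarrow> frame c s1 s2 \<Longrightarrow> frame c s s2"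
  by (simp add: frame_def)

lemma frame_mono:
  "frame c s s' \<Longrightarrow> wregs c \<subseteq> wregs d \<Longrightarrow> warrs c \<subseteq> warrs d \<Longrightarrow> frame d s s'"
  unfolding frame_def by blast

lemma exec_frame: "exec c s t s' \<Longrightarrow> frame c s s'"
  by (induction rule: exec.induct) (auto simp: frame_def)

text \<open>Every postcondition comes with the frame condition for free, so specifications and
  invariants need not list what a program leaves alone.\<close>

lemma runs_conseq:
  assumes "runs c s P" and "\<And>s' t. P s' t \<Longrightarrow> frame c s s' \<Longrightarrow> Q s' t"
  shows "runs c s Q"
  using assms unfolding runs_def by (blast intro: exec_frame)

section \<open>Counting loops and search loops\<close>

definition For :: "nat \<Rightarrow> nat \<Rightarrow> com \<Rightarrow> com" where
  "For x y c =
    Seq (Set x (Num 0)) (While (Less (Reg x) (Reg y)) (Seq c (Set x (Plus (Reg x) (Num 1)))))"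

lemma wregs_For [simp]: "wregs (For x y c) = insert x (wregs c)"
  and warrs_For [simp]: "warrs (For x y c) = warrs c"
  by (auto simp: For_def)

text \<open>The outer 2 counts the first write of the counter and the last, failing test; each round
  adds one test and one increment to the time \<open>T\<close> of the body.\<close>

definition loop_time :: "nat \<Rightarrow> nat \<Rightarrow> nat" where
  "loop_time N T = 2 + N * (T + 2)"

text \<open>\<open>K\<close> is the actual number of rounds and \<open>N\<close> a bound on it, so
  that time bounds of nested loops depend on the input size alone. The invariant is demanded after
  the counter has been increased, which lets it speak about the counter.\<close>

lemma runs_For:
  assumes y: "reg s y = K" "y \<noteq> x" "y \<notin> wregs c" and x: "x \<notin> wregs c"
    and init: "I 0 (s\<lparr>reg := (reg s)(x := 0)\<rparr>)"
    and step: "\<And>k s1. k < K \<Longrightarrow> I k s1 \<Longrightarrow> reg s1 x = k \<Longrightarrow> frame (For x y c) s s1 \<Longrightarrow>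
      runs c s1 (\<lambda>s2 t. t \<le> T \<and> I (Suc k) (s2\<lparr>reg := (reg s2)(x := Suc k)\<rparr>))"
    and K: "K \<le> N"
    and post: "\<And>s' t. I K s' \<Longrightarrow> frame (For x y c) s s' \<Longrightarrow> t \<le> loop_time N T \<Longrightarrow> Q s' t"
  shows "runs (For x y c) s Q"
proof -
  let ?w = "While (Less (Reg x) (Reg y)) (Seq c (Set x (Plus (Reg x) (Num 1))))"
  have loop: "runs ?w s1 (\<lambda>s' t. I K s' \<and> frame (For x y c) s s' \<and> t \<le> 1 + (K - k) * (T + 2))"
    if "k \<le> K" "I k s1" "reg s1 x = k" "frame (For x y c) s s1" for k s1
    using that
  proof (induction "K - k" arbitrary: k s1)
    case 0
    then have "k = K" by simp
    moreover have "reg s1 y = K"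
      using 0 y by (simp add: frame_def)
    ultimately show ?case
      using 0 by (subst runs_While) simp
  next
    case (Suc j)
    then have "k < K" by simp
    have y1: "reg s1 y = K"
      using Suc y by (simp add: frame_def)
    have "runs c s1 (\<lambda>s2 t. t \<le> T \<and> I (Suc k) (s2\<lparr>reg := (reg s2)(x := Suc k)\<rparr>))"
      using step Suc \<open>k < K\<close> by simp
    then have "runs c s1 (\<lambda>s2 t2. runs ?w (s2\<lparr>reg := (reg s2)(x := Suc k)\<rparr>)
      (\<lambda>s' t. I K s' \<and> frame (For x y c) s s' \<and> Suc (t2 + 1 + t) \<le> 1 + (K - k) * (T + 2)))"
    proof (rule runs_conseq)
      fix s2 t2
      assume *: "t2 \<le> T \<and> I (Suc k) (s2\<lparr>reg := (reg s2)(x := Suc k)\<rparr>)" and f: "frame c s1 s2"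
      let ?s = "s2\<lparr>reg := (reg s2)(x := Suc k)\<rparr>"
      have "frame (For x y c) s ?s"
        using f Suc.prems(4) by (auto simp: frame_def)
      then have "runs ?w ?s
          (\<lambda>s' t. I K s' \<and> frame (For x y c) s s' \<and> t \<le> 1 + (K - Suc k) * (T + 2))"
        using * \<open>k < K\<close> Suc.hyps(2) by (intro Suc.hyps(1)) simp_all
      moreover have "(K - k) * (T + 2) = (T + 2) + (K - Suc k) * (T + 2)"
        using \<open>k < K\<close> by (metis Suc_diff_Suc mult_Suc)
      ultimately show "runs ?w ?s
          (\<lambda>s' t. I K s' \<and> frame (For x y c) s s' \<and> Suc (t2 + 1 + t) \<le> 1 + (K - k) * (T + 2))"
        using * by (elim runs_conseq) (simp del: mult_Suc mult_Suc_right add_mult_distrib add_mult_distrib2)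
    qed
    \<comment> \<open>The body leaves \<open>x\<close> alone, so the increment really produces
      \<open>Suc k\<close>.\<close>
    moreover have "runs c s1 P \<Longrightarrow> runs c s1 (\<lambda>s2 t. reg s2 x = k \<and> P s2 t)" for P
      using x Suc.prems(3) by (elim runs_conseq) (simp add: frame_def)
    ultimately have "runs c s1 (\<lambda>s2 t2. reg s2 x = k \<and> runs ?w (s2\<lparr>reg := (reg s2)(x := Suc k)\<rparr>)
      (\<lambda>s' t. I K s' \<and> frame (For x y c) s s' \<and> Suc (t2 + 1 + t) \<le> 1 + (K - k) * (T + 2)))"
      by blast
    then have "runs c s1 (\<lambda>s2 t2. runs ?w (s2\<lparr>reg := (reg s2)(x := reg s2 x + 1)\<rparr>)
      (\<lambda>s' t. I K s' \<and> frame (For x y c) s s' \<and> Suc (t2 + 1 + t) \<le> 1 + (K - k) * (T + 2)))"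
      by (elim runs_conseq) (simp only: Suc_eq_plus1)
    moreover have "bval (Less (Reg x) (Reg y)) s1"
      using \<open>k < K\<close> y1 Suc.prems(3) by simp
    ultimately show ?case
      by (subst runs_While) (simp only: if_True runs_Seq runs_Set aval.simps)
  qed
  have "runs ?w (s\<lparr>reg := (reg s)(x := 0)\<rparr>)
      (\<lambda>s' t. I K s' \<and> frame (For x y c) s s' \<and> t \<le> 1 + (K - 0) * (T + 2))"
    using init by (intro loop) (auto simp: frame_def)
  moreover have "K * (T + 2) \<le> N * (T + 2)"
    using K by (rule mult_le_mono1)
  ultimately have "runs ?w (s\<lparr>reg := (reg s)(x := 0)\<rparr>) (\<lambda>s' t. Q s' (1 + t))"
    by (elim runs_conseq) (rule post, simp_all add: loop_time_def)
  then show ?thesis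
    unfolding For_def runs_Seq runs_Set by (simp only: aval.simps)
qed

text \<open>A loop with a success flag \<open>f\<close> that is never lost. \<open>G k\<close>
  describes when round \<open>k\<close> must succeed. What the flag guarantees about the stored
  result is left to \<open>Inv\<close>, so a later round may replace one result by another.\<close>

lemma runs_search:
  assumes y: "reg s y = K" "y \<noteq> x" "y \<notin> wregs c" and x: "x \<notin> wregs c" "f \<noteq> x"
    and inv: "Inv s" "\<And>s v. Inv s \<Longrightarrow> Inv (s\<lparr>reg := (reg s)(x := v)\<rparr>)"
    and step: "\<And>k s1. k < K \<Longrightarrow> Inv s1 \<Longrightarrow> reg s1 x = k \<Longrightarrow> frame (For x y c) s s1 \<Longrightarrow>
      runs c s1 (\<lambda>s2 t. t \<le> T \<and> Inv s2 \<and> (reg s1 f = 1 \<longrightarrow> reg s2 f = 1) \<and> (G k \<longrightarrow> reg s2 f = 1))"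
    and K: "K \<le> N"
    and post: "\<And>s' t. Inv s' \<Longrightarrow> frame (For x y c) s s' \<Longrightarrow> (reg s f = 1 \<longrightarrow> reg s' f = 1) \<Longrightarrow>
      (\<forall>k<K. G k \<longrightarrow> reg s' f = 1) \<Longrightarrow> t \<le> loop_time N T \<Longrightarrow> Q s' t"
  shows "runs (For x y c) s Q"
proof (rule runs_For[where K = K and T = T and N = N and
      I = "\<lambda>k s'. Inv s' \<and> (reg s f = 1 \<longrightarrow> reg s' f = 1) \<and> (\<forall>j<k. G j \<longrightarrow> reg s' f = 1)"])
  fix k s1
  assume "k < K" and I: "Inv s1 \<and> (reg s f = 1 \<longrightarrow> reg s1 f = 1) \<and> (\<forall>j<k. G j \<longrightarrow> reg s1 f = 1)"
    and "reg s1 x = k" "frame (For x y c) s s1"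
  then have "runs c s1
      (\<lambda>s2 t. t \<le> T \<and> Inv s2 \<and> (reg s1 f = 1 \<longrightarrow> reg s2 f = 1) \<and> (G k \<longrightarrow> reg s2 f = 1))"
    by (intro step) auto
  then show "runs c s1 (\<lambda>s2 t. t \<le> T \<and> Inv (s2\<lparr>reg := (reg s2)(x := Suc k)\<rparr>) \<and>
      (reg s f = 1 \<longrightarrow> reg (s2\<lparr>reg := (reg s2)(x := Suc k)\<rparr>) f = 1) \<and>
      (\<forall>j<Suc k. G j \<longrightarrow> reg (s2\<lparr>reg := (reg s2)(x := Suc k)\<rparr>) f = 1))"
    using I x by (elim runs_conseq) (auto simp: less_Suc_eq intro: inv)
qed (use y x inv(1) K in \<open>auto intro!: inv(2) post\<close>)

section \<open>Polynomially bounded functions\<close>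

definition poly_bounded :: "(nat \<Rightarrow> nat) \<Rightarrow> bool" where
  "poly_bounded f \<longleftrightarrow> (\<exists>p. \<forall>N. f N \<le> poly p N)"

lemma poly_bounded_const: "poly_bounded (\<lambda>_. k)"
  unfolding poly_bounded_def by (rule exI[of _ "[:k:]"]) simp

lemma poly_bounded_id: "poly_bounded (\<lambda>N. N)"
  unfolding poly_bounded_def by (rule exI[of _ "[:0, 1:]"]) simp

lemma poly_bounded_add:
  assumes "poly_bounded f" "poly_bounded g"
  shows "poly_bounded (\<lambda>N. f N + g N)"
proof -
  obtain p q where "\<And>N. f N \<le> poly p N" "\<And>N. g N \<le> poly q N"
    using assms by (auto simp: poly_bounded_def)
  then have "f N + g N \<le> poly (p + q) N" for N
    by (simp add: add_mono)
  then show ?thesis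
    unfolding poly_bounded_def by blast
qed

lemma poly_bounded_mult:
  assumes "poly_bounded f" "poly_bounded g"
  shows "poly_bounded (\<lambda>N. f N * g N)"
proof -
  obtain p q where "\<And>N. f N \<le> poly p N" "\<And>N. g N \<le> poly q N"
    using assms by (auto simp: poly_bounded_def)
  then have "f N * g N \<le> poly (p * q) N" for N
    by (simp add: mult_mono)
  then show ?thesis
    unfolding poly_bounded_def by blast
qed

lemma poly_bounded_loop_time:
  "poly_bounded f \<Longrightarrow> poly_bounded g \<Longrightarrow> poly_bounded (\<lambda>N. loop_time (f N) (g N))"
  unfolding loop_time_def
  by (intro poly_bounded_add poly_bounded_mult poly_bounded_const)

lemmas poly_bounded_intros = poly_bounded_const poly_bounded_id poly_bounded_add
  poly_bounded_mult poly_bounded_loop_time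

section \<open>Searching a path\<close>

definition arc_rel :: "nat set \<Rightarrow> (nat \<Rightarrow> nat) \<Rightarrow> (nat \<Rightarrow> nat) \<Rightarrow> (nat \<times> nat) set" where
  "arc_rel A src tgt = (\<lambda>e. (src e, tgt e)) ` A"

text \<open>Functions together with a length match the arrays in which the program stores a path;
  entries beyond the length are arbitrary.\<close>

definition simple_path ::
    "nat set \<Rightarrow> (nat \<Rightarrow> nat) \<Rightarrow> (nat \<Rightarrow> nat) \<Rightarrow> (nat \<Rightarrow> nat) \<Rightarrow> (nat \<Rightarrow> nat) \<Rightarrow> nat \<Rightarrow> nat \<Rightarrow> nat \<Rightarrow> bool"
where
  "simple_path A src tgt pv pa k u v \<longleftrightarrow>
     pv 0 = u \<and> pv k = v \<and> inj_on pv {..k} \<and>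
     (\<forall>i<k. pa i \<in> A \<and> src (pa i) = pv i \<and> tgt (pa i) = pv (Suc i))"

text \<open>
  \<open>d v - 1\<close> is the number of arcs on the path from \<open>v\<close> to \<open>t\<close> along the pointers \<open>nx\<close>, and \<open>d v = 0\<close>
  means that \<open>v\<close> has not been reached.
\<close>

definition labelling ::
    "nat \<Rightarrow> nat set \<Rightarrow> (nat \<Rightarrow> nat) \<Rightarrow> (nat \<Rightarrow> nat) \<Rightarrow> nat \<Rightarrow> (nat \<Rightarrow> nat) \<Rightarrow> (nat \<Rightarrow> nat) \<Rightarrow> bool"
where
  "labelling n A src tgt t d nx \<longleftrightarrow> d t = 1 \<and>
     (\<forall>v<n. d v \<noteq> 0 \<and> v \<noteq> t \<longrightarrow>
        nx v \<in> A \<and> src (nx v) = v \<and> d (tgt (nx v)) \<noteq> 0 \<and> d v = Suc (d (tgt (nx v))))"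

text \<open>Old labels and pointers stay valid: the pointer of a labelled vertex leads to a labelled
  vertex, hence not to \<open>src e\<close>, and \<open>src e\<close> is not \<open>t\<close>
  either, whose label is 1.\<close>

lemma labelling_update:
  assumes "labelling n A src tgt t d nx" "e \<in> A" "d (src e) = 0" "d (tgt e) \<noteq> 0"
  shows "labelling n A src tgt t (d(src e := Suc (d (tgt e)))) (nx(src e := e))"
  using assms unfolding labelling_def by (auto simp: fun_upd_def)

abbreviation (input) rN :: nat where "rN \<equiv> 0"
abbreviation (input) rM :: nat where "rM \<equiv> 1"
abbreviation (input) rQ :: nat where "rQ \<equiv> 3"
abbreviation (input) rSource :: nat where "rSource \<equiv> 4"
abbreviation (input) rTarget :: nat where "rTarget \<equiv> 5"
abbreviation (input) rRound :: nat where "rRound \<equiv> 6"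
abbreviation (input) rArc :: nat where "rArc \<equiv> 7"
abbreviation (input) rI :: nat where "rI \<equiv> 8"
abbreviation (input) rCur :: nat where "rCur \<equiv> 9"
abbreviation (input) rLen :: nat where "rLen \<equiv> 10"
abbreviation (input) rReached :: nat where "rReached \<equiv> 11"
abbreviation (input) aTail :: nat where "aTail \<equiv> 0"
abbreviation (input) aHead :: nat where "aHead \<equiv> 1"
abbreviation (input) aOn :: nat where "aOn \<equiv> 3"
abbreviation (input) aLabel :: nat where "aLabel \<equiv> 4"
abbreviation (input) aNext :: nat where "aNext \<equiv> 5"
abbreviation (input) aPathV :: nat where "aPathV \<equiv> 9"
abbreviation (input) aPathA :: nat where "aPathA \<equiv> 10"

section \<open>The path search\<close>

definition relax :: com where
  "relax =
    Cond (Conj (Equal (Cell aOn (Reg rArc)) (Num 1))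
           (Conj (Equal (Cell aLabel (Cell aTail (Reg rArc))) (Num 0))
                 (Neg (Equal (Cell aLabel (Cell aHead (Reg rArc))) (Num 0)))))
      (Seq (Store aNext (Cell aTail (Reg rArc)) (Reg rArc))
           (Store aLabel (Cell aTail (Reg rArc)) (Plus (Cell aLabel (Cell aHead (Reg rArc))) (Num 1))))
      Skip"

text \<open>Labels spread backwards from the target, so that the pointers lead forward along the
  path that is wanted. Register \<open>rQ\<close> holds \<open>2 * m\<close>, the number of arcs
  together with their reversed copies; by \<open>reachable_labelled\<close> this many rounds
  suffice.\<close>

definition label :: com where
  "label =
    Seq (For rI rN (Store aLabel (Reg rI) (Num 0)))
   (Seq (Store aLabel (Reg rTarget) (Num 1))
        (For rRound rQ (For rArc rQ relax)))"

text \<open>There is no early exit: once the target has been reached, the remaining ones of the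
  \<open>n\<close> rounds do nothing.\<close>

definition follow :: com where
  "follow =
    Seq (Set rLen (Num 0))
   (Seq (Set rCur (Reg rSource))
   (Seq (Store aPathV (Num 0) (Reg rSource))
        (For rI rN
          (Cond (Equal (Reg rCur) (Reg rTarget)) Skip
            (Seq (Store aPathA (Reg rLen) (Cell aNext (Reg rCur)))
            (Seq (Set rCur (Cell aHead (Cell aNext (Reg rCur))))
            (Seq (Set rLen (Plus (Reg rLen) (Num 1)))
                 (Store aPathV (Reg rLen) (Reg rCur)))))))))"

definition find_path :: com where
  "find_path =
    Seq label
        (Cond (Equal (Cell aLabel (Reg rSource)) (Num 0))
          (Set rReached (Num 0))
          (Seq (Set rReached (Num 1)) follow))"

text \<open>Computing the write sets once lets the simplifier decide what survives a subprogram
  without unfolding its code.\<close>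

lemma wregs_find_path: "wregs find_path = {6, 7, 8, 9, 10, 11}"
  and warrs_find_path: "warrs find_path = {4, 5, 9, 10}"
  by (rule subset_antisym; simp add: find_path_def label_def relax_def follow_def)+

text \<open>Here and in the later time bounds, \<open>N\<close> bounds the length of every loop, and
  the innermost constants count the steps of loop bodies.\<close>

definition label_time :: "nat \<Rightarrow> nat" where
  "label_time N = 1 + loop_time N 1 + loop_time N (loop_time N 3)"

definition follow_time :: "nat \<Rightarrow> nat" where
  "follow_time N = 3 + loop_time N 5"

definition find_time :: "nat \<Rightarrow> nat" where
  "find_time N = 2 + label_time N + follow_time N"

text \<open>The reversed copies of the arcs serve the search in the underlying undirected graph.\<close>

locale doubled_arcs =
  fixes n m :: nat and src tgt :: "nat \<Rightarrow> nat"
  assumes src_less: "e < 2 * m \<Longrightarrow> src e < n"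
    and tgt_less: "e < 2 * m \<Longrightarrow> tgt e < n"
    and src_reverse: "e < m \<Longrightarrow> src (m + e) = tgt e"
    and tgt_reverse: "e < m \<Longrightarrow> tgt (m + e) = src e"
begin

abbreviation N :: nat where "N \<equiv> n + 2 * m"

definition loaded :: "state \<Rightarrow> bool" where
  "loaded s \<longleftrightarrow> reg s rN = n \<and> reg s rM = m \<and> reg s rQ = 2 * m \<and>
     (\<forall>e<2 * m. arr s aTail e = src e \<and> arr s aHead e = tgt e)"

text \<open>Switching arcs on and off lets one path search serve the whole digraph, an induced
  subdigraph, and the underlying graph without one edge and some vertices.\<close>

definition on_arcs :: "state \<Rightarrow> nat set" where
  "on_arcs s = {e. e < 2 * m \<and> arr s aOn e = 1}"

lemma loaded_frame:
  "loaded s \<Longrightarrow> frame c s s' \<Longrightarrow> {0, 1, 3} \<inter> wregs c = {} \<Longrightarrow> {0, 1} \<inter> warrs c = {} \<Longrightarrow> loaded s'"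
  unfolding loaded_def frame_def by (simp add: disjoint_iff)

lemma on_arcs_frame: "frame c s s' \<Longrightarrow> 3 \<notin> warrs c \<Longrightarrow> on_arcs s' = on_arcs s"
  by (simp add: on_arcs_def frame_def)

lemma arc_rel_finite: "A \<subseteq> {..<2 * m} \<Longrightarrow> finite (arc_rel A src tgt) \<and> card (arc_rel A src tgt) \<le> 2 * m"
  unfolding arc_rel_def
  using card_image_le[of A] card_mono[of "{..<2 * m}" A] finite_subset[of A "{..<2 * m}"]
  by (fastforce intro: le_trans)

text \<open>A walk in a finite relation can be shortened to at most as many steps as the relation
  has pairs, and there are at most \<open>2 * m\<close> of them.\<close>

lemma reachable_labelled:
  assumes "A \<subseteq> {..<2 * m}"
    and "\<And>k v. k \<le> 2 * m \<Longrightarrow> (v, t) \<in> arc_rel A src tgt ^^ k \<Longrightarrow> d v \<noteq> (0::nat)"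
    and "(v, t) \<in> (arc_rel A src tgt)\<^sup>*"
  shows "d v \<noteq> 0"
proof -
  obtain k where "k \<le> card (arc_rel A src tgt)" "(v, t) \<in> arc_rel A src tgt ^^ k"
    using assms(3) arc_rel_finite[OF assms(1)] by (auto simp: rtrancl_finite_eq_relpow)
  then show ?thesis
    using assms(2) arc_rel_finite[OF assms(1)] by (meson le_trans)
qed

text \<open>The label drops by one along every pointer, so following the pointers ends at
  \<open>t\<close>.\<close>

lemma labelled_reachable:
  assumes "labelling n A src tgt t d nx" "A \<subseteq> {..<2 * m}" "v < n" "d v \<noteq> 0"
  shows "(v, t) \<in> (arc_rel A src tgt)\<^sup>*"
  using assms(3,4)
proof (induction "d v" arbitrary: v)
  case (Suc k)
  show ?case
  proof (cases "v = t")
    case False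
    then have *: "nx v \<in> A" "src (nx v) = v" "d (tgt (nx v)) \<noteq> 0" "d v = Suc (d (tgt (nx v)))"
      using Suc.prems assms(1) by (auto simp: labelling_def)
    then have "tgt (nx v) < n"
      using assms(2) tgt_less by blast
    then have "(tgt (nx v), t) \<in> (arc_rel A src tgt)\<^sup>*"
      using Suc * by simp
    moreover have "(v, tgt (nx v)) \<in> arc_rel A src tgt"
      using * by (force simp: arc_rel_def)
    ultimately show ?thesis by simp
  qed simp
qed simp

lemma runs_label:
  assumes s: "loaded s" "reg s rTarget = t" "t < n"
    and post: "\<And>s' k. frame label s s' \<Longrightarrow> k \<le> label_time N \<Longrightarrow>
      labelling n (on_arcs s) src tgt t (arr s' aLabel) (arr s' aNext) \<Longrightarrow>
      (\<And>v. (v, t) \<in> (arc_rel (on_arcs s) src tgt)\<^sup>* \<Longrightarrow> arr s' aLabel v \<noteq> 0) \<Longrightarrow> Q s' k"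
  shows "runs label s Q"
proof -
  let ?A = "on_arcs s"
  let ?R = "arc_rel ?A src tgt"
  \<comment> \<open>The invariant bounds the rounds by lengths of walks, although labels need not be
    distances: a label set early in a round may be used again in the same round, so only lengths
    along the pointers are recorded.\<close>
  let ?I = "\<lambda>k s'. labelling n ?A src tgt t (arr s' aLabel) (arr s' aNext) \<and>
    (\<forall>v. \<forall>j\<le>k. (v, t) \<in> ?R ^^ j \<longrightarrow> arr s' aLabel v \<noteq> 0)"
  have A: "?A \<subseteq> {..<2 * m}" by (auto simp: on_arcs_def)
  have rounds: "runs (For rRound rQ (For rArc rQ relax)) s1
      (\<lambda>s' k. ?I (2 * m) s' \<and> k \<le> loop_time N (loop_time N 3))"
    if "loaded s1" "on_arcs s1 = ?A" "?I 0 s1" for s1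
  proof (rule runs_For[where I = ?I and K = "2 * m" and N = N and T = "loop_time N 3"])
    fix k s2
    assume I: "?I k s2" and f2: "frame (For rRound rQ (For rArc rQ relax)) s1 s2"
    have l2: "loaded s2" and A2: "on_arcs s2 = ?A"
      using loaded_frame[OF that(1) f2] on_arcs_frame[OF f2] that(2) by (auto simp: relax_def)
    \<comment> \<open>Only heads labelled at the start of the round count: an arc scanned before its
      head was labelled in this round may still have an unlabelled tail.\<close>
    let ?J = "\<lambda>j s'. labelling n ?A src tgt t (arr s' aLabel) (arr s' aNext) \<and>
      (\<forall>v. arr s2 aLabel v \<noteq> 0 \<longrightarrow> arr s' aLabel v \<noteq> 0) \<and>
      (\<forall>e\<in>?A. e < j \<and> arr s2 aLabel (tgt e) \<noteq> 0 \<longrightarrow> arr s' aLabel (src e) \<noteq> 0)"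
    show "runs (For rArc rQ relax) s2
      (\<lambda>s' t. t \<le> loop_time N 3 \<and> ?I (Suc k) (s'\<lparr>reg := (reg s')(rRound := Suc k)\<rparr>))"
    proof (rule runs_For[where I = ?J and K = "2 * m" and N = N and T = 3])
      fix j s3
      assume J: "?J j s3" and j: "j < 2 * m" "reg s3 rArc = j" and f3: "frame (For rArc rQ relax) s2 s3"
      have l3: "loaded s3" and A3: "on_arcs s3 = ?A"
        using loaded_frame[OF l2 f3] on_arcs_frame[OF f3] A2 by (auto simp: relax_def)
      have on: "arr s3 aOn j = 1 \<longleftrightarrow> j \<in> ?A"
        using j A3 by (auto simp: on_arcs_def)
      have ends: "arr s3 aTail j = src j" "arr s3 aHead j = tgt j"
        using l3 j by (auto simp: loaded_def)
      show "runs relax s3 (\<lambda>s' t. t \<le> 3 \<and> ?J (Suc j) (s'\<lparr>reg := (reg s')(rArc := Suc j)\<rparr>))"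
      proof (cases "j \<in> ?A \<and> arr s3 aLabel (src j) = 0 \<and> arr s3 aLabel (tgt j) \<noteq> 0")
        case True
        then have "labelling n ?A src tgt t ((arr s3 aLabel)(src j := Suc (arr s3 aLabel (tgt j))))
            ((arr s3 aNext)(src j := j))"
          using J by (intro labelling_update) auto
        then show ?thesis
          using True J j on ends by (auto simp: relax_def less_Suc_eq)
      next
        case False
        moreover have "j \<in> ?A \<and> arr s2 aLabel (tgt j) \<noteq> 0 \<longrightarrow> arr s3 aLabel (src j) \<noteq> 0"
          using False J by metis
        ultimately show ?thesis
          using J j on ends by (auto simp: relax_def less_Suc_eq)
      qed
    next
      fix s' t'
      assume J: "?J (2 * m) s'" and t': "t' \<le> loop_time N 3"
      have "arr s' aLabel v \<noteq> 0" if "j \<le> Suc k" "(v, t) \<in> ?R ^^ j" for v j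
      proof (cases "j \<le> k")
        case True
        then show ?thesis using that I J by blast
      next
        case False
        then have "(v, t) \<in> ?R ^^ Suc k"
          using that by (simp add: le_Suc_eq)
        then obtain w where "(v, w) \<in> ?R" and w: "(w, t) \<in> ?R ^^ k"
          by (rule relpow_Suc_E2)
        then obtain e where e: "e \<in> ?A" "src e = v" "tgt e = w"
          by (auto simp: arc_rel_def)
        then have "arr s2 aLabel (tgt e) \<noteq> 0" "e < 2 * m"
          using I A w by auto
        then show ?thesis
          using e J by metis
      qed
      then show "t' \<le> loop_time N 3 \<and> ?I (Suc k) (s'\<lparr>reg := (reg s')(rRound := Suc k)\<rparr>)"
        using J t' by simp
    qed (use I l2 in \<open>auto simp: loaded_def relax_def\<close>)
  qed (use that in \<open>auto simp: loaded_def relax_def\<close>)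
  show ?thesis
    unfolding label_def runs_Seq runs_Store
  proof (rule runs_For[where I = "\<lambda>k s'. \<forall>v<k. arr s' aLabel v = 0" and K = n and N = N and T = 1])
    fix s1 t1
    assume z: "\<forall>v<n. arr s1 aLabel v = 0" and f1: "frame (For rI rN (Store aLabel (Reg rI) (Num 0))) s s1"
      and t1: "t1 \<le> loop_time N 1"
    let ?s = "s1\<lparr>arr := (arr s1)(aLabel := (arr s1 aLabel)(aval (Reg rTarget) s1 := aval (Num 1) s1))\<rparr>"
    have f: "frame label s ?s" "reg s1 rTarget = t"
      using f1 s by (auto simp: frame_def label_def)
    have ld: "loaded ?s" and A1: "on_arcs ?s = ?A"
      using loaded_frame[OF s(1) f1] on_arcs_frame[OF f1] by (auto simp: loaded_def on_arcs_def)
    have I: "?I 0 ?s"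
      using z s(3) f by (auto simp: labelling_def)
    have "runs (For rRound rQ (For rArc rQ relax)) ?s (\<lambda>s' t'. Q s' (t1 + (1 + t')))"
    proof (rule runs_conseq[OF rounds[OF ld A1 I]])
      fix s' k
      assume r: "?I (2 * m) s' \<and> k \<le> loop_time N (loop_time N 3)"
        and f2: "frame (For rRound rQ (For rArc rQ relax)) ?s s'"
      show "Q s' (t1 + (1 + k))"
      proof (rule post)
        show "frame label s s'"
          using f(1) f2 by (rule frame_trans[OF _ frame_mono]) (auto simp: label_def)
        show "arr s' aLabel v \<noteq> 0" if "(v, t) \<in> ?R\<^sup>*" for v
          by (rule reachable_labelled[OF A _ that]) (use r in blast)
      qed (use r t1 in \<open>auto simp: label_time_def\<close>)
    qed
    then show "runs (For rRound rQ (For rArc rQ relax)) ?s (\<lambda>s' t'. Q s' (t1 + (1 + t')))" .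
  qed (use s in \<open>auto simp: loaded_def less_Suc_eq\<close>)
qed

lemma runs_follow:
  assumes s: "loaded s" "reg s rSource = u" "reg s rTarget = t" "u < n" "A \<subseteq> {..<2 * m}"
    and lab: "labelling n A src tgt t (arr s aLabel) (arr s aNext)" "arr s aLabel u \<noteq> 0"
    and post: "\<And>s' k. frame follow s s' \<Longrightarrow> k \<le> follow_time N \<Longrightarrow>
      simple_path A src tgt (arr s' aPathV) (arr s' aPathA) (reg s' rLen) u t \<Longrightarrow> Q s' k"
  shows "runs follow s Q"
proof -
  let ?d = "arr s aLabel"
  let ?nx = "arr s aNext"
  \<comment> \<open>Label plus number of arcs so far is constant, so labels strictly decrease and no
    vertex repeats. The last disjunct says that every round before the arrival at \<open>t\<close>
    has added an arc.\<close>
  let ?I = "\<lambda>j s'. let k = reg s' rLen; c = reg s' rCur; pv = arr s' aPathV; pa = arr s' aPathA in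
    pv 0 = u \<and> pv k = c \<and> c < n \<and> ?d c \<noteq> 0 \<and> (\<forall>i\<le>k. pv i < n \<and> ?d (pv i) + i = ?d u) \<and>
    (\<forall>i<k. pa i \<in> A \<and> src (pa i) = pv i \<and> tgt (pa i) = pv (Suc i)) \<and> (c = t \<or> k = j)"
  let ?s = "s\<lparr>reg := (reg s)(rLen := 0, rCur := u), arr := (arr s)(aPathV := (arr s aPathV)(0 := u))\<rparr>"
  let ?b = "Cond (Equal (Reg rCur) (Reg rTarget)) Skip
            (Seq (Store aPathA (Reg rLen) (Cell aNext (Reg rCur)))
            (Seq (Set rCur (Cell aHead (Cell aNext (Reg rCur))))
            (Seq (Set rLen (Plus (Reg rLen) (Num 1)))
                 (Store aPathV (Reg rLen) (Reg rCur)))))"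
  have "runs (For rI rN ?b) ?s (\<lambda>s' k. Q s' (3 + k))"
  proof (rule runs_For[where I = ?I and K = n and N = N and T = 5])
    fix j s1
    assume I: "?I j s1" and f1: "frame (For rI rN ?b) ?s s1"
    have eqs: "reg s1 rTarget = t" "arr s1 aLabel = ?d" "arr s1 aNext = ?nx"
      using f1 s by (auto simp: frame_def)
    have l1: "loaded s1"
      by (rule loaded_frame[OF _ f1]) (use s in \<open>auto simp: loaded_def\<close>)
    define c where "c = reg s1 rCur"
    show "runs ?b s1 (\<lambda>s2 t. t \<le> 5 \<and> ?I (Suc j) (s2\<lparr>reg := (reg s2)(rI := Suc j)\<rparr>))"
    proof (cases "c = t")
      case True
      then show ?thesis
        using I eqs by (simp add: c_def)
    next
      case False
      then have *: "?nx c \<in> A" "src (?nx c) = c" "?d (tgt (?nx c)) \<noteq> 0" "?d c = Suc (?d (tgt (?nx c)))"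
        using I lab by (auto simp: labelling_def c_def Let_def)
      then have "?nx c < 2 * m" using s(5) by auto
      then have **: "arr s1 aHead (?nx c) = tgt (?nx c)" "tgt (?nx c) < n"
        using l1 tgt_less by (auto simp: loaded_def)
      have "?d c + reg s1 rLen = ?d u"
        using I by (auto simp: c_def Let_def)
      then show ?thesis
        using I False eqs * ** unfolding Let_def
        by (auto simp: c_def[symmetric] less_Suc_eq le_Suc_eq)
    qed
  next
    fix s1 t1
    assume I: "?I n s1" and f1: "frame (For rI rN ?b) ?s s1" and t1: "t1 \<le> loop_time N 5"
    let ?k = "reg s1 rLen"
    have inj: "inj_on (arr s1 aPathV) {..?k}"
    proof (rule inj_onI)
      fix i j
      assume "i \<in> {..?k}" "j \<in> {..?k}" and e: "arr s1 aPathV i = arr s1 aPathV j"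
      then have "?d (arr s1 aPathV i) + i = ?d (arr s1 aPathV j) + j"
        using I by (auto simp: Let_def)
      then show "i = j" using e by simp
    qed
    have "arr s1 aPathV ` {..?k} \<subseteq> {..<n}"
      using I by (auto simp: Let_def)
    \<comment> \<open>The vertices are distinct, so fewer than \<open>n\<close> arcs have been
      followed; after \<open>n\<close> rounds the last disjunct of the invariant therefore leaves
      only the arrival at \<open>t\<close>.\<close>
    then have "card {..?k} \<le> card {..<n}"
      using inj by (intro card_inj_on_le[where f = "arr s1 aPathV"]) auto
    then have "?k < n" by simp
    then have "simple_path A src tgt (arr s1 aPathV) (arr s1 aPathA) ?k u t"
      using I inj by (auto simp: simple_path_def Let_def)
    moreover have "frame follow s s1"
      using f1 by (auto simp: frame_def follow_def)
    ultimately show "Q s1 (3 + t1)"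
      using t1 by (intro post) (auto simp: follow_time_def)
  qed (use s lab in \<open>auto simp: loaded_def\<close>)
  then show ?thesis
    using s by (simp add: follow_def numeral_3_eq_3)
qed

lemma runs_find_path:
  assumes s: "loaded s" "reg s rSource = u" "reg s rTarget = t" "u < n" "t < n"
    and post: "\<And>s' k. frame find_path s s' \<Longrightarrow> k \<le> find_time N \<Longrightarrow>
      (reg s' rReached = 1 \<longleftrightarrow> (u, t) \<in> (arc_rel (on_arcs s) src tgt)\<^sup>*) \<Longrightarrow>
      (reg s' rReached = 1 \<Longrightarrow>
        simple_path (on_arcs s) src tgt (arr s' aPathV) (arr s' aPathA) (reg s' rLen) u t) \<Longrightarrow> Q s' k"
  shows "runs find_path s Q"
  unfolding find_path_def runs_Seq
proof (rule runs_label[OF s(1,3,5)])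
  let ?A = "on_arcs s"
  fix s1 t1
  assume f1: "frame label s s1" and t1: "t1 \<le> label_time N"
    and lab: "labelling n ?A src tgt t (arr s1 aLabel) (arr s1 aNext)"
    and reach: "\<And>v. (v, t) \<in> (arc_rel ?A src tgt)\<^sup>* \<Longrightarrow> arr s1 aLabel v \<noteq> 0"
  have A: "?A \<subseteq> {..<2 * m}" by (auto simp: on_arcs_def)
  have eqs: "reg s1 rSource = u" "reg s1 rTarget = t"
    using f1 s by (auto simp: frame_def label_def relax_def)
  show "runs (Cond (Equal (Cell aLabel (Reg rSource)) (Num 0))
          (Set rReached (Num 0)) (Seq (Set rReached (Num 1)) follow)) s1 (\<lambda>s2 t2. Q s2 (t1 + t2))"
  proof (cases "arr s1 aLabel u = 0")
    case True
    have "Q (s1\<lparr>reg := (reg s1)(rReached := 0)\<rparr>) (t1 + 2)"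
      using True f1 t1 reach[of u] by (intro post) (auto simp: find_path_def find_time_def frame_def)
    then show ?thesis
      using True eqs by simp
  next
    case False
    let ?s = "s1\<lparr>reg := (reg s1)(rReached := 1)\<rparr>"
    have "loaded ?s"
      using loaded_frame[OF s(1) f1] by (auto simp: loaded_def label_def relax_def)
    then have "runs follow ?s (\<lambda>s' k. Q s' (t1 + (1 + (1 + k))))"
    proof (rule runs_follow[OF _ _ _ s(4) A])
      fix s' k
      assume f2: "frame follow ?s s'" and k: "k \<le> follow_time N"
        and p: "simple_path ?A src tgt (arr s' aPathV) (arr s' aPathA) (reg s' rLen) u t"
      have "frame find_path s s'"
        using f1 f2 by (auto simp: frame_def find_path_def)
      moreover have "reg s' rReached = 1"
        using f2 by (simp add: frame_def follow_def)
      ultimately show "Q s' (t1 + (1 + (1 + k)))"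
        using t1 k p labelled_reachable[OF lab A s(4) False]
        by (intro post) (auto simp: find_time_def)
    qed (use eqs lab False in auto)
    then show ?thesis
      using False eqs by simp
  qed
qed

end

section \<open>The program\<close>

abbreviation (input) rBound :: nat where "rBound \<equiv> 12"
abbreviation (input) rChosen :: nat where "rChosen \<equiv> 13"
abbreviation (input) rDicycle :: nat where "rDicycle \<equiv> 14"
abbreviation (input) rCycle :: nat where "rCycle \<equiv> 15"
abbreviation (input) rFound :: nat where "rFound \<equiv> 16"
abbreviation (input) rLenB :: nat where "rLenB \<equiv> 17"
abbreviation (input) rLenC :: nat where "rLenC \<equiv> 18"
abbreviation (input) aMark :: nat where "aMark \<equiv> 6"
abbreviation (input) aB :: nat where "aB \<equiv> 7"
abbreviation (input) aCV :: nat where "aCV \<equiv> 8"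
abbreviation (input) aCE :: nat where "aCE \<equiv> 2"

definition set_arcs :: "bexp \<Rightarrow> com" where
  "set_arcs b =
    For rArc rQ (Cond b (Store aOn (Reg rArc) (Num 1)) (Store aOn (Reg rArc) (Num 0)))"

definition mark_path :: "nat \<Rightarrow> nat \<Rightarrow> com" where
  "mark_path x y =
    Seq (Set rSource (Reg x))
   (Seq (Set rTarget (Reg y))
   (Seq find_path
        (Cond (Equal (Reg rReached) (Num 1))
          (Seq (Set rBound (Plus (Reg rLen) (Num 1)))
               (For rI rBound (Store aMark (Cell aPathV (Reg rI)) (Num 1))))
          Skip)))"

definition mark_paths :: com where
  "mark_paths =
    Seq (For rI rN (Store aMark (Reg rI) (Num 0)))
   (Seq (set_arcs (Less (Reg rArc) (Reg rM)))
   (Seq (mark_path 21 22) (Seq (mark_path 23 24) (mark_path 25 26))))"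

abbreviation tail_marked :: "nat \<Rightarrow> bexp" where
  "tail_marked x \<equiv> Equal (Cell aMark (Cell aTail (Reg x))) (Num 1)"

abbreviation head_marked :: "nat \<Rightarrow> bexp" where
  "head_marked x \<equiv> Equal (Cell aMark (Cell aHead (Reg x))) (Num 1)"

definition try_dicycle :: com where
  "try_dicycle =
    Cond (Equal (Cell aOn (Reg rChosen)) (Num 1))
      (Seq (Set rSource (Cell aHead (Reg rChosen)))
      (Seq (Set rTarget (Cell aTail (Reg rChosen)))
      (Seq find_path
           (Cond (Equal (Reg rReached) (Num 1))
             (Seq (Set rDicycle (Num 1))
             (Seq (Store aB (Num 0) (Reg rChosen))
             (Seq (Set rLenB (Plus (Reg rLen) (Num 1)))
                  (For rI rLen (Store aB (Plus (Reg rI) (Num 1)) (Cell aPathA (Reg rI)))))))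
             Skip))))
      Skip"

definition find_dicycle :: com where
  "find_dicycle =
    Seq (set_arcs (Conj (Less (Reg rArc) (Reg rM)) (Conj (tail_marked rArc) (head_marked rArc))))
   (Seq (Set rDicycle (Num 0))
        (For rChosen rM try_dicycle))"

text \<open>Both copies of the chosen edge are switched off, since its reversed copy alone would
  lead from the head back to the tail. An index of at least \<open>m\<close> belongs to a reversed
  copy, and subtracting \<open>m\<close> recovers the edge.\<close>

definition try_cycle :: com where
  "try_cycle =
    Cond (Conj (Neg (tail_marked rChosen)) (Neg (head_marked rChosen)))
      (Seq (set_arcs
             (Conj (Conj (Neg (Equal (Reg rArc) (Reg rChosen)))
                         (Neg (Equal (Reg rArc) (Plus (Reg rM) (Reg rChosen)))))
                   (Conj (Neg (tail_marked rArc)) (Neg (head_marked rArc)))))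
      (Seq (Set rSource (Cell aHead (Reg rChosen)))
      (Seq (Set rTarget (Cell aTail (Reg rChosen)))
      (Seq find_path
           (Cond (Equal (Reg rReached) (Num 1))
             (Seq (Set rCycle (Num 1))
             (Seq (Set rLenC (Plus (Reg rLen) (Num 1)))
             (Seq (For rI rLen
                    (Seq (Store aCV (Reg rI) (Cell aPathV (Reg rI)))
                         (Cond (Less (Cell aPathA (Reg rI)) (Reg rM))
                           (Store aCE (Reg rI) (Cell aPathA (Reg rI)))
                           (Store aCE (Reg rI) (Minus (Cell aPathA (Reg rI)) (Reg rM))))))
             (Seq (Store aCV (Reg rLen) (Cell aPathV (Reg rLen)))
                  (Store aCE (Reg rLen) (Reg rChosen))))))
             Skip)))))
      Skip"

definition find_cycle :: com where
  "find_cycle = Seq (Set rCycle (Num 0)) (For rChosen rM try_cycle)"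

text \<open>Once a solution has been found, all later attempts are skipped, since they could
  overwrite its arrays and lengths.\<close>

definition attempt :: com where
  "attempt =
    Cond (Equal (Reg rFound) (Num 1)) Skip
      (Seq mark_paths
      (Seq find_dicycle
      (Seq find_cycle
           (Cond (Conj (Equal (Reg rDicycle) (Num 1)) (Equal (Reg rCycle) (Num 1)))
             (Set rFound (Num 1)) Skip))))"

definition setup_arcs :: com where
  "setup_arcs =
    Seq (Set rQ (Plus (Reg rM) (Reg rM)))
        (For rI rM
          (Seq (Store aTail (Plus (Reg rM) (Reg rI)) (Cell aHead (Reg rI)))
               (Store aHead (Plus (Reg rM) (Reg rI)) (Cell aTail (Reg rI)))))"

text \<open>Arrays 0 and 1 hold the arcs until the searches are over, so the dicycle and the
  vertices of the cycle are collected elsewhere and moved only now. The edges of the cycle already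
  lie in array 2, which is \<open>aCE\<close>.\<close>

definition output_solution :: com where
  "output_solution =
    Cond (Equal (Reg rFound) (Num 1))
      (Seq (For rI rLenB (Store 0 (Reg rI) (Cell aB (Reg rI))))
      (Seq (For rI rLenC (Store 1 (Reg rI) (Cell aCV (Reg rI))))
      (Seq (Set 0 (Num 1))
      (Seq (Set 1 (Reg rLenB))
           (Set 2 (Reg rLenC))))))
      (Set 0 (Num 0))"

definition search :: com where
  "search = For 21 rN (For 22 rN (For 23 rN (For 24 rN (For 25 rN (For 26 rN attempt)))))"

definition solve :: com where
  "solve = Seq setup_arcs (Seq search output_solution)"

lemma wregs_mark_path: "wregs (mark_path x y) = {4, 5, 6, 7, 8, 9, 10, 11, 12}"
  and warrs_mark_path: "warrs (mark_path x y) = {4, 5, 6, 9, 10}"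
  by (rule subset_antisym; simp add: mark_path_def wregs_find_path warrs_find_path)+

lemma wregs_mark_paths: "wregs mark_paths = {4, 5, 6, 7, 8, 9, 10, 11, 12}"
  and warrs_mark_paths: "warrs mark_paths = {3, 4, 5, 6, 9, 10}"
  by (rule subset_antisym; simp add: mark_paths_def set_arcs_def wregs_mark_path warrs_mark_path)+

lemma wregs_try_dicycle: "wregs try_dicycle = {4, 5, 6, 7, 8, 9, 10, 11, 14, 17}"
  and warrs_try_dicycle: "warrs try_dicycle = {4, 5, 7, 9, 10}"
  by (rule subset_antisym; simp add: try_dicycle_def wregs_find_path warrs_find_path)+

lemma wregs_find_dicycle: "wregs find_dicycle = {4, 5, 6, 7, 8, 9, 10, 11, 13, 14, 17}"
  and warrs_find_dicycle: "warrs find_dicycle = {3, 4, 5, 7, 9, 10}"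
  by (rule subset_antisym; simp add: find_dicycle_def set_arcs_def wregs_try_dicycle warrs_try_dicycle)+

lemma wregs_try_cycle: "wregs try_cycle = {4, 5, 6, 7, 8, 9, 10, 11, 15, 18}"
  and warrs_try_cycle: "warrs try_cycle = {2, 3, 4, 5, 8, 9, 10}"
  by (rule subset_antisym; simp add: try_cycle_def set_arcs_def wregs_find_path warrs_find_path)+

lemma wregs_find_cycle: "wregs find_cycle = {4, 5, 6, 7, 8, 9, 10, 11, 13, 15, 18}"
  and warrs_find_cycle: "warrs find_cycle = {2, 3, 4, 5, 8, 9, 10}"
  by (rule subset_antisym; simp add: find_cycle_def wregs_try_cycle warrs_try_cycle)+

lemma wregs_attempt: "wregs attempt = {4, 5, 6, 7, 8, 9, 10, 11, 12, 13, 14, 15, 16, 17, 18}"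
  and warrs_attempt: "warrs attempt = {2, 3, 4, 5, 6, 7, 8, 9, 10}"
  by (rule subset_antisym; simp add: attempt_def wregs_mark_paths warrs_mark_paths wregs_find_dicycle
      warrs_find_dicycle wregs_find_cycle warrs_find_cycle)+

lemmas write_sets = wregs_find_path warrs_find_path wregs_mark_path warrs_mark_path
  wregs_mark_paths warrs_mark_paths wregs_try_dicycle warrs_try_dicycle wregs_find_dicycle
  warrs_find_dicycle wregs_try_cycle warrs_try_cycle wregs_find_cycle warrs_find_cycle
  wregs_attempt warrs_attempt

section \<open>Time bounds of the subprograms\<close>

definition mark_path_time :: "nat \<Rightarrow> nat" where
  "mark_path_time N = 5 + find_time N + loop_time N 1"

definition mark_paths_time :: "nat \<Rightarrow> nat" where
  "mark_paths_time N = loop_time N 1 + loop_time N 2 + 3 * mark_path_time N"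

definition try_dicycle_time :: "nat \<Rightarrow> nat" where
  "try_dicycle_time N = 7 + find_time N + loop_time N 1"

definition find_dicycle_time :: "nat \<Rightarrow> nat" where
  "find_dicycle_time N = 1 + loop_time N 2 + loop_time N (try_dicycle_time N)"

definition try_cycle_time :: "nat \<Rightarrow> nat" where
  "try_cycle_time N = 10 + loop_time N 2 + find_time N + loop_time N 3"

definition find_cycle_time :: "nat \<Rightarrow> nat" where
  "find_cycle_time N = 1 + loop_time N (try_cycle_time N)"

definition attempt_time :: "nat \<Rightarrow> nat" where
  "attempt_time N = 3 + mark_paths_time N + find_dicycle_time N + find_cycle_time N"

text \<open>An attempt takes cubic time, as it runs a quadratic path search for each arc; the six
  nested loops raise the degree of the bound to 9.\<close>

definition search_time :: "nat \<Rightarrow> nat" where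
  "search_time N = loop_time N (loop_time N (loop_time N (loop_time N (loop_time N
     (loop_time N (attempt_time N))))))"

definition solve_time :: "nat \<Rightarrow> nat" where
  "solve_time N = 5 + loop_time N 2 + search_time N + 2 * loop_time N 1"

context doubled_arcs
begin

section \<open>Sets, paths and cycles in terms of which the searches are specified\<close>

definition marked :: "state \<Rightarrow> nat set" where
  "marked s = {x. x < n \<and> arr s aMark x = 1}"

text \<open>Written in the shape \<open>{e. e < 2 * m \<and> P e}\<close> in which
  \<open>runs_set_arcs\<close> delivers the arcs that are switched on; \<open>e < m\<close> selects
  the original arcs.\<close>

definition inside :: "nat set \<Rightarrow> nat set" where
  "inside W = {e. e < 2 * m \<and> e < m \<and> src e \<in> W \<and> tgt e \<in> W}"

definition outside :: "nat set \<Rightarrow> nat \<Rightarrow> nat set" where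
  "outside W f = {e. e < 2 * m \<and> e \<noteq> f \<and> e \<noteq> m + f \<and> src e \<notin> W \<and> tgt e \<notin> W}"

abbreviation joined :: "nat set \<Rightarrow> nat \<Rightarrow> nat \<Rightarrow> bool" where
  "joined A u v \<equiv> (u, v) \<in> (arc_rel A src tgt)\<^sup>*"

abbreviation spath where "spath A \<equiv> simple_path A src tgt"

definition path_set :: "nat \<Rightarrow> nat \<Rightarrow> nat set \<Rightarrow> bool" where
  "path_set u v X \<longleftrightarrow> (\<exists>pv pa k. spath {e. e < 2 * m \<and> e < m} pv pa k u v \<and> X = pv ` {..k})"

text \<open>\<open>dicycle_via\<close> and \<open>cycle_via\<close> tell when a search has to
  succeed for a given arc, \<open>dicycle_in\<close> and \<open>cycle_off\<close> what it leaves in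
  the arrays.\<close>

definition dicycle_via :: "nat set \<Rightarrow> nat \<Rightarrow> bool" where
  "dicycle_via W a \<longleftrightarrow> a \<in> inside W \<and> joined (inside W) (tgt a) (src a)"

definition cycle_via :: "nat set \<Rightarrow> nat \<Rightarrow> bool" where
  "cycle_via W f \<longleftrightarrow> f < m \<and> src f \<notin> W \<and> tgt f \<notin> W \<and> joined (outside W f) (tgt f) (src f)"

definition dicycle_in :: "nat set \<Rightarrow> (nat \<Rightarrow> nat) \<Rightarrow> nat \<Rightarrow> bool" where
  "dicycle_in W B l \<longleftrightarrow> (\<exists>a pv pa k. a \<in> inside W \<and> spath (inside W) pv pa k (tgt a) (src a) \<and>
     l = Suc k \<and> B 0 = a \<and> (\<forall>i<k. B (Suc i) = pa i))"

text \<open>Edge \<open>i\<close> has to join the vertices \<open>i\<close> and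
  \<open>i + 1\<close>, so the closing edge \<open>f\<close> comes last: it joins the end
  \<open>src f\<close> of the path to its start \<open>tgt f\<close>.\<close>

definition cycle_off :: "nat set \<Rightarrow> (nat \<Rightarrow> nat) \<Rightarrow> (nat \<Rightarrow> nat) \<Rightarrow> nat \<Rightarrow> bool" where
  "cycle_off W vs fs l \<longleftrightarrow> (\<exists>f pv pa k. f < m \<and> src f \<notin> W \<and> tgt f \<notin> W \<and>
     spath (outside W f) pv pa k (tgt f) (src f) \<and> l = Suc k \<and> (\<forall>i\<le>k. vs i = pv i) \<and> fs k = f \<and>
     (\<forall>i<k. fs i = (if pa i < m then pa i else pa i - m)))"

text \<open>\<open>W\<close> acts as a separator that contains the dicycle and misses the cycle;
  this is how disjointness is recorded.\<close>

definition solved :: "state \<Rightarrow> bool" where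
  "solved s \<longleftrightarrow> (\<exists>W. dicycle_in W (arr s aB) (reg s rLenB) \<and>
     cycle_off W (arr s aCV) (arr s aCE) (reg s rLenC))"

definition good_set :: "nat set \<Rightarrow> bool" where
  "good_set W \<longleftrightarrow> (\<exists>a. dicycle_via W a) \<and> (\<exists>f. cycle_via W f)"

definition good_tuple :: "nat \<Rightarrow> nat \<Rightarrow> nat \<Rightarrow> nat \<Rightarrow> nat \<Rightarrow> nat \<Rightarrow> bool" where
  "good_tuple v1 u1 v2 u2 v3 u3 \<longleftrightarrow>
     joined {e. e < 2 * m \<and> e < m} v1 u1 \<and> joined {e. e < 2 * m \<and> e < m} v2 u2 \<and>
     joined {e. e < 2 * m \<and> e < m} v3 u3 \<and>
     (\<forall>X1 X2 X3. path_set v1 u1 X1 \<and> path_set v2 u2 X2 \<and> path_set v3 u3 X3 \<longrightarrow>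
        good_set (X1 \<union> X2 \<union> X3))"

lemma spath_bounded:
  assumes "spath A pv pa k u v" "A \<subseteq> {..<2 * m}" "u < n"
  shows "k < n" and "i \<le> k \<Longrightarrow> pv i < n"
proof -
  have *: "pv i < n" if "i \<le> k" for i
  proof (cases i)
    case 0
    then show ?thesis using assms by (simp add: simple_path_def)
  next
    case (Suc j)
    then have "pa j \<in> A" "tgt (pa j) = pv i"
      using that assms(1) by (auto simp: simple_path_def)
    then show ?thesis
      using assms(2) tgt_less by fastforce
  qed
  show "i \<le> k \<Longrightarrow> pv i < n" by (rule *)
  have "card {..k} \<le> card {..<n}"
    using assms * by (intro card_inj_on_le[of pv]) (auto simp: simple_path_def)
  then show "k < n" by simp
qed

section \<open>Correctness of the marking and of the two cycle searches\<close>

lemma runs_set_arcs: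
  assumes s: "loaded s"
    and b: "\<And>e s1. e < 2 * m \<Longrightarrow> reg s1 rArc = e \<Longrightarrow> frame (set_arcs b) s s1 \<Longrightarrow> loaded s1 \<Longrightarrow>
      bval b s1 \<longleftrightarrow> P e"
    and post: "\<And>s' t. frame (set_arcs b) s s' \<Longrightarrow> t \<le> loop_time N 2 \<Longrightarrow> loaded s' \<Longrightarrow>
      on_arcs s' = {e. e < 2 * m \<and> P e} \<Longrightarrow> Q s' t"
  shows "runs (set_arcs b) s Q"
  unfolding set_arcs_def
proof (rule runs_For[where K = "2 * m" and N = N and T = 2 and
      I = "\<lambda>k s'. \<forall>e<k. arr s' aOn e = (if P e then 1 else 0)"])
  fix k s1
  let ?c = "Cond b (Store aOn (Reg rArc) (Num 1)) (Store aOn (Reg rArc) (Num 0))"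
  assume k: "k < 2 * m" and I: "\<forall>e<k. arr s1 aOn e = (if P e then 1 else 0)"
    and r: "reg s1 rArc = k" and f: "frame (For rArc rQ ?c) s s1"
  have "loaded s1"
    by (rule loaded_frame[OF s f]) auto
  then have "bval b s1 \<longleftrightarrow> P k"
    using b k r f by (simp add: set_arcs_def)
  then show "runs ?c s1 (\<lambda>s2 t. t \<le> 2 \<and>
      (\<forall>e<Suc k. arr (s2\<lparr>reg := (reg s2)(rArc := Suc k)\<rparr>) aOn e = (if P e then 1 else 0)))"
    using I r by (auto simp: less_Suc_eq)
next
  fix s' t
  let ?c = "Cond b (Store aOn (Reg rArc) (Num 1)) (Store aOn (Reg rArc) (Num 0))"
  assume I: "\<forall>e<2 * m. arr s' aOn e = (if P e then 1 else 0)"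
    and f: "frame (For rArc rQ ?c) s s'" and t: "t \<le> loop_time N 2"
  have "loaded s'"
    by (rule loaded_frame[OF s f]) auto
  moreover have "on_arcs s' = {e. e < 2 * m \<and> P e}"
    using I by (auto simp: on_arcs_def split: if_splits)
  ultimately show "Q s' t"
    using f t by (intro post) (auto simp: set_arcs_def)
qed (use s in \<open>auto simp: loaded_def\<close>)

text \<open>The condition \<open>y \<noteq> 4\<close> is there because register 4,
  \<open>rSource\<close>, is overwritten before register \<open>y\<close> is read.\<close>

lemma runs_mark_path:
  assumes s: "loaded s" "reg s x < n" "reg s y < n" "y \<noteq> 4"
    and post: "\<And>s' t X. frame (mark_path x y) s s' \<Longrightarrow> t \<le> mark_path_time N \<Longrightarrow>
      marked s' = marked s \<union> X \<Longrightarrow>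
      (joined (on_arcs s) (reg s x) (reg s y) \<Longrightarrow>
        \<exists>pv pa k. spath (on_arcs s) pv pa k (reg s x) (reg s y) \<and> X = pv ` {..k}) \<Longrightarrow> Q s' t"
  shows "runs (mark_path x y) s Q"
proof -
  let ?A = "on_arcs s"
  have A: "?A \<subseteq> {..<2 * m}" by (auto simp: on_arcs_def)
  let ?s = "s\<lparr>reg := (reg s)(rSource := reg s x, rTarget := reg s y)\<rparr>"
  let ?rest = "Cond (Equal (Reg rReached) (Num 1))
          (Seq (Set rBound (Plus (Reg rLen) (Num 1)))
               (For rI rBound (Store aMark (Cell aPathV (Reg rI)) (Num 1)))) Skip"
  have main: "runs find_path ?s (\<lambda>s1 t1. runs ?rest s1 (\<lambda>s' t. Q s' (2 + t1 + t)))"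
  proof (rule runs_find_path)
    fix s1 t1
    assume f1: "frame find_path ?s s1" and t1: "t1 \<le> find_time N"
      and r: "reg s1 rReached = 1 \<longleftrightarrow> joined (on_arcs ?s) (reg s x) (reg s y)"
      and p: "reg s1 rReached = 1 \<Longrightarrow>
        spath (on_arcs ?s) (arr s1 aPathV) (arr s1 aPathA) (reg s1 rLen) (reg s x) (reg s y)"
    have A1: "on_arcs ?s = ?A" by (simp add: on_arcs_def)
    have m1: "marked s1 = marked s"
      using f1 by (simp add: marked_def frame_def write_sets)
    have f1': "frame (mark_path x y) s s1"
      using f1 by (auto simp: frame_def mark_path_def)
    show "runs ?rest s1 (\<lambda>s' t. Q s' (2 + t1 + t))"
    proof (cases "reg s1 rReached = 1")
      case False
      then have "Q s1 (2 + t1 + 2)"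
        using f1' t1 m1 r A1 by (intro post[where X = "{}"]) (auto simp: mark_path_time_def)
      then show ?thesis
        using False by simp
    next
      case True
      let ?pv = "arr s1 aPathV" and ?k = "reg s1 rLen"
      note path = p[OF True, unfolded A1]
      note bounded = spath_bounded[OF path A s(2)]
      let ?s1 = "s1\<lparr>reg := (reg s1)(rBound := Suc ?k)\<rparr>"
      have "runs (For rI rBound (Store aMark (Cell aPathV (Reg rI)) (Num 1))) ?s1
        (\<lambda>s' t. Q s' (4 + t1 + t))"
      proof (rule runs_For[where K = "Suc ?k" and N = N and T = 1 and
            I = "\<lambda>j s'. marked s' = marked s \<union> ?pv ` {..<j}"])
        fix j s2
        assume "j < Suc ?k" "reg s2 rI = j" and I: "marked s2 = marked s \<union> ?pv ` {..<j}"
          and f2: "frame (For rI rBound (Store aMark (Cell aPathV (Reg rI)) (Num 1))) ?s1 s2"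
        moreover have "arr s2 aPathV = ?pv"
          using f2 by (simp add: frame_def)
        ultimately show "runs (Store aMark (Cell aPathV (Reg rI)) (Num 1)) s2 (\<lambda>s3 t. t \<le> 1 \<and>
            marked (s3\<lparr>reg := (reg s3)(rI := Suc j)\<rparr>) = marked s \<union> ?pv ` {..<Suc j})"
          using bounded(2)[of j] by (auto simp: marked_def lessThan_Suc set_eq_iff)
      next
        fix s' t
        assume I: "marked s' = marked s \<union> ?pv ` {..<Suc ?k}" and t: "t \<le> loop_time N 1"
          and f2: "frame (For rI rBound (Store aMark (Cell aPathV (Reg rI)) (Num 1))) ?s1 s'"
        show "Q s' (4 + t1 + t)"
        proof (rule post)
          show "frame (mark_path x y) s s'"
            using f1' f2 by (auto simp: frame_def mark_path_def)
          show "marked s' = marked s \<union> ?pv ` {..?k}"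
            using I by (simp add: lessThan_Suc_atMost)
          show "4 + t1 + t \<le> mark_path_time N"
            using t t1 by (simp add: mark_path_time_def)
        qed (use path in blast)
      qed (use m1 bounded(1) in \<open>auto simp: marked_def\<close>)
      then show ?thesis
        using True by (simp add: eval_nat_numeral)
    qed
  qed (use s in \<open>auto simp: loaded_def\<close>)
  have "Suc (Suc (t1 + t)) = 2 + t1 + t" for t1 t :: nat by simp
  then show ?thesis
    using s main unfolding mark_path_def by (simp del: runs_Cond)
qed

lemma runs_mark_paths:
  assumes s: "loaded s" "\<And>x. x \<in> {21..26} \<Longrightarrow> reg s x < n"
    and post: "\<And>s' t. frame mark_paths s s' \<Longrightarrow> t \<le> mark_paths_time N \<Longrightarrow>
      (good_tuple (reg s 21) (reg s 22) (reg s 23) (reg s 24) (reg s 25) (reg s 26) \<Longrightarrow>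
        good_set (marked s')) \<Longrightarrow> Q s' t"
  shows "runs mark_paths s Q"
proof -
  let ?c0 = "For rI rN (Store aMark (Reg rI) (Num 0))"
  let ?c1 = "set_arcs (Less (Reg rArc) (Reg rM))"
  let ?A = "{e. e < 2 * m \<and> e < m}"
  \<comment> \<open>One of three chained calls, with the marks made so far in \<open>W\<close>. The
    ends are always read off the initial state \<open>s\<close>, because registers 21 to 26 are not
    written by \<open>mark_paths\<close>.\<close>
  have step: "runs (mark_path x y) s1 Q'"
    if "frame mark_paths s s1" "on_arcs s1 = ?A" "marked s1 = W" "x \<in> {21..26}" "y \<in> {21..26}"
      and "\<And>s' t X. frame mark_paths s s' \<Longrightarrow> on_arcs s' = ?A \<Longrightarrow> marked s' = W \<union> X \<Longrightarrow>
        t \<le> mark_path_time N \<Longrightarrow>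
        (joined ?A (reg s x) (reg s y) \<Longrightarrow> path_set (reg s x) (reg s y) X) \<Longrightarrow> Q' s' t"
    for x y s1 Q' W
  proof (rule runs_mark_path)
    have regs: "reg s1 x = reg s x" "reg s1 y = reg s y"
      using that(1,4,5) by (auto simp: frame_def write_sets)
    then show "reg s1 x < n" "reg s1 y < n"
      using that(4,5) s(2) by auto
    show "loaded s1"
      by (rule loaded_frame[OF s(1) that(1)]) (auto simp: write_sets)
    show "y \<noteq> 4" using that(5) by auto
    fix s' t X
    assume f: "frame (mark_path x y) s1 s'" and t: "t \<le> mark_path_time N"
      and m: "marked s' = marked s1 \<union> X"
      and p: "joined (on_arcs s1) (reg s1 x) (reg s1 y) \<Longrightarrow>
        \<exists>pv pa k. spath (on_arcs s1) pv pa k (reg s1 x) (reg s1 y) \<and> X = pv ` {..k}"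
    show "Q' s' t"
    proof (rule that(6))
      show "frame mark_paths s s'"
        by (rule frame_trans[OF that(1) frame_mono[OF f]]) (auto simp: write_sets)
      show "on_arcs s' = ?A"
        using on_arcs_frame[OF f] that(2) by (simp add: write_sets)
      show "marked s' = W \<union> X" using m that(3) by simp
      show "path_set (reg s x) (reg s y) X" if "joined ?A (reg s x) (reg s y)"
        using p that \<open>on_arcs s1 = ?A\<close> regs by (simp add: path_set_def)
    qed (rule t)
  qed
  show ?thesis
    unfolding mark_paths_def runs_Seq
  proof (rule runs_For[where K = n and N = N and T = 1 and I = "\<lambda>j s'. \<forall>x<j. arr s' aMark x = 0"])
    fix s1 t1
    assume z: "\<forall>x<n. arr s1 aMark x = 0" and f1: "frame ?c0 s s1" and t1: "t1 \<le> loop_time N 1"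
    have l1: "loaded s1"
      by (rule loaded_frame[OF s(1) f1]) auto
    show "runs ?c1 s1 (\<lambda>s2 t2. runs (mark_path 21 22) s2 (\<lambda>s3 t3. runs (mark_path 23 24) s3
        (\<lambda>s4 t4. runs (mark_path 25 26) s4 (\<lambda>s5 t5. Q s5 (t1 + (t2 + (t3 + (t4 + t5))))))))"
    proof (rule runs_set_arcs[OF l1, where P = "\<lambda>e. e < m"])
      fix s2 t2
      assume f2: "frame ?c1 s1 s2" and t2: "t2 \<le> loop_time N 2" and A2: "on_arcs s2 = ?A"
      have f: "frame mark_paths s s2"
        using f1 f2 by (auto simp: frame_def mark_paths_def set_arcs_def)
      have m2: "marked s2 = {}"
        using z f2 by (auto simp: frame_def marked_def set_arcs_def)
      show "runs (mark_path 21 22) s2 (\<lambda>s3 t3. runs (mark_path 23 24) s3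
        (\<lambda>s4 t4. runs (mark_path 25 26) s4 (\<lambda>s5 t5. Q s5 (t1 + (t2 + (t3 + (t4 + t5)))))))"
      proof (rule step[OF f A2 m2], goal_cases)
        case (3 s3 t3 X1)
        note X1 = 3(4,5)
        show ?case
        proof (rule step[OF 3(1-3)], goal_cases)
          case (3 s4 t4 X2)
          note X2 = 3(4,5)
          show ?case
          proof (rule step[OF 3(1-3)], goal_cases)
            case (3 s5 t5 X3)
            note X3 = 3(4,5)
            show ?case
            proof (rule post[OF 3(1)])
              show "t1 + (t2 + (t3 + (t4 + t5))) \<le> mark_paths_time N"
                using t1 t2 X1(1) X2(1) X3(1) by (simp add: mark_paths_time_def)
            next
              assume "good_tuple (reg s 21) (reg s 22) (reg s 23) (reg s 24) (reg s 25) (reg s 26)"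
              then have "good_set (X1 \<union> X2 \<union> X3)"
                using X1(2) X2(2) X3(2) unfolding good_tuple_def by blast
              then show "good_set (marked s5)"
                using 3(3) by simp
            qed
          qed auto
        qed auto
      qed auto
    qed (auto simp: loaded_def)
  qed (use s in \<open>auto simp: loaded_def less_Suc_eq\<close>)
qed


text \<open>A failed search leaves \<open>aB\<close> and \<open>rLenB\<close> untouched, so an
  earlier dicycle remains valid; a successful one replaces it completely.\<close>

lemma runs_try_dicycle:
  assumes s: "loaded s" "on_arcs s = inside W" "reg s rChosen < m" "marked s = W"
    and inv: "reg s rDicycle = 1 \<longrightarrow> dicycle_in W (arr s aB) (reg s rLenB)"
    and post: "\<And>s' t. frame try_dicycle s s' \<Longrightarrow> t \<le> try_dicycle_time N \<Longrightarrow>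
      (reg s' rDicycle = 1 \<longrightarrow> dicycle_in W (arr s' aB) (reg s' rLenB)) \<Longrightarrow>
      (reg s rDicycle = 1 \<or> dicycle_via W (reg s rChosen) \<longrightarrow> reg s' rDicycle = 1) \<Longrightarrow> Q s' t"
  shows "runs try_dicycle s Q"
proof (cases "reg s rChosen \<in> inside W")
  case False
  then have "reg s rChosen \<notin> on_arcs s"
    using s(2) by simp
  then have off: "arr s aOn (reg s rChosen) \<noteq> 1"
    using s(3) by (simp add: on_arcs_def)
  have "Q s 2"
    using False inv by (intro post frame_refl) (auto simp: try_dicycle_time_def dicycle_via_def)
  then show ?thesis
    using off by (simp add: try_dicycle_def eval_nat_numeral)
next
  case True
  define a where "a = reg s rChosen"
  have a: "a \<in> inside W" "a < 2 * m"
    using True by (auto simp: a_def inside_def)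
  have on: "arr s aOn a = 1"
    using True s(2)[symmetric] unfolding a_def by (simp add: on_arcs_def)
  have ends: "arr s aTail a = src a" "arr s aHead a = tgt a"
    using s(1) a by (auto simp: loaded_def)
  have A: "inside W \<subseteq> {..<2 * m}" by (auto simp: inside_def)
  let ?s = "s\<lparr>reg := (reg s)(rSource := tgt a, rTarget := src a)\<rparr>"
  let ?copy = "For rI rLen (Store aB (Plus (Reg rI) (Num 1)) (Cell aPathA (Reg rI)))"
  let ?rest = "Cond (Equal (Reg rReached) (Num 1))
             (Seq (Set rDicycle (Num 1))
             (Seq (Store aB (Num 0) (Reg rChosen))
             (Seq (Set rLenB (Plus (Reg rLen) (Num 1))) ?copy))) Skip"
  have main: "runs find_path ?s (\<lambda>s1 t1. runs ?rest s1 (\<lambda>s' t. Q s' (Suc (Suc (Suc (t1 + t))))))"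
  proof (rule runs_find_path)
    fix s1 t1
    assume f1: "frame find_path ?s s1" and t1: "t1 \<le> find_time N"
      and r: "reg s1 rReached = 1 \<longleftrightarrow> joined (on_arcs ?s) (tgt a) (src a)"
      and p: "reg s1 rReached = 1 \<Longrightarrow>
        spath (on_arcs ?s) (arr s1 aPathV) (arr s1 aPathA) (reg s1 rLen) (tgt a) (src a)"
    have A1: "on_arcs ?s = inside W" using s(2) by (simp add: on_arcs_def)
    have f: "frame try_dicycle s s1"
      using f1 by (auto simp: frame_def write_sets)
    have regs: "reg s1 rChosen = a" "reg s1 rDicycle = reg s rDicycle"
      "reg s1 rLenB = reg s rLenB" "arr s1 aB = arr s aB"
      using f1 by (auto simp: frame_def write_sets a_def)
    show "runs ?rest s1 (\<lambda>s' t. Q s' (Suc (Suc (Suc (t1 + t)))))"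
    proof (cases "reg s1 rReached = 1")
      case False
      then have "Q s1 (Suc (Suc (Suc (t1 + 2))))"
        using f t1 r A1 inv regs
        by (intro post) (auto simp: try_dicycle_time_def dicycle_via_def a_def)
      then show ?thesis
        using False by simp
    next
      case True
      let ?pa = "arr s1 aPathA" and ?k = "reg s1 rLen"
      note path = p[OF True, unfolded A1]
      have k: "?k < n"
        by (rule spath_bounded(1)[OF path A tgt_less[OF a(2)]])
      let ?s1 = "s1\<lparr>arr := (arr s1)(aB := (arr s1 aB)(0 := a)),
        reg := (reg s1)(rDicycle := 1, rLenB := Suc ?k)\<rparr>"
      have "runs ?copy ?s1 (\<lambda>s' t. Q s' (Suc (Suc (Suc (t1 + (Suc (Suc (Suc (Suc t)))))))))"
      proof (rule runs_For[where K = ?k and N = N and T = 1 and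
            I = "\<lambda>j s'. arr s' aB 0 = a \<and> (\<forall>i<j. arr s' aB (Suc i) = ?pa i)"])
        fix j s2
        assume "reg s2 rI = j" "arr s2 aB 0 = a \<and> (\<forall>i<j. arr s2 aB (Suc i) = ?pa i)"
          and f2: "frame ?copy ?s1 s2"
        moreover have "arr s2 aPathA = ?pa"
          using f2 by (simp add: frame_def)
        ultimately show "runs (Store aB (Plus (Reg rI) (Num 1)) (Cell aPathA (Reg rI))) s2
          (\<lambda>s3 t. t \<le> 1 \<and> arr (s3\<lparr>reg := (reg s3)(rI := Suc j)\<rparr>) aB 0 = a \<and>
            (\<forall>i<Suc j. arr (s3\<lparr>reg := (reg s3)(rI := Suc j)\<rparr>) aB (Suc i) = ?pa i))"
          by (auto simp: less_Suc_eq)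
      next
        fix s' t
        assume I: "arr s' aB 0 = a \<and> (\<forall>i<?k. arr s' aB (Suc i) = ?pa i)"
          and t: "t \<le> loop_time N 1" and f2: "frame ?copy ?s1 s'"
        have eqs: "reg s' rDicycle = 1" "reg s' rLenB = Suc ?k"
          using f2 by (auto simp: frame_def)
        show "Q s' (Suc (Suc (Suc (t1 + (Suc (Suc (Suc (Suc t))))))))"
        proof (rule post)
          show "frame try_dicycle s s'"
            using f f2 by (auto simp: frame_def write_sets)
          show "reg s' rDicycle = 1 \<longrightarrow> dicycle_in W (arr s' aB) (reg s' rLenB)"
            unfolding dicycle_in_def eqs(2)
            by (intro impI exI[of _ a] exI[of _ "arr s1 aPathV"] exI[of _ ?pa] exI[of _ ?k])
              (use path a(1) I in simp)
        qed (use t t1 eqs in \<open>auto simp: try_dicycle_time_def\<close>)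
      qed (use k in auto)
      then show ?thesis
        using True regs by (simp add: fun_upd_twist)
    qed
  qed (use a s src_less tgt_less in \<open>auto simp: loaded_def\<close>)
  show ?thesis
    using main on ends unfolding try_dicycle_def a_def[symmetric]
    by (subst runs_Cond) (simp del: runs_Cond flip: a_def)
qed


lemma mark_tests:
  assumes "loaded s" "marked s = W" "reg s x = e" "e < 2 * m"
  shows "bval (tail_marked x) s \<longleftrightarrow> src e \<in> W" "bval (head_marked x) s \<longleftrightarrow> tgt e \<in> W"
  using assms src_less tgt_less by (auto simp: loaded_def marked_def)

lemma marked_frame: "frame c s s' \<Longrightarrow> 6 \<notin> warrs c \<Longrightarrow> marked s' = marked s"
  by (simp add: marked_def frame_def)

lemma loadedD: "loaded s \<Longrightarrow> reg s 0 = n \<and> reg s (Suc 0) = m \<and> reg s 3 = 2 * m"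
  by (simp add: loaded_def)

lemma loaded_update [simp]: "x \<notin> {0, 1, 3} \<Longrightarrow> loaded (s\<lparr>reg := (reg s)(x := v)\<rparr>) \<longleftrightarrow> loaded s"
  by (simp add: loaded_def)

lemma on_arcs_update [simp]: "on_arcs (s\<lparr>reg := r\<rparr>) = on_arcs s"
  by (simp add: on_arcs_def)

lemma marked_update [simp]: "marked (s\<lparr>reg := r\<rparr>) = marked s"
  by (simp add: marked_def)

lemma runs_find_dicycle:
  assumes s: "loaded s" "marked s = W"
    and post: "\<And>s' t. frame find_dicycle s s' \<Longrightarrow> t \<le> find_dicycle_time N \<Longrightarrow>
      (reg s' rDicycle = 1 \<longrightarrow> dicycle_in W (arr s' aB) (reg s' rLenB)) \<Longrightarrow>
      (\<forall>a. dicycle_via W a \<longrightarrow> reg s' rDicycle = 1) \<Longrightarrow> Q s' t"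
  shows "runs find_dicycle s Q"
  unfolding find_dicycle_def runs_Seq runs_Set
proof (rule runs_set_arcs[OF s(1), where P = "\<lambda>e. e < m \<and> src e \<in> W \<and> tgt e \<in> W"])
  let ?b = "Conj (Less (Reg rArc) (Reg rM)) (Conj (tail_marked rArc) (head_marked rArc))"
  fix e s1
  assume e: "e < 2 * m" "reg s1 rArc = e" and f: "frame (set_arcs ?b) s s1" and l: "loaded s1"
  have "marked s1 = W"
    using marked_frame[OF f] s(2) by (simp add: set_arcs_def)
  with l show "bval ?b s1 \<longleftrightarrow> e < m \<and> src e \<in> W \<and> tgt e \<in> W"
    using mark_tests[of s1 W rArc e] e by (auto simp: loaded_def)
next
  let ?b = "Conj (Less (Reg rArc) (Reg rM)) (Conj (tail_marked rArc) (head_marked rArc))"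
  fix s1 t1
  assume f1: "frame (set_arcs ?b) s s1" and t1: "t1 \<le> loop_time N 2" and l1: "loaded s1"
    and "on_arcs s1 = {e. e < 2 * m \<and> e < m \<and> src e \<in> W \<and> tgt e \<in> W}"
  then have A1: "on_arcs s1 = inside W" by (simp add: inside_def)
  have m1: "marked s1 = W"
    using marked_frame[OF f1] s(2) by (simp add: set_arcs_def)
  let ?s1 = "s1\<lparr>reg := (reg s1)(rDicycle := aval (Num 0) s1)\<rparr>"
  let ?Inv = "\<lambda>s'. loaded s' \<and> on_arcs s' = inside W \<and> marked s' = W \<and>
    (reg s' rDicycle = 1 \<longrightarrow> dicycle_in W (arr s' aB) (reg s' rLenB))"
  show "runs (For rChosen rM try_dicycle) ?s1 (\<lambda>s2 t2. Q s2 (t1 + (1 + t2)))"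
  proof (rule runs_search[where Inv = ?Inv and G = "dicycle_via W" and f = rDicycle and K = m
        and N = N and T = "try_dicycle_time N"])
    fix k s2
    assume k: "k < m" "reg s2 rChosen = k" and I: "?Inv s2"
    show "runs try_dicycle s2 (\<lambda>s3 t. t \<le> try_dicycle_time N \<and> ?Inv s3 \<and>
        (reg s2 rDicycle = 1 \<longrightarrow> reg s3 rDicycle = 1) \<and> (dicycle_via W k \<longrightarrow> reg s3 rDicycle = 1))"
    proof (rule runs_try_dicycle[where W = W])
      fix s' t
      assume f: "frame try_dicycle s2 s'" and t: "t \<le> try_dicycle_time N"
        and d: "reg s' rDicycle = 1 \<longrightarrow> dicycle_in W (arr s' aB) (reg s' rLenB)"
        and g: "reg s2 rDicycle = 1 \<or> dicycle_via W (reg s2 rChosen) \<longrightarrow> reg s' rDicycle = 1"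
      have "loaded s'"
        by (rule loaded_frame[OF _ f]) (use I in \<open>auto simp: write_sets\<close>)
      then show "t \<le> try_dicycle_time N \<and> ?Inv s' \<and> (reg s2 rDicycle = 1 \<longrightarrow> reg s' rDicycle = 1) \<and>
          (dicycle_via W k \<longrightarrow> reg s' rDicycle = 1)"
        using t d g k I on_arcs_frame[OF f] marked_frame[OF f] by (simp add: write_sets)
    qed (use I k in auto)
  next
    fix s' t
    assume I: "?Inv s'" and f: "frame (For rChosen rM try_dicycle) ?s1 s'"
      and g: "\<forall>k<m. dicycle_via W k \<longrightarrow> reg s' rDicycle = 1"
      and t: "t \<le> loop_time N (try_dicycle_time N)"
    show "Q s' (t1 + (1 + t))"
    proof (rule post)
      show "frame find_dicycle s s'"
        using f1 f by (auto simp: frame_def find_dicycle_def)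
      show "\<forall>a. dicycle_via W a \<longrightarrow> reg s' rDicycle = 1"
        using g by (auto simp: dicycle_via_def inside_def)
    qed (use I t t1 in \<open>auto simp: find_dicycle_time_def\<close>)
  qed (use l1 A1 m1 in \<open>simp_all add: loadedD write_sets\<close>)
qed

text \<open>Unlike for dicycles, the arcs that are switched on depend on the chosen edge and are set
  anew each time, so they are no part of the loop invariant.\<close>

lemma runs_try_cycle:
  assumes s: "loaded s" "reg s rChosen < m" "marked s = W"
    and inv: "reg s rCycle = 1 \<longrightarrow> cycle_off W (arr s aCV) (arr s aCE) (reg s rLenC)"
    and post: "\<And>s' t. frame try_cycle s s' \<Longrightarrow> t \<le> try_cycle_time N \<Longrightarrow>
      (reg s' rCycle = 1 \<longrightarrow> cycle_off W (arr s' aCV) (arr s' aCE) (reg s' rLenC)) \<Longrightarrow>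
      (reg s rCycle = 1 \<or> cycle_via W (reg s rChosen) \<longrightarrow> reg s' rCycle = 1) \<Longrightarrow> Q s' t"
  shows "runs try_cycle s Q"
proof -
  define g where "g = reg s rChosen"
  have g: "g < m" "g < 2 * m" using s(2) by (auto simp: g_def)
  let ?off = "Conj (Neg (tail_marked rChosen)) (Neg (head_marked rChosen))"
  let ?b = "Conj (Conj (Neg (Equal (Reg rArc) (Reg rChosen)))
                         (Neg (Equal (Reg rArc) (Plus (Reg rM) (Reg rChosen)))))
                   (Conj (Neg (tail_marked rArc)) (Neg (head_marked rArc)))"
  let ?body = "Seq (Store aCV (Reg rI) (Cell aPathV (Reg rI)))
                         (Cond (Less (Cell aPathA (Reg rI)) (Reg rM))
                           (Store aCE (Reg rI) (Cell aPathA (Reg rI)))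
                           (Store aCE (Reg rI) (Minus (Cell aPathA (Reg rI)) (Reg rM))))"
  let ?copy = "For rI rLen ?body"
  let ?rest = "Cond (Equal (Reg rReached) (Num 1))
             (Seq (Set rCycle (Num 1))
             (Seq (Set rLenC (Plus (Reg rLen) (Num 1)))
             (Seq ?copy
             (Seq (Store aCV (Reg rLen) (Cell aPathV (Reg rLen)))
                  (Store aCE (Reg rLen) (Reg rChosen))))))
             Skip"
  have off: "bval ?off s \<longleftrightarrow> src g \<notin> W \<and> tgt g \<notin> W"
    using mark_tests[OF s(1,3) _ g(2), of rChosen] by (simp add: g_def)
  show ?thesis
  proof (cases "bval ?off s")
    case False
    then have "Q s (Suc 1)"
      using off inv by (intro post frame_refl) (auto simp: try_cycle_time_def cycle_via_def g_def)
    then show ?thesis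
      unfolding try_cycle_def by (subst runs_Cond) (simp only: False if_False runs_Skip)
  next
    case True
    then have gW: "src g \<notin> W" "tgt g \<notin> W" using off by auto
    have A: "outside W g \<subseteq> {..<2 * m}" by (auto simp: outside_def)
    have main: "runs (set_arcs ?b) s (\<lambda>s1 t1. runs find_path
      (s1\<lparr>reg := (reg s1)(rSource := tgt g, rTarget := src g)\<rparr>)
      (\<lambda>s2 t2. runs ?rest s2 (\<lambda>s' t. Q s' (Suc (t1 + (1 + (1 + (t2 + t))))))))"
    proof (rule runs_set_arcs[OF s(1),
          where P = "\<lambda>e. e \<noteq> g \<and> e \<noteq> m + g \<and> src e \<notin> W \<and> tgt e \<notin> W"])
      fix e s1
      assume e: "e < 2 * m" "reg s1 rArc = e" and f: "frame (set_arcs ?b) s s1" and l: "loaded s1"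
      have "marked s1 = W" "reg s1 rChosen = g"
        using marked_frame[OF f] s(3) f by (auto simp: set_arcs_def frame_def g_def)
      with l show "bval ?b s1 \<longleftrightarrow> e \<noteq> g \<and> e \<noteq> m + g \<and> src e \<notin> W \<and> tgt e \<notin> W"
        using mark_tests[of s1 W rArc e] e by (auto simp: loaded_def)
    next
      fix s1 t1
      assume f1: "frame (set_arcs ?b) s s1" and t1: "t1 \<le> loop_time N 2" and l1: "loaded s1"
        and "on_arcs s1 = {e. e < 2 * m \<and> e \<noteq> g \<and> e \<noteq> m + g \<and> src e \<notin> W \<and> tgt e \<notin> W}"
      then have A1: "on_arcs s1 = outside W g" by (simp add: outside_def)
      let ?s1 = "s1\<lparr>reg := (reg s1)(rSource := tgt g, rTarget := src g)\<rparr>"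
      have l1': "loaded ?s1" using l1 by (simp add: loaded_def)
      show "runs find_path ?s1
        (\<lambda>s2 t2. runs ?rest s2 (\<lambda>s' t. Q s' (Suc (t1 + (1 + (1 + (t2 + t)))))))"
      proof (rule runs_find_path[OF l1'])
        fix s2 t2
        assume f2: "frame find_path ?s1 s2" and t2: "t2 \<le> find_time N"
          and r: "reg s2 rReached = 1 \<longleftrightarrow> joined (on_arcs ?s1) (tgt g) (src g)"
          and p: "reg s2 rReached = 1 \<Longrightarrow>
            spath (on_arcs ?s1) (arr s2 aPathV) (arr s2 aPathA) (reg s2 rLen) (tgt g) (src g)"
        have f: "frame try_cycle s s2"
          using f1 f2 by (auto simp: frame_def write_sets set_arcs_def)
        have regs: "reg s2 rChosen = g" "reg s2 rCycle = reg s rCycle" "reg s2 rM = m"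
          "reg s2 rLenC = reg s rLenC" "arr s2 aCV = arr s aCV" "arr s2 aCE = arr s aCE"
          using f1 f2 s(1) by (auto simp: frame_def write_sets set_arcs_def g_def loaded_def)
        show "runs ?rest s2 (\<lambda>s' t. Q s' (Suc (t1 + (1 + (1 + (t2 + t))))))"
        proof (cases "reg s2 rReached = 1")
          case False
          then have "Q s2 (Suc (t1 + (1 + (1 + (t2 + 2)))))"
            using f t1 t2 r A1 inv regs
            by (intro post) (auto simp: try_cycle_time_def cycle_via_def g_def)
          then show ?thesis
            using False by simp
        next
          case True
          let ?pv = "arr s2 aPathV" and ?pa = "arr s2 aPathA" and ?k = "reg s2 rLen"
          have path: "spath (outside W g) ?pv ?pa ?k (tgt g) (src g)"
            using p[OF True] A1 by simp
          have k: "?k < n"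
            by (rule spath_bounded(1)[OF path A tgt_less[OF g(2)]])
          let ?s2 = "s2\<lparr>reg := (reg s2)(rCycle := 1, rLenC := Suc ?k)\<rparr>"
          let ?fin = "\<lambda>s'. s'\<lparr>arr := (arr s')(aCV := (arr s' aCV)(?k := ?pv ?k),
            aCE := (arr s' aCE)(?k := g))\<rparr>"
          let ?I = "\<lambda>j s'. \<forall>i<j. arr s' aCV i = ?pv i \<and>
              arr s' aCE i = (if ?pa i < m then ?pa i else ?pa i - m)"
          \<comment> \<open>The 8 consists of two tests, four register writes and the two stores
            after the copying loop, which \<open>?fin\<close> anticipates: the last vertex and the
            closing edge at index \<open>?k\<close>.\<close>
          have "runs ?copy ?s2 (\<lambda>s' t. frame ?copy ?s2 s' \<and> Q (?fin s') (8 + t1 + t2 + t))"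
          proof (rule runs_For[where K = ?k and N = N and T = 3 and I = ?I])
            fix j s3
            assume "reg s3 rI = j" "?I j s3" and f3: "frame ?copy ?s2 s3"
            moreover have "arr s3 aPathA = ?pa" "arr s3 aPathV = ?pv" "reg s3 rM = m"
              using f3 regs by (auto simp: frame_def)
            ultimately show "runs ?body s3
              (\<lambda>s4 t. t \<le> 3 \<and> ?I (Suc j) (s4\<lparr>reg := (reg s4)(rI := Suc j)\<rparr>))"
              by (auto simp: less_Suc_eq)
          next
            fix s' t
            assume I: "?I ?k s'" and t: "t \<le> loop_time N 3" and f3: "frame ?copy ?s2 s'"
            have eqs: "reg (?fin s') rCycle = 1" "reg (?fin s') rLenC = Suc ?k"
              using f3 by (auto simp: frame_def)
            have "Q (?fin s') (8 + t1 + t2 + t)"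
            proof (rule post)
              show "frame try_cycle s (?fin s')"
                using f f3 by (auto simp: frame_def write_sets)
              have "cycle_off W (arr (?fin s') aCV) (arr (?fin s') aCE) (Suc ?k)"
                unfolding cycle_off_def
                by (intro exI[of _ g] exI[of _ ?pv] exI[of _ ?pa] exI[of _ ?k])
                  (use path g gW I in \<open>simp add: le_less\<close>)
              then show "reg (?fin s') rCycle = 1 \<longrightarrow>
                  cycle_off W (arr (?fin s') aCV) (arr (?fin s') aCE) (reg (?fin s') rLenC)"
                using eqs(2) by simp
            qed (use t t1 t2 eqs in \<open>auto simp: try_cycle_time_def\<close>)
            then show "frame ?copy ?s2 s' \<and> Q (?fin s') (8 + t1 + t2 + t)"
              using f3 by simp
          qed (use k in auto)
          then have "runs ?copy ?s2 (\<lambda>s3 t3. runs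
              (Seq (Store aCV (Reg rLen) (Cell aPathV (Reg rLen))) (Store aCE (Reg rLen) (Reg rChosen)))
              s3 (\<lambda>s' t. Q s' (Suc (t1 + (1 + (1 + (t2 + Suc (1 + (1 + (t3 + t))))))))))"
          proof (rule runs_conseq)
            fix s3 t3
            assume "frame ?copy ?s2 s3 \<and> Q (?fin s3) (8 + t1 + t2 + t3)"
            moreover from this have "reg s3 rLen = ?k" "reg s3 rChosen = g" "arr s3 aPathV = ?pv"
              using regs by (auto simp: frame_def)
            ultimately show "runs
              (Seq (Store aCV (Reg rLen) (Cell aPathV (Reg rLen))) (Store aCE (Reg rLen) (Reg rChosen)))
              s3 (\<lambda>s' t. Q s' (Suc (t1 + (1 + (1 + (t2 + Suc (1 + (1 + (t3 + t)))))))))"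
              by (simp add: eval_nat_numeral add.assoc)
          qed
          then show ?thesis
            using True by simp
        qed
      qed (use A1 src_less tgt_less g in auto)
    qed
    have ends: "arr s1 aTail g = src g" "arr s1 aHead g = tgt g" "reg s1 rChosen = g"
      if "frame (set_arcs ?b) s s1" for s1
      using that s(1) g by (auto simp: frame_def set_arcs_def loaded_def g_def)
    show ?thesis
      unfolding try_cycle_def
      by (subst runs_Cond, simp only: True if_True runs_Seq, rule runs_conseq[OF main])
        (simp del: runs_Cond add: ends[unfolded One_nat_def])
  qed
qed

lemma runs_find_cycle:
  assumes s: "loaded s" "marked s = W"
    and post: "\<And>s' t. frame find_cycle s s' \<Longrightarrow> t \<le> find_cycle_time N \<Longrightarrow>
      (reg s' rCycle = 1 \<longrightarrow> cycle_off W (arr s' aCV) (arr s' aCE) (reg s' rLenC)) \<Longrightarrow>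
      (\<forall>f. cycle_via W f \<longrightarrow> reg s' rCycle = 1) \<Longrightarrow> Q s' t"
  shows "runs find_cycle s Q"
proof -
  let ?s = "s\<lparr>reg := (reg s)(rCycle := 0)\<rparr>"
  let ?Inv = "\<lambda>s'. loaded s' \<and> marked s' = W \<and>
    (reg s' rCycle = 1 \<longrightarrow> cycle_off W (arr s' aCV) (arr s' aCE) (reg s' rLenC))"
  have "runs (For rChosen rM try_cycle) ?s (\<lambda>s2 t2. Q s2 (Suc t2))"
  proof (rule runs_search[where Inv = ?Inv and G = "cycle_via W" and f = rCycle and K = m
        and N = N and T = "try_cycle_time N"])
    fix k s2
    assume k: "k < m" "reg s2 rChosen = k" and I: "?Inv s2"
    show "runs try_cycle s2 (\<lambda>s3 t. t \<le> try_cycle_time N \<and> ?Inv s3 \<and>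
        (reg s2 rCycle = 1 \<longrightarrow> reg s3 rCycle = 1) \<and> (cycle_via W k \<longrightarrow> reg s3 rCycle = 1))"
    proof (rule runs_try_cycle[where W = W])
      fix s' t
      assume f: "frame try_cycle s2 s'" and t: "t \<le> try_cycle_time N"
        and d: "reg s' rCycle = 1 \<longrightarrow> cycle_off W (arr s' aCV) (arr s' aCE) (reg s' rLenC)"
        and g: "reg s2 rCycle = 1 \<or> cycle_via W (reg s2 rChosen) \<longrightarrow> reg s' rCycle = 1"
      have "loaded s'"
        by (rule loaded_frame[OF _ f]) (use I in \<open>auto simp: write_sets\<close>)
      then show "t \<le> try_cycle_time N \<and> ?Inv s' \<and> (reg s2 rCycle = 1 \<longrightarrow> reg s' rCycle = 1) \<and>
          (cycle_via W k \<longrightarrow> reg s' rCycle = 1)"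
        using t d g k I marked_frame[OF f] by (simp add: write_sets)
    qed (use I k in auto)
  next
    fix s' t
    assume I: "?Inv s'" and f: "frame (For rChosen rM try_cycle) ?s s'"
      and g: "\<forall>k<m. cycle_via W k \<longrightarrow> reg s' rCycle = 1"
      and t: "t \<le> loop_time N (try_cycle_time N)"
    show "Q s' (Suc t)"
    proof (rule post)
      show "frame find_cycle s s'"
        using f by (auto simp: frame_def find_cycle_def)
      show "\<forall>f. cycle_via W f \<longrightarrow> reg s' rCycle = 1"
        using g by (auto simp: cycle_via_def)
    qed (use I t in \<open>auto simp: find_cycle_time_def\<close>)
  qed (use s in \<open>simp_all add: loadedD write_sets\<close>)
  then show ?thesis
    by (simp add: find_cycle_def)
qed


section \<open>The exhaustive search over six vertices\<close>

definition good_regs :: "(nat \<Rightarrow> nat) \<Rightarrow> bool" where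
  "good_regs r \<longleftrightarrow> good_tuple (r 21) (r 22) (r 23) (r 24) (r 25) (r 26)"

definition sound :: "state \<Rightarrow> bool" where
  "sound s \<longleftrightarrow> loaded s \<and> (reg s rFound = 1 \<longrightarrow> solved s)"

lemma sound_update: "x \<notin> {0, 1, 3, 16, 17, 18} \<Longrightarrow> sound (s\<lparr>reg := (reg s)(x := v)\<rparr>) \<longleftrightarrow> sound s"
  by (simp add: sound_def solved_def)

lemma runs_attempt:
  assumes s: "sound s" "\<And>x. x \<in> {21..26} \<Longrightarrow> reg s x < n"
  shows "runs attempt s (\<lambda>s' t. t \<le> attempt_time N \<and> sound s' \<and>
    (reg s rFound = 1 \<longrightarrow> reg s' rFound = 1) \<and> (good_regs (reg s) \<longrightarrow> reg s' rFound = 1))"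
    (is "runs _ _ ?Q")
proof (cases "reg s rFound = 1")
  case True
  then show ?thesis
    using s by (simp add: attempt_def attempt_time_def)
next
  case False
  let ?last = "Cond (Conj (Equal (Reg rDicycle) (Num 1)) (Equal (Reg rCycle) (Num 1)))
             (Set rFound (Num 1)) Skip"
  have s0: "loaded s" using s(1) by (simp add: sound_def)
  have "runs mark_paths s (\<lambda>s1 t1. runs find_dicycle s1 (\<lambda>s2 t2. runs find_cycle s2
    (\<lambda>s3 t3. runs ?last s3 (\<lambda>s' t. ?Q s' (Suc (t1 + (t2 + (t3 + t))))))))"
  proof (rule runs_mark_paths[OF s0 s(2)])
    fix s1 t1
    assume f1: "frame mark_paths s s1" and t1: "t1 \<le> mark_paths_time N"
      and g: "good_tuple (reg s 21) (reg s 22) (reg s 23) (reg s 24) (reg s 25) (reg s 26) \<Longrightarrow>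
        good_set (marked s1)"
    define W where "W = marked s1"
    have l1: "loaded s1"
      by (rule loaded_frame[OF s0 f1]) (auto simp: write_sets)
    show "runs find_dicycle s1 (\<lambda>s2 t2. runs find_cycle s2
      (\<lambda>s3 t3. runs ?last s3 (\<lambda>s' t. ?Q s' (Suc (t1 + (t2 + (t3 + t)))))))"
    proof (rule runs_find_dicycle[OF l1 W_def[symmetric]])
      fix s2 t2
      assume f2: "frame find_dicycle s1 s2" and t2: "t2 \<le> find_dicycle_time N"
        and d: "reg s2 rDicycle = 1 \<longrightarrow> dicycle_in W (arr s2 aB) (reg s2 rLenB)"
          "\<forall>a. dicycle_via W a \<longrightarrow> reg s2 rDicycle = 1"
      have l2: "loaded s2"
        by (rule loaded_frame[OF l1 f2]) (auto simp: write_sets)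
      have m2: "marked s2 = W"
        using marked_frame[OF f2] by (simp add: W_def write_sets)
      show "runs find_cycle s2
        (\<lambda>s3 t3. runs ?last s3 (\<lambda>s' t. ?Q s' (Suc (t1 + (t2 + (t3 + t))))))"
      proof (rule runs_find_cycle[OF l2 m2])
        fix s3 t3
        assume f3: "frame find_cycle s2 s3" and t3: "t3 \<le> find_cycle_time N"
          and c: "reg s3 rCycle = 1 \<longrightarrow> cycle_off W (arr s3 aCV) (arr s3 aCE) (reg s3 rLenC)"
            "\<forall>f. cycle_via W f \<longrightarrow> reg s3 rCycle = 1"
        have l3: "loaded s3"
          by (rule loaded_frame[OF l2 f3]) (auto simp: write_sets)
        have eqs: "reg s3 rDicycle = reg s2 rDicycle" "reg s3 rLenB = reg s2 rLenB"
          "arr s3 aB = arr s2 aB" "reg s3 rFound = reg s rFound"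
          using f1 f2 f3 by (auto simp: frame_def write_sets)
        have time: "Suc (t1 + (t2 + (t3 + 2))) \<le> attempt_time N"
          using t1 t2 t3 by (simp add: attempt_time_def)
        show "runs ?last s3 (\<lambda>s' t. ?Q s' (Suc (t1 + (t2 + (t3 + t)))))"
        proof (cases "reg s3 rDicycle = 1 \<and> reg s3 rCycle = 1")
          case True
          then have "solved (s3\<lparr>reg := (reg s3)(rFound := 1)\<rparr>)"
            using c(1) d(1) eqs by (auto simp: solved_def)
          then have "?Q (s3\<lparr>reg := (reg s3)(rFound := 1)\<rparr>) (Suc (t1 + (t2 + (t3 + 2))))"
            using l3 time by (simp add: sound_def)
          then show ?thesis
            using True by simp
        next
          case n: False
          \<comment> \<open>A good set would have raised both flags.\<close>
          then have "\<not> good_set W"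
            using c(2) d(2) eqs by (auto simp: good_set_def)
          then have "?Q s3 (Suc (t1 + (t2 + (t3 + 2))))"
            using g l3 time False eqs by (auto simp: sound_def good_regs_def W_def)
          then show ?thesis
            using n by auto
        qed
      qed
    qed
  qed
  then show ?thesis
    unfolding attempt_def by (subst runs_Cond) (use False in \<open>simp del: runs_Cond\<close>)
qed

text \<open>A specification that is stable under wrapping the program into a loop: \<open>X\<close>
  are the loop registers not yet controlled, and \<open>G\<close> depends on them alone. Each loop
  removes one register from \<open>X\<close> and turns \<open>G\<close> into an existential
  statement.\<close>

definition searches :: "com \<Rightarrow> nat set \<Rightarrow> nat \<Rightarrow> ((nat \<Rightarrow> nat) \<Rightarrow> bool) \<Rightarrow> bool" where
  "searches c X T G \<longleftrightarrow>
     ({0, 1, 3, 16, 17, 18} \<inter> X = {} \<and> 0 \<notin> wregs c \<and> X \<inter> wregs c = {} \<and>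
     (\<forall>r r'. (\<forall>x\<in>X. r x = r' x) \<longrightarrow> G r = G r')) \<and>
     (\<forall>s. sound s \<and> (\<forall>x\<in>X. reg s x < n) \<longrightarrow>
       runs c s (\<lambda>s' t. t \<le> T \<and> sound s' \<and> (reg s rFound = 1 \<longrightarrow> reg s' rFound = 1) \<and>
         (G (reg s) \<longrightarrow> reg s' rFound = 1)))"

lemma searches_For:
  assumes c: "searches c (insert x X) T G" and x: "x \<notin> X"
  shows "searches (For x rN c) X (loop_time N T) (\<lambda>r. \<exists>k<n. G (r(x := k)))"
proof -
  note c' = c[unfolded searches_def]
  note X = conjunct1[OF conjunct1[OF c']] conjunct1[OF conjunct2[OF conjunct1[OF c']]]
    conjunct1[OF conjunct2[OF conjunct2[OF conjunct1[OF c']]]]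
  note G = conjunct2[OF conjunct2[OF conjunct2[OF conjunct1[OF c']]], THEN spec, THEN spec, THEN mp]
  note run = conjunct2[OF c', THEN spec, THEN mp]
  have "runs (For x rN c) s (\<lambda>s' t. t \<le> loop_time N T \<and> sound s' \<and>
      (reg s rFound = 1 \<longrightarrow> reg s' rFound = 1) \<and>
      ((\<exists>k<n. G ((reg s)(x := k))) \<longrightarrow> reg s' rFound = 1))"
    if s: "sound s" "\<forall>y\<in>X. reg s y < n" for s
  proof (rule runs_search[where Inv = sound and f = rFound and K = n and N = N and T = T
        and G = "\<lambda>k. G ((reg s)(x := k))"])
    fix k s1
    assume k: "k < n" "reg s1 x = k" and s1: "sound s1" and f: "frame (For x rN c) s s1"
    have same: "\<forall>y\<in>X. reg s1 y = reg s y"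
      using f X(3) x by (auto simp: frame_def)
    then have "G (reg s1) = G ((reg s)(x := k))"
      using k x by (intro G) auto
    moreover have "\<forall>y\<in>insert x X. reg s1 y < n"
      using same s(2) k by simp
    ultimately show "runs c s1 (\<lambda>s2 t. t \<le> T \<and> sound s2 \<and>
        (reg s1 rFound = 1 \<longrightarrow> reg s2 rFound = 1) \<and> (G ((reg s)(x := k)) \<longrightarrow> reg s2 rFound = 1))"
      using run[of s1] s1 by simp
  qed (use s X loadedD[of s] in \<open>auto simp: sound_update sound_def[of s]\<close>)
  moreover have "(\<exists>k<n. G (r(x := k))) = (\<exists>k<n. G (r'(x := k)))" if "\<forall>y\<in>X. r y = r' y" for r r'
  proof -
    have "G (r(x := k)) = G (r'(x := k))" for k
      using that by (intro G) auto
    then show ?thesis by simp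
  qed
  ultimately show ?thesis
    using X x unfolding searches_def by auto
qed

lemma searches_attempt: "searches attempt {21, 22, 23, 24, 25, 26} (attempt_time N) good_regs"
proof -
  have "x \<in> {21, 22, 23, 24, 25, 26}" if "x \<in> {21..26}" for x :: nat
    using that by (auto simp: less_Suc_eq_le[symmetric] less_Suc_eq eval_nat_numeral)
  then have run: "runs attempt s (\<lambda>s' t. t \<le> attempt_time N \<and> sound s' \<and>
      (reg s rFound = 1 \<longrightarrow> reg s' rFound = 1) \<and> (good_regs (reg s) \<longrightarrow> reg s' rFound = 1))"
    if "sound s" "\<forall>x\<in>{21, 22, 23, 24, 25, 26}. reg s x < n" for s
    using that by (intro runs_attempt) blast+
  have "\<forall>r r'. (\<forall>x\<in>{21, 22, 23, 24, 25, 26}. r x = r' x) \<longrightarrow> good_regs r = good_regs r'"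
    by (simp add: good_regs_def)
  moreover have "{21, 22, 23, 24, 25, 26} \<inter> wregs attempt = {}" "0 \<notin> wregs attempt"
    by (simp_all add: write_sets)
  moreover have "{0, 1, 3, 16, 17, 18} \<inter> {21, 22, 23, 24, 25, 26} = ({} :: nat set)"
    by simp
  ultimately show ?thesis
    unfolding searches_def
    by (intro conjI) (assumption+, intro allI impI, elim conjE, rule run, assumption+)
qed

lemma runs_search_all:
  assumes "sound s"
  shows "runs search s (\<lambda>s' t. t \<le> search_time N \<and> sound s' \<and>
    ((\<exists>v1<n. \<exists>u1<n. \<exists>v2<n. \<exists>u2<n. \<exists>v3<n. \<exists>u3<n. good_tuple v1 u1 v2 u2 v3 u3) \<longrightarrow> reg s' rFound = 1))"
proof -
  \<comment> \<open>The loops are peeled off from the innermost register 26 outwards, so each set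
    has to display the register that is removed next.\<close>
  have sets: "{21, 22, 23, 24, 25, 26::nat} = insert 26 {21, 22, 23, 24, 25}"
    "{21, 22, 23, 24, 25::nat} = insert 25 {21, 22, 23, 24}"
    "{21, 22, 23, 24::nat} = insert 24 {21, 22, 23}" "{21, 22, 23::nat} = insert 23 {21, 22}"
    "{21, 22::nat} = insert 22 {21}" by auto
  note 1 = searches_For[OF searches_attempt[unfolded sets(1)]]
  note 2 = searches_For[OF 1[unfolded sets(2)]]
  note 3 = searches_For[OF 2[unfolded sets(3)]]
  note 4 = searches_For[OF 3[unfolded sets(4)]]
  note 5 = searches_For[OF 4[unfolded sets(5)]]
  note 6 = searches_For[OF 5]
  have "searches search {} (search_time N) (\<lambda>r. \<exists>v1<n. \<exists>u1<n. \<exists>v2<n. \<exists>u2<n. \<exists>v3<n. \<exists>u3<n.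
      good_regs (r(21 := v1, 22 := u1, 23 := v2, 24 := u2, 25 := v3, 26 := u3)))"
    unfolding search_def search_time_def by (rule 6) auto
  note search = conjunct2[OF this[unfolded searches_def], THEN spec, THEN mp]
  have "sound s \<and> (\<forall>x\<in>{}. reg s x < n)" using assms by simp
  from search[OF this] show ?thesis
    by (rule runs_conseq) (simp add: good_regs_def)
qed

section \<open>Preparing the arcs and delivering the output\<close>

lemma runs_setup_arcs:
  assumes s: "reg s 0 = n" "reg s 1 = m" "\<And>e. e < m \<Longrightarrow> arr s 0 e = src e \<and> arr s 1 e = tgt e"
    and post: "\<And>s' t. loaded s' \<Longrightarrow> reg s' rFound = reg s rFound \<Longrightarrow> t \<le> 1 + loop_time N 2 \<Longrightarrow> Q s' t"
  shows "runs setup_arcs s Q"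
proof -
  let ?c = "Seq (Store aTail (Plus (Reg rM) (Reg rI)) (Cell aHead (Reg rI)))
               (Store aHead (Plus (Reg rM) (Reg rI)) (Cell aTail (Reg rI)))"
  let ?s = "s\<lparr>reg := (reg s)(rQ := 2 * m)\<rparr>"
  let ?I = "\<lambda>k s'. \<forall>e<m + k. arr s' 0 e = src e \<and> arr s' 1 e = tgt e"
  have "runs (For rI rM ?c) ?s (\<lambda>s' t. Q s' (Suc t))"
  proof (rule runs_For[where I = ?I and K = m and N = N and T = 2])
    fix k s1
    assume k: "k < m" "reg s1 rI = k" and I: "?I k s1" and f: "frame (For rI rM ?c) ?s s1"
    have "reg s1 1 = m" using f s by (simp add: frame_def)
    moreover have "arr s1 0 k = src k" "arr s1 1 k = tgt k" using I k by auto
    ultimately show "runs ?c s1 (\<lambda>s2 t. t \<le> 2 \<and> ?I (Suc k) (s2\<lparr>reg := (reg s2)(rI := Suc k)\<rparr>))"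
      using I k src_reverse tgt_reverse by (auto simp: less_Suc_eq)
  next
    fix s' t
    assume I: "?I m s'" and f: "frame (For rI rM ?c) ?s s'" and t: "t \<le> loop_time N 2"
    have "loaded s'"
      using I f s by (simp add: loaded_def frame_def mult_2)
    moreover have "reg s' rFound = reg s rFound"
      using f by (simp add: frame_def)
    ultimately show "Q s' (Suc t)"
      using t by (intro post) auto
  qed (use s in auto)
  then show ?thesis
    using s by (simp add: setup_arcs_def mult_2)
qed

text \<open>Copying to the output array reproduces only the entries below the length; nothing is
  known about the others.\<close>

lemma dicycle_in_cong:
  assumes "dicycle_in W B l" "\<And>i. i < l \<Longrightarrow> B' i = B i"
  shows "dicycle_in W B' l"
proof -
  obtain a pv pa k where "a \<in> inside W" "spath (inside W) pv pa k (tgt a) (src a)"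
    "l = Suc k" "B 0 = a" "\<forall>i<k. B (Suc i) = pa i"
    using assms(1) unfolding dicycle_in_def by blast
  then show ?thesis
    unfolding dicycle_in_def using assms(2)
    by (intro exI[of _ a] exI[of _ pv] exI[of _ pa] exI[of _ k]) auto
qed

lemma cycle_off_cong:
  assumes "cycle_off W vs fs l" "\<And>i. i < l \<Longrightarrow> vs' i = vs i"
  shows "cycle_off W vs' fs l"
proof -
  obtain f pv pa k where "f < m" "src f \<notin> W" "tgt f \<notin> W"
    "spath (outside W f) pv pa k (tgt f) (src f)" "l = Suc k" "\<forall>i\<le>k. vs i = pv i" "fs k = f"
    "\<forall>i<k. fs i = (if pa i < m then pa i else pa i - m)"
    using assms(1) unfolding cycle_off_def by blast
  then show ?thesis
    unfolding cycle_off_def using assms(2)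
    by (intro exI[of _ f] exI[of _ pv] exI[of _ pa] exI[of _ k]) auto
qed

text \<open>This bounds the copying loops of the output: a simple path has fewer than
  \<open>n\<close> arcs, and one closing arc is added.\<close>

lemma solved_lengths:
  assumes "solved s"
  shows "reg s rLenB \<le> N" "reg s rLenC \<le> N"
proof -
  obtain W where W: "dicycle_in W (arr s aB) (reg s rLenB)"
    "cycle_off W (arr s aCV) (arr s aCE) (reg s rLenC)"
    using assms unfolding solved_def by blast
  obtain a pv pa k where a: "a \<in> inside W" "spath (inside W) pv pa k (tgt a) (src a)"
    "reg s rLenB = Suc k"
    using W(1) unfolding dicycle_in_def by blast
  have sub: "inside W \<subseteq> {..<2 * m}" "outside W f \<subseteq> {..<2 * m}" for f
    by (auto simp: inside_def outside_def)
  have "tgt a < n"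
    using a(1) sub(1) by (intro tgt_less) auto
  then show "reg s rLenB \<le> N"
    using spath_bounded(1)[OF a(2) sub(1)] a(3) by simp
  obtain f pv pa k where f: "f < m" "spath (outside W f) pv pa k (tgt f) (src f)"
    "reg s rLenC = Suc k"
    using W(2) unfolding cycle_off_def by blast
  have "tgt f < n"
    using f(1) by (intro tgt_less) auto
  then show "reg s rLenC \<le> N"
    using spath_bounded(1)[OF f(2) sub(2)] f(3) by simp
qed

definition correct_output :: "state \<Rightarrow> bool" where
  "correct_output s \<longleftrightarrow> (\<exists>W. dicycle_in W (arr s 0) (reg s 1) \<and> cycle_off W (arr s 1) (arr s 2) (reg s 2))"

lemma runs_output_solution:
  assumes s: "reg s rFound = 1 \<longrightarrow> solved s"
  shows "runs output_solution s (\<lambda>s' t. t \<le> 4 + 2 * loop_time N 1 \<and>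
    (if reg s rFound = 1 then reg s' 0 = 1 \<and> correct_output s' else reg s' 0 = 0))"
    (is "runs _ _ ?Q")
proof (cases "reg s rFound = 1")
  case False
  then show ?thesis by (simp add: output_solution_def loop_time_def)
next
  case True
  then have sol: "solved s" using s by simp
  then obtain W where W: "dicycle_in W (arr s aB) (reg s rLenB)"
    "cycle_off W (arr s aCV) (arr s aCE) (reg s rLenC)"
    unfolding solved_def by blast
  note len = solved_lengths[OF sol]
  let ?c0 = "Store 0 (Reg rI) (Cell aB (Reg rI))" and ?c1 = "Store 1 (Reg rI) (Cell aCV (Reg rI))"
  have "runs (For rI rLenB ?c0) s (\<lambda>s1 t1. runs (For rI rLenC ?c1) s1
      (\<lambda>s2 t2. ?Q (s2\<lparr>reg := (reg s2)(0 := 1, 1 := reg s2 rLenB, 2 := reg s2 rLenC)\<rparr>)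
        (Suc (t1 + (t2 + 3)))))"
  proof (rule runs_For[where K = "reg s rLenB" and N = N and T = 1 and
        I = "\<lambda>k s'. \<forall>i<k. arr s' 0 i = arr s aB i"])
    fix k s1
    assume "\<forall>i<k. arr s1 0 i = arr s aB i" "reg s1 rI = k" "frame (For rI rLenB ?c0) s s1"
    then show "runs ?c0 s1 (\<lambda>s2 t. t \<le> 1 \<and>
        (\<forall>i<Suc k. arr (s2\<lparr>reg := (reg s2)(rI := Suc k)\<rparr>) 0 i = arr s aB i))"
      by (auto simp: less_Suc_eq frame_def)
  next
    fix s1 t1
    assume I1: "\<forall>i<reg s rLenB. arr s1 0 i = arr s aB i" and f1: "frame (For rI rLenB ?c0) s s1"
      and t1: "t1 \<le> loop_time N 1"
    show "runs (For rI rLenC ?c1) s1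
      (\<lambda>s2 t2. ?Q (s2\<lparr>reg := (reg s2)(0 := 1, 1 := reg s2 rLenB, 2 := reg s2 rLenC)\<rparr>)
        (Suc (t1 + (t2 + 3))))"
    proof (rule runs_For[where K = "reg s rLenC" and N = N and T = 1 and
          I = "\<lambda>k s'. \<forall>i<k. arr s' 1 i = arr s aCV i"])
      fix k s2
      assume "\<forall>i<k. arr s2 1 i = arr s aCV i" "reg s2 rI = k" "frame (For rI rLenC ?c1) s1 s2"
      then show "runs ?c1 s2 (\<lambda>s3 t. t \<le> 1 \<and>
          (\<forall>i<Suc k. arr (s3\<lparr>reg := (reg s3)(rI := Suc k)\<rparr>) 1 i = arr s aCV i))"
        using f1 by (auto simp: less_Suc_eq frame_def)
    next
      fix s2 t2
      assume I2: "\<forall>i<reg s rLenC. arr s2 1 i = arr s aCV i" and f2: "frame (For rI rLenC ?c1) s1 s2"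
        and t2: "t2 \<le> loop_time N 1"
      let ?s = "s2\<lparr>reg := (reg s2)(0 := 1, 1 := reg s2 rLenB, 2 := reg s2 rLenC)\<rparr>"
      have eqs: "reg s2 rLenB = reg s rLenB" "reg s2 rLenC = reg s rLenC" "arr s2 2 = arr s aCE"
        "arr s2 0 = arr s1 0"
        using f1 f2 by (auto simp: frame_def)
      have "dicycle_in W (arr ?s 0) (reg ?s 1)"
        using dicycle_in_cong[OF W(1)] I1 eqs by simp
      moreover have "cycle_off W (arr ?s 1) (arr ?s 2) (reg ?s 2)"
        using cycle_off_cong[OF W(2)] I2 eqs by simp
      ultimately have "correct_output ?s"
        unfolding correct_output_def by blast
      then show "?Q ?s (Suc (t1 + (t2 + 3)))"
        using True t1 t2 by simp
    qed (use f1 len in \<open>auto simp: frame_def\<close>)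
  qed (use len in auto)
  then show ?thesis
    unfolding output_solution_def by (subst runs_Cond) (use True in \<open>simp add: eval_nat_numeral\<close>)
qed

text \<open>A positive answer comes with a correct output for every digraph. A negative answer only
  excludes good tuples here; that a solvable instance has one is derived from the shape of its
  component in \<open>good_tuple_exists\<close>.\<close>

lemma runs_solve:
  assumes "reg s 0 = n" "reg s 1 = m" "reg s rFound = 0"
    and "\<And>e. e < m \<Longrightarrow> arr s 0 e = src e \<and> arr s 1 e = tgt e"
  shows "runs solve s (\<lambda>s' t. t \<le> solve_time N \<and>
    (reg s' 0 = 1 \<and> correct_output s' \<or>
     reg s' 0 = 0 \<and> \<not> (\<exists>v1<n. \<exists>u1<n. \<exists>v2<n. \<exists>u2<n. \<exists>v3<n. \<exists>u3<n. good_tuple v1 u1 v2 u2 v3 u3)))"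
  unfolding solve_def runs_Seq
proof (rule runs_setup_arcs[OF assms(1,2,4)])
  fix s1 t1
  assume "loaded s1" "reg s1 rFound = reg s rFound" and t1: "t1 \<le> 1 + loop_time N 2"
  then have "sound s1" using assms(3) by (simp add: sound_def)
  from runs_search_all[OF this]
  show "runs search s1 (\<lambda>s2 t2. runs output_solution s2 (\<lambda>s3 t3. t1 + (t2 + t3) \<le> solve_time N \<and>
    (reg s3 0 = 1 \<and> correct_output s3 \<or>
     reg s3 0 = 0 \<and> \<not> (\<exists>v1<n. \<exists>u1<n. \<exists>v2<n. \<exists>u2<n. \<exists>v3<n. \<exists>u3<n. good_tuple v1 u1 v2 u2 v3 u3))))"
  proof (rule runs_conseq)
    fix s2 t2
    assume r: "t2 \<le> search_time N \<and> sound s2 \<and>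
      ((\<exists>v1<n. \<exists>u1<n. \<exists>v2<n. \<exists>u2<n. \<exists>v3<n. \<exists>u3<n. good_tuple v1 u1 v2 u2 v3 u3) \<longrightarrow> reg s2 rFound = 1)"
    then have "reg s2 rFound = 1 \<longrightarrow> solved s2" by (simp add: sound_def)
    from runs_output_solution[OF this]
    show "runs output_solution s2 (\<lambda>s3 t3. t1 + (t2 + t3) \<le> solve_time N \<and>
      (reg s3 0 = 1 \<and> correct_output s3 \<or>
       reg s3 0 = 0 \<and> \<not> (\<exists>v1<n. \<exists>u1<n. \<exists>v2<n. \<exists>u2<n. \<exists>v3<n. \<exists>u3<n. good_tuple v1 u1 v2 u2 v3 u3)))"
    proof (rule runs_conseq)
      fix s3 t3
      assume o: "t3 \<le> 4 + 2 * loop_time N 1 \<and>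
        (if reg s2 rFound = 1 then reg s3 0 = 1 \<and> correct_output s3 else reg s3 0 = 0)"
      then have "t1 + (t2 + t3) \<le> solve_time N"
        using r t1 by (simp add: solve_time_def)
      then show "t1 + (t2 + t3) \<le> solve_time N \<and>
        (reg s3 0 = 1 \<and> correct_output s3 \<or>
         reg s3 0 = 0 \<and> \<not> (\<exists>v1<n. \<exists>u1<n. \<exists>v2<n. \<exists>u2<n. \<exists>v3<n. \<exists>u3<n. good_tuple v1 u1 v2 u2 v3 u3))"
        using o r by metis
    qed
  qed
qed

end

lemma poly_bounded_solve_time: "poly_bounded solve_time"
proof -
  have "poly_bounded (\<lambda>N. solve_time N)"
    unfolding solve_time_def search_time_def attempt_time_def find_cycle_time_def try_cycle_time_def
      find_dicycle_time_def try_dicycle_time_def mark_paths_time_def mark_path_time_def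
      find_time_def follow_time_def label_time_def
    by (intro poly_bounded_intros)
  then show ?thesis by simp
qed

section \<open>Dicycles in terms of few vertices\<close>

text \<open>Paths are injective functions on an initial segment, to match
  \<open>simple_path\<close>. If no path exists, this holds vacuously, so it is always paired with
  \<open>joined_in\<close>.\<close>

definition tight :: "('v \<times> 'v) set \<Rightarrow> 'v set \<Rightarrow> 'v \<Rightarrow> 'v \<Rightarrow> bool" where
  "tight E Z v u \<longleftrightarrow> (\<forall>p k. p 0 = v \<and> p k = u \<and> inj_on p {..k} \<and>
     (\<forall>i<k. (p i, p (Suc i)) \<in> E) \<longrightarrow> p ` {..(k::nat)} \<subseteq> Z)"

text \<open>A dicycle by its vertices, opened at an arbitrary place; a singleton list stands for a
  loop.\<close>

definition cyclic_list :: "('v \<times> 'v) set \<Rightarrow> 'v list \<Rightarrow> bool" where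
  "cyclic_list E zs \<longleftrightarrow> zs \<noteq> [] \<and> distinct zs \<and> successively (\<lambda>x y. (x, y) \<in> E) zs \<and>
     (last zs, hd zs) \<in> E"

text \<open>Membership in \<open>W\<close> is explicit because the reflexive closure would also
  relate a vertex outside \<open>W\<close> to itself.\<close>

definition joined_in :: "('v \<times> 'v) set \<Rightarrow> 'v set \<Rightarrow> 'v \<Rightarrow> 'v \<Rightarrow> bool" where
  "joined_in E W v u \<longleftrightarrow> v \<in> W \<and> u \<in> W \<and> (v, u) \<in> (E \<inter> W \<times> W)\<^sup>*"

text \<open>
  The pairs in \<open>segs\<close> determine a dicycle with vertex set \<open>Z\<close> closely enough: joining each of them by
  arbitrary simple paths yields a set of vertices inside \<open>Z\<close> which induces a dicycle.
\<close>

definition segmentation :: "('v \<times> 'v) set \<Rightarrow> 'v set \<Rightarrow> ('v \<times> 'v) list \<Rightarrow> bool" where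
  "segmentation E Z segs \<longleftrightarrow> (\<forall>(v, u)\<in>set segs. tight E Z v u \<and> joined_in E Z v u) \<and>
     (\<forall>W. (\<forall>(v, u)\<in>set segs. joined_in E W v u) \<longrightarrow> (\<exists>x y. (x, y) \<in> E \<and> joined_in E W y x))"

lemma tight_mono: "tight E Z v u \<Longrightarrow> Z \<subseteq> Z' \<Longrightarrow> tight E Z' v u"
  unfolding tight_def by blast

lemma joined_in_mono: "joined_in E Z v u \<Longrightarrow> Z \<subseteq> Z' \<Longrightarrow> joined_in E Z' v u"
  unfolding joined_in_def by (meson Int_mono Sigma_mono order_refl rtrancl_mono subsetD)

lemma joined_in_trans: "joined_in E W x y \<Longrightarrow> joined_in E W y z \<Longrightarrow> joined_in E W x z"
  unfolding joined_in_def by (meson rtrancl_trans)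

lemma joined_in_arc: "x \<in> W \<Longrightarrow> y \<in> W \<Longrightarrow> (x, y) \<in> E \<Longrightarrow> joined_in E W x y"
  unfolding joined_in_def by blast

lemma joined_in_successively:
  "zs \<noteq> [] \<Longrightarrow> successively (\<lambda>x y. (x, y) \<in> E) zs \<Longrightarrow> joined_in E (set zs) (hd zs) (last zs)"
proof (induction zs rule: induct_list012)
  case (3 x y zs)
  then have "joined_in E (set (y # zs)) y (last (y # zs))"
    by simp
  then have "joined_in E (set (x # y # zs)) y (last (y # zs))"
    by (rule joined_in_mono) auto
  moreover have "joined_in E (set (x # y # zs)) x y"
    using 3 by (intro joined_in_arc) auto
  ultimately show ?case
    by (auto intro: joined_in_trans)
qed (auto simp: joined_in_def)

text \<open>Allows a dicycle to be opened at a convenient vertex.\<close>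

lemma cyclic_list_rotate: "cyclic_list E (xs @ ys) \<Longrightarrow> cyclic_list E (ys @ xs)"
  by (cases "xs = []"; cases "ys = []") (auto simp: cyclic_list_def successively_append_iff)

lemma successively_successor:
  assumes "successively P (xs @ [z])" "x \<in> set xs"
  shows "\<exists>y\<in>set xs \<union> {z}. P x y"
proof -
  obtain as bs where "xs = as @ x # bs"
    using assms(2) by (meson split_list)
  then show ?thesis
    using assms(1) by (cases bs) (auto simp: successively_append_iff)
qed

lemma successively_predecessor:
  assumes "successively P (z # xs)" "x \<in> set xs"
  shows "\<exists>y\<in>set xs \<union> {z}. P y x"
proof -
  obtain as bs where xs: "xs = as @ x # bs"
    using assms(2) by (meson split_list)
  show ?thesis
  proof (cases as rule: rev_cases)
    case Nil
    then show ?thesis using assms(1) xs by auto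
  next
    case (snoc cs c)
    then have "successively P ((z # cs) @ [c] @ x # bs)"
      using assms(1) xs by simp
    then have "P c x"
      by (subst (asm) append_assoc[symmetric]) (simp only: successively_append_iff, auto)
    then show ?thesis using snoc xs by auto
  qed
qed

text \<open>The colouring in abstract form: \<open>LL\<close> are the blue vertices,
  \<open>RR\<close> the red ones and \<open>G\<close> the roots of the component \<open>S\<close>.
  Degree conditions are stated for neighbours, since parallel arcs coincide in \<open>E\<close>.
  \<open>convex\<close> is the property of strong components that no path between two of their
  vertices leaves them.\<close>

locale turning =
  fixes E :: "('v \<times> 'v) set" and S LL RR G :: "'v set"
  assumes cover: "S = LL \<union> RR \<union> G"
    and G: "finite G" "card G \<le> 3" "G \<inter> (LL \<union> RR) = {}"
    and disjoint: "LL \<inter> RR = {}"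
    and LL_unique: "x \<in> LL \<Longrightarrow> (x, y) \<in> E \<Longrightarrow> y \<in> S \<Longrightarrow> (x, y') \<in> E \<Longrightarrow> y' \<in> S \<Longrightarrow> y = y'"
    and LL_RR: "x \<in> LL \<Longrightarrow> (x, y) \<in> E \<Longrightarrow> y \<notin> RR"
    and RR_unique: "y \<in> RR \<Longrightarrow> (x, y) \<in> E \<Longrightarrow> x \<in> S \<Longrightarrow> (x', y) \<in> E \<Longrightarrow> x' \<in> S \<Longrightarrow> x = x'"
    and convex: "v \<in> S \<Longrightarrow> u \<in> S \<Longrightarrow> (v, x) \<in> E\<^sup>* \<Longrightarrow> (x, u) \<in> E\<^sup>* \<Longrightarrow> x \<in> S"
begin

text \<open>\<open>E\<close> belongs to the whole digraph, whereas degrees are controlled inside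
  \<open>S\<close> only; by convexity, paths with both ends in \<open>S\<close> stay where they are
  controlled.\<close>

lemma path_in_S:
  assumes "p 0 \<in> S" "p k \<in> S" "\<forall>i<k. (p i, p (Suc i)) \<in> E" "i \<le> (k::nat)"
  shows "p i \<in> S"
proof -
  have "(p a, p b) \<in> E\<^sup>*" if "a \<le> b" "b \<le> k" for a b
    using that by (induction b) (use assms(3) in \<open>auto simp: le_Suc_eq intro: rtrancl_into_rtrancl\<close>)
  then show ?thesis
    using assms convex by blast
qed

text \<open>
  A path leaving \<open>v\<close> has no choice before its first visit to \<open>g\<close>, and, seen from its end \<open>u\<close>, none
  after its last visit to \<open>g\<close>. A simple path visits \<open>g\<close> at most once.
\<close>

lemma tight_through:
  assumes vu: "v \<in> S" "u \<in> S" "v \<in> A \<union> {g}" "u \<in> B \<union> {g}" "A \<union> {g} \<union> B \<subseteq> Z"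
    and A: "\<And>x y. x \<in> A \<Longrightarrow> (x, y) \<in> E \<Longrightarrow> y \<in> S \<Longrightarrow> y \<in> A \<union> {g}"
    and B: "\<And>x y. y \<in> B \<Longrightarrow> (x, y) \<in> E \<Longrightarrow> x \<in> S \<Longrightarrow> x \<in> B \<union> {g}"
  shows "tight E Z v u"
  unfolding tight_def
proof (intro allI impI)
  fix p and k :: nat
  assume p: "p 0 = v \<and> p k = u \<and> inj_on p {..k} \<and> (\<forall>i<k. (p i, p (Suc i)) \<in> E)"
  have S: "p i \<in> S" if "i \<le> k" for i
    using path_in_S[of p k i] p vu that by auto
  have fwd: "p i \<in> A" if "i \<le> k" "\<forall>j\<le>i. p j \<noteq> g" for i
    using that
  proof (induction i)
    case (Suc i)
    then show ?case using A[of "p i" "p (Suc i)"] p S by auto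
  qed (use p vu in auto)
  show "p ` {..k} \<subseteq> Z"
  proof (cases "\<exists>j\<le>k. p j = g")
    case False
    then show ?thesis
      using fwd vu by (auto simp: image_subset_iff)
  next
    case True
    then obtain j where j: "j \<le> k" "p j = g" by blast
    have only: "i = j" if "i \<le> k" "p i = g" for i
      using p j that by (metis atMost_iff inj_onD)
    have bwd: "p i \<in> B" if "j < i" "i \<le> k" for i
      using that(2,1)
    proof (induction i rule: inc_induct)
      case base
      then show ?case using p vu only[of k] by auto
    next
      case (step i)
      then show ?case using B[of "p (Suc i)" "p i"] p S only[of i] by auto
    qed
    have "p i \<in> Z" if "i \<le> k" for i
    proof (cases i j rule: linorder_cases)
      case less
      then have "\<forall>l\<le>i. p l \<noteq> g" using only that by (metis le_trans leD)
      then show ?thesis using fwd that vu by auto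
    next
      case equal
      then show ?thesis using j vu by auto
    next
      case greater
      then show ?thesis using bwd that vu by auto
    qed
    then show ?thesis by auto
  qed
qed

text \<open>The first segment consists of the maximal blue prefix \<open>l\<close>, a vertex
  \<open>g\<close>, and the maximal red run \<open>r\<close> behind it. By maximality
  \<open>g\<close> is not blue, and it is not red since it is either the start or entered from a
  blue vertex; so it is a root. The rest starts with a vertex that is not red, and induction
  applies. Each segment uses up one root, which bounds their number.\<close>

lemma segments_of_walk:
  assumes "zs \<noteq> []" "distinct zs" "successively (\<lambda>x y. (x, y) \<in> E) zs" "set zs \<subseteq> S"
    "hd zs \<notin> RR" "last zs \<notin> LL"
  shows "\<exists>segs. segs \<noteq> [] \<and> length segs \<le> card (set zs \<inter> G) \<and>
    (\<forall>(v, u)\<in>set segs. tight E (set zs) v u \<and> joined_in E (set zs) v u) \<and>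
    (\<forall>W. (\<forall>(v, u)\<in>set segs. joined_in E W v u) \<longrightarrow> joined_in E W (hd zs) (last zs))"
  using assms
proof (induction zs rule: length_induct)
  case (1 zs)
  define l where "l = takeWhile (\<lambda>x. x \<in> LL) zs"
  define zs' where "zs' = dropWhile (\<lambda>x. x \<in> LL) zs"
  have zs: "zs = l @ zs'" by (simp add: l_def zs'_def)
  have lLL: "set l \<subseteq> LL" by (auto simp: l_def dest: set_takeWhileD)
  \<comment> \<open>The walk cannot be all blue, as its last vertex is not blue.\<close>
  have "zs' \<noteq> []"
    using 1(2,7) last_in_set[of zs] by (auto simp: zs'_def dropWhile_eq_Nil_conv)
  then obtain g zs2 where zs': "zs' = g # zs2" by (cases zs') auto
  have "g \<notin> LL"
    using hd_dropWhile[of "\<lambda>x. x \<in> LL" zs] \<open>zs' \<noteq> []\<close> zs' by (simp add: zs'_def)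
  moreover have "g \<notin> RR"
  proof (cases l rule: rev_cases)
    case Nil
    then show ?thesis using 1(6) zs zs' by simp
  next
    case (snoc l' x)
    then have "(x, g) \<in> E" "x \<in> LL"
      using 1(4) zs zs' lLL by (auto simp: successively_append_iff)
    then show ?thesis using LL_RR by blast
  qed
  ultimately have g: "g \<in> G"
    using 1(5) zs zs' cover by auto
  define r where "r = takeWhile (\<lambda>x. x \<in> RR) zs2"
  define rest where "rest = dropWhile (\<lambda>x. x \<in> RR) zs2"
  have zs2: "zs2 = r @ rest" by (simp add: r_def rest_def)
  have rRR: "set r \<subseteq> RR" by (auto simp: r_def dest: set_takeWhileD)
  have split: "zs = l @ g # r @ rest" using zs zs' zs2 by simp
  define u where "u = last (g # r)"
  have hd: "hd zs = hd (l @ [g])" using split by (cases l) auto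
  have succ: "successively (\<lambda>x y. (x, y) \<in> E) (l @ [g])" "successively (\<lambda>x y. (x, y) \<in> E) (g # r)"
    "successively (\<lambda>x y. (x, y) \<in> E) (l @ g # r)"
    using 1(4) split by (auto simp: successively_append_iff successively_Cons)
  have S: "set l \<subseteq> S" "g \<in> S" "set r \<subseteq> S" using 1(5) split by auto
  have tight: "tight E (set zs) (hd zs) u"
  proof (rule tight_through[of _ _ "set l" g "set r"])
    show "hd zs \<in> set l \<union> {g}" unfolding hd by (cases l) auto
    show "u \<in> set r \<union> {g}" by (auto simp: u_def)
    then show "u \<in> S" using S by auto
    show "hd zs \<in> S" using 1(2,5) by auto
    show "set l \<union> {g} \<union> set r \<subseteq> set zs" using split by auto
  next
    \<comment> \<open>The walk itself provides one successor of \<open>x\<close>, in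
      \<open>l\<close> or equal to \<open>g\<close>, and a blue vertex has no other one inside
      \<open>S\<close>.\<close>
    fix x y assume "x \<in> set l" "(x, y) \<in> E" "y \<in> S"
    then show "y \<in> set l \<union> {g}"
      using successively_successor[OF succ(1)] LL_unique lLL S
      by (metis (no_types, lifting) UnE empty_iff insert_iff subsetD)
  next
    fix x y assume "y \<in> set r" "(x, y) \<in> E" "x \<in> S"
    then show "x \<in> set r \<union> {g}"
      using successively_predecessor[OF succ(2)] RR_unique rRR S
      by (metis (no_types, lifting) UnE empty_iff insert_iff subsetD)
  qed
  have "joined_in E (set (l @ g # r)) (hd zs) u"
    using joined_in_successively[OF _ succ(3)] hd by (cases l) (auto simp: u_def)
  then have joined_in: "joined_in E (set zs) (hd zs) u"
    by (rule joined_in_mono) (use split in auto)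
  show ?case
  proof (cases "rest = []")
    case True
    then have "last zs = u" using split by (simp add: u_def)
    moreover have "1 \<le> card (set zs \<inter> G)"
      using g split G(1) by (simp add: Suc_le_eq card_gt_0_iff)
    ultimately show ?thesis
      using tight joined_in by (intro exI[of _ "[(hd zs, u)]"]) auto
  next
    case False
    have "hd rest \<notin> RR"
      using hd_dropWhile[of "\<lambda>x. x \<in> RR" zs2] False by (simp add: rest_def)
    moreover have "last rest = last zs" using False split by simp
    moreover have "distinct rest" "successively (\<lambda>x y. (x, y) \<in> E) rest" "set rest \<subseteq> S"
      "length rest < length zs"
      using 1(3-5) split by (auto simp: successively_append_iff successively_Cons)
    ultimately obtain segs where segs: "segs \<noteq> []" "length segs \<le> card (set rest \<inter> G)"
      "\<forall>(v, u)\<in>set segs. tight E (set rest) v u \<and> joined_in E (set rest) v u"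
      "\<forall>W. (\<forall>(v, u)\<in>set segs. joined_in E W v u) \<longrightarrow> joined_in E W (hd rest) (last zs)"
      using 1(1) False 1(7) by (metis (no_types, lifting))
    have "set rest \<inter> G \<subset> set zs \<inter> G"
      using g split 1(3) by auto
    then have "card (set rest \<inter> G) < card (set zs \<inter> G)"
      using G(1) by (intro psubset_card_mono) auto
    then have "length ((hd zs, u) # segs) \<le> card (set zs \<inter> G)"
      using segs(2) by simp
    moreover have "\<forall>(v, u)\<in>set ((hd zs, u) # segs). tight E (set zs) v u \<and> joined_in E (set zs) v u"
      using tight joined_in segs(3) split
      by (auto intro: tight_mono[where Z = "set rest"] joined_in_mono[where Z = "set rest"])
    moreover have "joined_in E W (hd zs) (last zs)"
      if "\<forall>(v, u)\<in>set ((hd zs, u) # segs). joined_in E W v u" for W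
    proof -
      have "joined_in E W (hd zs) u" "joined_in E W (hd rest) (last zs)"
        using that segs(4) by auto
      \<comment> \<open>The arc of the walk between two consecutive segments has both ends in
        \<open>W\<close>, since \<open>joined_in\<close> includes membership; so the joins
        concatenate inside \<open>W\<close>.\<close>
      moreover have "(u, hd rest) \<in> E"
        using 1(4) split False
        by (cases r rule: rev_cases) (auto simp: u_def successively_append_iff successively_Cons)
      then have "joined_in E W u (hd rest)"
        using calculation by (intro joined_in_arc) (auto simp: joined_in_def)
      ultimately show ?thesis
        by (blast intro: joined_in_trans)
    qed
    ultimately show ?thesis
      by blast
  qed
qed

text \<open>Opened at a blue vertex, the dicycle can never turn red: that needs a root or an arc
  from blue to red.\<close>

lemma cyclic_list_LL:
  assumes "cyclic_list E zs" "set zs \<subseteq> S" "set zs \<inter> G = {}" "set zs \<inter> LL \<noteq> {}"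
  shows "set zs \<subseteq> LL"
proof -
  obtain x where "x \<in> set zs" "x \<in> LL" using assms(4) by blast
  then obtain as bs where zs: "zs = as @ x # bs" by (meson split_list)
  have c: "cyclic_list E ((x # bs) @ as)"
    using assms(1) zs cyclic_list_rotate by blast
  have *: "set ys \<subseteq> LL"
    if "successively (\<lambda>x y. (x, y) \<in> E) (y # ys)" "y \<in> LL" "set ys \<subseteq> LL \<union> RR" for y ys
    using that
  proof (induction ys arbitrary: y)
    case (Cons a ys)
    then show ?case using LL_RR[of y a] by auto
  qed simp
  have "set (bs @ as) \<subseteq> LL"
    by (rule *[of x]) (use c zs assms(2,3) cover \<open>x \<in> LL\<close> in \<open>auto simp: cyclic_list_def\<close>)
  then show ?thesis using zs \<open>x \<in> LL\<close> by auto
qed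

lemma segmentation_single:
  assumes "cyclic_list E zs" "tight E (set zs) (hd zs) (last zs)"
  shows "segmentation E (set zs) [(hd zs, last zs)]"
  using assms joined_in_successively unfolding segmentation_def cyclic_list_def by auto

lemma segments_of_cycle:
  assumes c: "cyclic_list E zs" "set zs \<subseteq> S"
  shows "\<exists>segs. segs \<noteq> [] \<and> length segs \<le> 3 \<and> segmentation E (set zs) segs"
proof (cases "set zs \<inter> G = {}")
  case False
  then obtain g where "g \<in> set zs" "g \<in> G" by blast
  then obtain as bs where zs: "zs = as @ g # bs" by (meson split_list)
  \<comment> \<open>The dicycle is opened behind the red run \<open>r\<close> that follows
    \<open>g\<close>. Then it ends in \<open>g\<close> or a red vertex and starts in
    \<open>g\<close> or a vertex that is not red, as \<open>segments_of_walk\<close>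
    demands.\<close>
  define r where "r = takeWhile (\<lambda>x. x \<in> RR) (bs @ as)"
  define rest where "rest = dropWhile (\<lambda>x. x \<in> RR) (bs @ as)"
  have split: "bs @ as = r @ rest" by (simp add: r_def rest_def)
  have "cyclic_list E (g # r @ rest)"
    using c(1) zs cyclic_list_rotate[of E as "g # bs"] split by simp
  then have cyc: "cyclic_list E (rest @ g # r)"
    using cyclic_list_rotate[of E "g # r" rest] by simp
  define ys where "ys = rest @ g # r"
  have set: "set ys = set zs"
    using zs arg_cong[OF split, of set] by (auto simp: ys_def)
  have "set r \<subseteq> RR" by (auto simp: r_def dest: set_takeWhileD)
  have "hd ys \<notin> RR"
  proof (cases "rest = []")
    case True
    then show ?thesis using \<open>g \<in> G\<close> G(3) by (auto simp: ys_def)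
  next
    case False
    then show ?thesis
      using hd_dropWhile[of "\<lambda>x. x \<in> RR" "bs @ as"] by (simp add: ys_def rest_def)
  qed
  have "last ys \<notin> LL"
  proof (cases r rule: rev_cases)
    case Nil
    then show ?thesis using \<open>g \<in> G\<close> G(3) by (auto simp: ys_def)
  next
    case (snoc r' x)
    then have "x \<in> RR" using \<open>set r \<subseteq> RR\<close> by simp
    then show ?thesis
      using disjoint snoc by (auto simp: ys_def)
  qed
  have ys: "ys \<noteq> []" "distinct ys" "successively (\<lambda>x y. (x, y) \<in> E) ys" "set ys \<subseteq> S"
    using cyc c(2) set by (simp_all add: cyclic_list_def ys_def)
  from segments_of_walk[OF ys \<open>hd ys \<notin> RR\<close> \<open>last ys \<notin> LL\<close>] obtain segs where segs: "segs \<noteq> []" "length segs \<le> card (set ys \<inter> G)"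
    "\<forall>(v, u)\<in>set segs. tight E (set ys) v u \<and> joined_in E (set ys) v u"
    "\<forall>W. (\<forall>(v, u)\<in>set segs. joined_in E W v u) \<longrightarrow> joined_in E W (hd ys) (last ys)"
    by (elim exE conjE)
  have "card (set ys \<inter> G) \<le> card G"
    using G(1) by (intro card_mono) auto
  then have "length segs \<le> 3" using segs(2) G(2) by simp
  moreover have "(last ys, hd ys) \<in> E" using cyc by (simp add: cyclic_list_def ys_def)
  then have "segmentation E (set zs) segs"
    using segs(3,4) unfolding segmentation_def set[symmetric] by blast
  ultimately show ?thesis using segs(1) by blast
next
  case True
  \<comment> \<open>Without roots the dicycle is all blue, hence forced forwards, or all red, hence
    forced backwards. In \<open>tight_through\<close> one of the two sets is then empty, and
    \<open>last zs\<close> or \<open>hd zs\<close> stands in for the root.\<close>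
  have S: "hd zs \<in> S" "last zs \<in> S" using c by (auto simp: cyclic_list_def)
  have "tight E (set zs) (hd zs) (last zs)"
  proof (cases "set zs \<inter> LL = {}")
    case False
    then have LL: "set zs \<subseteq> LL" using cyclic_list_LL c True by blast
    show ?thesis
    proof (rule tight_through[of _ _ "set zs" "last zs" "{}"])
      fix x y assume *: "x \<in> set zs" "(x, y) \<in> E" "y \<in> S"
      have "\<exists>y\<in>set zs. (x, y) \<in> E"
        using successively_successor[of "\<lambda>x y. (x, y) \<in> E" zs "hd zs" x] c *
        by (auto simp: cyclic_list_def successively_append_iff intro: bexI hd_in_set)
      then show "y \<in> set zs \<union> {last zs}"
        using LL_unique LL * c(2) by blast
    qed (use c S in \<open>auto simp: cyclic_list_def\<close>)
  next
    case no: True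
    then have RR: "set zs \<subseteq> RR" using c(2) True cover by auto
    show ?thesis
    proof (rule tight_through[of _ _ "{}" "hd zs" "set zs"])
      fix x y assume *: "y \<in> set zs" "(x, y) \<in> E" "x \<in> S"
      have "\<exists>x\<in>set zs. (x, y) \<in> E"
        using successively_predecessor[of "\<lambda>x y. (x, y) \<in> E" "last zs" zs y] c *
        by (auto simp: cyclic_list_def successively_Cons intro: bexI last_in_set)
      then show "x \<in> set zs \<union> {hd zs}"
        using RR_unique RR * c(2) by blast
    qed (use c S in \<open>auto simp: cyclic_list_def\<close>)
  qed
  then show ?thesis
    using segmentation_single[OF c(1)] by (intro exI[of _ "[(hd zs, last zs)]"]) auto
qed

end

text \<open>Injectivity leaves only the path of length 0 from \<open>x\<close> to itself; this
  handles dicycles that are loops.\<close>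

lemma tight_refl: "tight E {x} x x"
proof -
  have "k = 0" if "inj_on p {..k}" "p 0 = x" "p k = x" for p :: "nat \<Rightarrow> 'a" and k
    using that by (metis atMost_iff inj_onD le0 order_refl)
  then show ?thesis
    unfolding tight_def by fastforce
qed

section \<open>Subdivisions of trivaults\<close>

text \<open>The vertex sequence is both the list of tails followed by \<open>v\<close> and
  \<open>u\<close> followed by the list of heads; all claims on arcs are read off its
  distinctness.\<close>

lemma dipath_arcs:
  assumes "is_dipath G u v"
  shows "inj_on (tail G) (arcs G)" "inj_on (head G) (arcs G)"
    "a \<in> arcs G \<Longrightarrow> tail G a \<noteq> v" "a \<in> arcs G \<Longrightarrow> head G a \<noteq> u"
    "u \<in> verts G" "v \<in> verts G"
proof -
  interpret wf_digraph G using assms by (simp add: is_dipath_def)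
  obtain p where p: "apath u p v" "arcs G = set p" "verts G = set (awalk_verts u p)"
    using assms by (auto simp: is_dipath_def)
  then have w: "awalk u p v" "distinct (awalk_verts u p)"
    by (auto simp: apath_def)
  have "awalk_verts u p = map (tail G) p @ [v]"
    using w(1) awalk_verts_conv[of u p] by (cases p rule: rev_cases) (auto simp: awalk_def)
  then have "distinct (map (tail G) p @ [v])"
    using w(2) by simp
  then show "inj_on (tail G) (arcs G)" "a \<in> arcs G \<Longrightarrow> tail G a \<noteq> v"
    using p(2) by (auto simp: distinct_map)
  have "awalk_verts u p = u # map (head G) p"
    using w(1) awalk_verts_conv'[of u p v] by (cases p) (auto simp: awalk_def)
  then have "distinct (u # map (head G) p)"
    using w(2) by simp
  then show "inj_on (head G) (arcs G)" "a \<in> arcs G \<Longrightarrow> head G a \<noteq> u"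
    using p(2) by (auto simp: distinct_map)
  show "u \<in> verts G" "v \<in> verts G"
    using w(1) by (auto dest: awalk_hd_in_verts awalk_last_in_verts)
qed

text \<open>What out-stars and dipaths have in common, so that the later arguments need no
  distinction between the two shapes; \<open>in_part\<close> is the dual.\<close>

lemma out_part:
  assumes "if s then nontrivial_out_star G b else is_dipath G b x"
  shows "inj_on (head G) (arcs G)" "a \<in> arcs G \<Longrightarrow> head G a \<noteq> b" "b \<in> verts G"
  using assms dipath_arcs[of G b x]
  by (auto simp: nontrivial_out_star_def bij_betw_def split: if_splits)

lemma in_part:
  assumes "if s then nontrivial_in_star G c else is_dipath G y c"
  shows "inj_on (tail G) (arcs G)" "a \<in> arcs G \<Longrightarrow> tail G a \<noteq> c" "c \<in> verts G"
  using assms dipath_arcs[of G y c]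
  by (auto simp: nontrivial_in_star_def bij_betw_def split: if_splits)

lemma subgraph_same_ends:
  assumes "subgraph G T"
  shows "tail G = tail T" "head G = head T" "arcs G \<subseteq> arcs T" "verts G \<subseteq> verts T"
    "a \<in> arcs G \<Longrightarrow> tail T a \<in> verts G" "a \<in> arcs G \<Longrightarrow> head T a \<in> verts G"
proof -
  interpret wf_digraph G using assms by (simp add: subgraph_def)
  show eqs: "tail G = tail T" "head G = head T" "arcs G \<subseteq> arcs T" "verts G \<subseteq> verts T"
    using assms by (auto simp: subgraph_def compatible_def)
  show "a \<in> arcs G \<Longrightarrow> tail T a \<in> verts G" "a \<in> arcs G \<Longrightarrow> head T a \<in> verts G"
    using tail_in_verts head_in_verts eqs by metis+
qed

text \<open>
  \<open>RV\<close> and \<open>RA\<close> consist of the vertices and arcs of the parts \<open>R i\<close>, and \<open>G\<close> of the roots \<open>b i\<close>.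
\<close>

lemma trivault_turning:
  fixes T :: "('a, 'b) pre_digraph"
  assumes T: "trivault T"
  obtains RA RV G where
    "finite G" "card G \<le> 3" "G \<subseteq> RV" "RV \<subseteq> verts T"
    "\<And>a. a \<in> RA \<Longrightarrow> tail T a \<in> RV"
    "\<And>a a'. a \<in> arcs T \<Longrightarrow> a' \<in> arcs T \<Longrightarrow> tail T a = tail T a' \<Longrightarrow> tail T a \<notin> RV \<Longrightarrow> a = a'"
    "\<And>a a'. a \<in> arcs T \<Longrightarrow> a' \<in> arcs T \<Longrightarrow> head T a = head T a' \<Longrightarrow> head T a \<in> RV - G \<Longrightarrow> a = a'"
    "\<And>a. a \<in> arcs T \<Longrightarrow> head T a \<in> RV - G \<Longrightarrow> a \<in> RA"
proof -
  from T obtain R L :: "nat \<Rightarrow> ('a, 'b) pre_digraph" and b c x y :: "nat \<Rightarrow> 'a" and \<rho> \<sigma> where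
    parts: "\<forall>i<3. subgraph (R i) T \<and> subgraph (L i) T \<and>
          (if \<rho> i then nontrivial_out_star (R i) (b i) else is_dipath (R i) (b i) (x i)) \<and>
          (if \<sigma> i then nontrivial_in_star (L i) (c i) else is_dipath (L i) (y i) (c i)) \<and>
          (verts (R i) \<inter> verts (L i) = {} \<and> arc_count T (c i) (b i) = 1 \<or>
           b i = c i \<and> verts (R i) \<inter> verts (L i) = {b i})"
    and pairs: "\<forall>i<3. \<forall>j<3. i \<noteq> j \<longrightarrow>
          (verts (R i) \<union> verts (L i)) \<inter> (verts (R j) \<union> verts (L j)) = {} \<and>
          (if \<rho> i
           then if \<sigma> j then star_to_star T (R i) (b i) (L j) (c j)
                else star_to_path T (R i) (b i) (L j) (y j)
           else if \<sigma> j then path_to_star T (R i) (x i) (L j) (c j)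
                else path_to_path T (R i) (x i) (L j) (y j))"
    and arcs: "arcs T = (\<Union>i<3. arcs (R i) \<union> arcs (L i)) \<union>
         (\<Union>i<3. {a \<in> arcs T. b i \<noteq> c i \<and> tail T a = c i \<and> head T a = b i}) \<union>
         (\<Union>i<3. \<Union>j\<in>{..<3} - {i}. {a \<in> arcs T. tail T a \<in> verts (R i) \<and> head T a \<in> verts (L j)})"
    unfolding trivault_def by (elim conjE exE) (rule that; assumption)
  note part = parts[THEN spec, THEN mp]
  note R = part[THEN conjunct1] and L = part[THEN conjunct2, THEN conjunct1]
    and Ri = part[THEN conjunct2, THEN conjunct2, THEN conjunct1]
    and Li = part[THEN conjunct2, THEN conjunct2, THEN conjunct2, THEN conjunct1]
    and bc = part[THEN conjunct2, THEN conjunct2, THEN conjunct2, THEN conjunct2]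
  note Rs = subgraph_same_ends[OF R] and Ls = subgraph_same_ends[OF L]
  note Rp = out_part[OF Ri] and Lp = in_part[OF Li]
  define RV where "RV = (\<Union>i<3. verts (R i))"
  define RA where "RA = (\<Union>i<3. arcs (R i))"
  define G where "G = b ` {..<3::nat}"
  have same: "i = j" if "i < 3" "j < 3" "u \<in> verts (R i) \<union> verts (L i)" "u \<in> verts (R j) \<union> verts (L j)"
    for i j :: nat and u
    using pairs[rule_format, OF that(1,2)] that(3,4) by blast
  have cases: "(\<exists>i<3. a \<in> arcs (R i)) \<or> (\<exists>i<3. a \<in> arcs (L i)) \<or>
      (\<exists>i<3. b i \<noteq> c i \<and> tail T a = c i \<and> head T a = b i) \<or>
      (\<exists>i<3. \<exists>j<3. tail T a \<in> verts (R i) \<and> head T a \<in> verts (L j))" if "a \<in> arcs T" for a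
    using that by (subst (asm) arcs) auto
  have out: "(\<exists>i<3. a \<in> arcs (L i)) \<or> (\<exists>i<3. b i \<noteq> c i \<and> tail T a = c i \<and> head T a = b i)"
    if "a \<in> arcs T" "tail T a \<notin> RV" for a
    using cases[OF that(1)] that(2) Rs(5) unfolding RV_def by blast
  have "in": "\<exists>i<3. a \<in> arcs (R i) \<and> head T a \<in> verts (R i)"
    if a: "a \<in> arcs T" "head T a \<in> RV - G" for a
  proof -
    obtain k where k: "k < 3" "head T a \<in> verts (R k)" "head T a \<noteq> b k"
      using a(2) by (auto simp: RV_def G_def)
    \<comment> \<open>\<open>R k\<close> and \<open>L k\<close> share at most the root
      \<open>b k\<close>, and parts with different indices are disjoint. So arcs ending in some
      \<open>L i\<close> or in a root are ruled out, and only arcs of the parts \<open>R i\<close>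
      remain.\<close>
    have "head T a \<notin> verts (L i)" if "i < 3" for i
      using same[OF k(1) that, of "head T a"] k bc[OF k(1)] by blast
    moreover have "head T a \<noteq> b i" if "i < 3" for i
      using a(2) that by (auto simp: G_def)
    ultimately obtain i where "i < 3" "a \<in> arcs (R i)"
      using cases[OF a(1)] Ls(6) by blast
    then show ?thesis using Rs(6) by blast
  qed
  show thesis
  proof (rule that[of G RV RA])
    show "finite G" "card G \<le> 3"
      using card_image_le[of "{..<3::nat}" b] by (auto simp: G_def)
    show "G \<subseteq> RV" using Rp(3) by (auto simp: G_def RV_def)
    show "RV \<subseteq> verts T" using Rs(4) by (auto simp: RV_def)
    show "tail T a \<in> RV" if "a \<in> RA" for a
      using that Rs(5) by (auto simp: RV_def RA_def)
    show "a \<in> RA" if "a \<in> arcs T" "head T a \<in> RV - G" for a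
      using "in"[OF that] by (auto simp: RA_def)
    show "a = a'"
      if h: "a \<in> arcs T" "a' \<in> arcs T" "head T a = head T a'" "head T a \<in> RV - G" for a a'
    proof -
      have "head T a' \<in> RV - G" using h(3,4) by simp
      then obtain i j where i: "i < 3" "a \<in> arcs (R i)" "head T a \<in> verts (R i)"
        and j: "j < 3" "a' \<in> arcs (R j)" "head T a' \<in> verts (R j)"
        using "in"[OF h(1,4)] "in"[OF h(2)] by blast
      then have "i = j" using same[of i j "head T a"] h(3) by auto
      then have "a' \<in> arcs (R i)" using j(2) by simp
      then show ?thesis
        using i(2) h(3) by (intro inj_onD[OF Rp(1)[OF i(1)]]) (simp_all add: Rs(2)[OF i(1)])
    qed
    show "a = a'" if h: "a \<in> arcs T" "a' \<in> arcs T" "tail T a = tail T a'" "tail T a \<notin> RV" for a a'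
    proof -
      \<comment> \<open>No arc of a part \<open>L i\<close> leaves any \<open>c j\<close>. Hence two
        arcs with a common tail outside \<open>RV\<close> are of the same kind: both inside parts
        \<open>L i\<close>, or both from some \<open>c i\<close> to \<open>b i\<close>.\<close>
      have no: False if "i < 3" "j < 3" "e \<in> arcs (L i)" "tail T e = c j" for i j e
      proof -
        have "i = j"
          using same[OF that(1,2), of "c j"] that Ls(5)[OF that(1), of e] Lp(3)[OF that(2)] by auto
        then show False using Lp(2)[OF that(1), of e] that Ls(1)[OF that(1)] by auto
      qed
      consider i j where "i < 3" "j < 3" "a \<in> arcs (L i)" "a' \<in> arcs (L j)"
        | i j where "i < 3" "j < 3" "b i \<noteq> c i" "tail T a = c i" "head T a = b i"
            "tail T a' = c j" "head T a' = b j"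
        using out[OF h(1,4)] out[OF h(2)] h(3,4) no by metis
      then show ?thesis
      proof cases
        case 1
        then have "i = j"
          using same[OF 1(1,2), of "tail T a"] h(3) Ls(5)[OF 1(1,3)] Ls(5)[OF 1(2,4)] by auto
        then have "a' \<in> arcs (L i)" using 1(4) by simp
        then show ?thesis
          using 1(3) h(3) by (intro inj_onD[OF Lp(1)[OF 1(1)]]) (simp_all add: Ls(1)[OF 1(1)])
      next
        case 2
        have "c i = c j" using 2(4,6) h(3) by simp
        then have "i = j"
          using same[OF 2(1,2), of "c i"] Lp(3)[OF 2(1)] Lp(3)[OF 2(2)] by simp
        \<comment> \<open>Roots that are not identified are joined by exactly one arc.\<close>
        have "arc_count T (c i) (b i) = 1" using bc[OF 2(1)] 2(3) by auto
        then obtain e where e: "{a \<in> arcs T. tail T a = c i \<and> head T a = b i} = {e}"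
          unfolding arc_count_def by (auto simp: card_1_singleton_iff)
        have "a \<in> {a \<in> arcs T. tail T a = c i \<and> head T a = b i}"
          "a' \<in> {a \<in> arcs T. tail T a = c i \<and> head T a = b i}"
          using 2(4-7) \<open>i = j\<close> h(1,2) by simp_all
        then show ?thesis unfolding e by simp
      qed
    qed
  qed
qed

text \<open>Every arc of \<open>H\<close> lies on the path of exactly one arc \<open>a\<close> of
  \<open>T\<close>, and membership of \<open>a\<close> in \<open>RA\<close> decides the colour of
  the inner vertices of that path: red inside \<open>RA\<close>, blue outside. An arc leaving a blue
  vertex belongs to an \<open>a\<close> outside \<open>RA\<close>, an arc entering a red vertex to
  an \<open>a\<close> in \<open>RA\<close>. So no arc does both, and the degree conditions carry
  over from \<open>T\<close>.\<close>

lemma subdivided_trivault_turning: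
  assumes T: "trivault T" and H: "is_subdivision_of H T"
  obtains LL RR G where "verts H = LL \<union> RR \<union> G" "finite G" "card G \<le> 3" "G \<inter> (LL \<union> RR) = {}"
    "LL \<inter> RR = {}"
    "\<And>e e'. e \<in> arcs H \<Longrightarrow> e' \<in> arcs H \<Longrightarrow> tail H e = tail H e' \<Longrightarrow> tail H e \<in> LL \<Longrightarrow> e = e'"
    "\<And>e e'. e \<in> arcs H \<Longrightarrow> e' \<in> arcs H \<Longrightarrow> head H e = head H e' \<Longrightarrow> head H e \<in> RR \<Longrightarrow> e = e'"
    "\<And>e. e \<in> arcs H \<Longrightarrow> tail H e \<in> LL \<Longrightarrow> head H e \<notin> RR"
proof -
  obtain RA RV G where G: "finite G" "card G \<le> 3" "G \<subseteq> RV" "RV \<subseteq> verts T"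
    and RA: "\<And>a. a \<in> RA \<Longrightarrow> tail T a \<in> RV"
    and outT: "\<And>a a'. a \<in> arcs T \<Longrightarrow> a' \<in> arcs T \<Longrightarrow> tail T a = tail T a' \<Longrightarrow> tail T a \<notin> RV \<Longrightarrow> a = a'"
    and inT: "\<And>a a'. a \<in> arcs T \<Longrightarrow> a' \<in> arcs T \<Longrightarrow> head T a = head T a' \<Longrightarrow> head T a \<in> RV - G \<Longrightarrow> a = a'"
    and inRA: "\<And>a. a \<in> arcs T \<Longrightarrow> head T a \<in> RV - G \<Longrightarrow> a \<in> RA"
    by (rule trivault_turning[OF T]) blast
  interpret T: wf_digraph T using H by (simp add: is_subdivision_of_def)
  interpret H: wf_digraph H using H by (simp add: is_subdivision_of_def)
  obtain \<phi> P where inj: "inj_on \<phi> (verts T)"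
    and P: "\<forall>a\<in>arcs T. P a \<noteq> [] \<and> H.awalk (\<phi> (tail T a)) (P a) (\<phi> (head T a)) \<and>
           distinct (tl (butlast (H.awalk_verts (\<phi> (tail T a)) (P a)))) \<and>
           set (tl (butlast (H.awalk_verts (\<phi> (tail T a)) (P a)))) \<inter> \<phi> ` verts T = {}"
    and disj: "\<forall>a\<in>arcs T. \<forall>a'\<in>arcs T. a \<noteq> a' \<longrightarrow>
           set (tl (butlast (H.awalk_verts (\<phi> (tail T a)) (P a)))) \<inter>
           set (tl (butlast (H.awalk_verts (\<phi> (tail T a')) (P a')))) = {} \<and>
           set (P a) \<inter> set (P a') = {}"
    and vH: "verts H = \<phi> ` verts T \<union>
           (\<Union>a\<in>arcs T. set (tl (butlast (H.awalk_verts (\<phi> (tail T a)) (P a)))))"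
    and aH: "arcs H = (\<Union>a\<in>arcs T. set (P a))"
    using H unfolding is_subdivision_of_def Let_def by (elim conjE exE) (rule that; assumption)
  define inn where "inn = (\<lambda>a. tl (butlast (H.awalk_verts (\<phi> (tail T a)) (P a))))"
  define I where "I = (\<lambda>a. set (inn a))"
  have Iphi: "I a \<inter> \<phi> ` verts T = {}" if "a \<in> arcs T" for a
    using P that by (simp add: I_def inn_def)
  have II: "a = a'" if "a \<in> arcs T" "a' \<in> arcs T" "x \<in> I a" "x \<in> I a'" for a a' x
  proof (rule ccontr)
    assume "a \<noteq> a'"
    then have "I a \<inter> I a' = {}"
      using disj that(1,2) unfolding I_def inn_def by simp
    then show False using that(3,4) by blast
  qed
  have vH': "verts H = \<phi> ` verts T \<union> (\<Union>a\<in>arcs T. I a)"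
    using vH by (simp add: I_def inn_def)
  \<comment> \<open>Both lists come from the two readings of one vertex sequence: tails and then the
    last head, or the first tail and then heads.\<close>
  have tails: "map (tail H) (P a) = \<phi> (tail T a) # inn a"
    and heads: "map (head H) (P a) = inn a @ [\<phi> (head T a)]" if a: "a \<in> arcs T" for a
  proof -
    have w: "H.awalk (\<phi> (tail T a)) (P a) (\<phi> (head T a))" "P a \<noteq> []"
      using P a by auto
    have 1: "H.awalk_verts (\<phi> (tail T a)) (P a) = map (tail H) (P a) @ [\<phi> (head T a)]"
      using w H.awalk_verts_conv[of "\<phi> (tail T a)" "P a"]
      by (cases "P a" rule: rev_cases) (auto simp: H.awalk_def)
    have 2: "H.awalk_verts (\<phi> (tail T a)) (P a) = \<phi> (tail T a) # map (head H) (P a)"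
      using w H.awalk_verts_conv'[of "\<phi> (tail T a)" "P a" "\<phi> (head T a)"]
      by (cases "P a") (auto simp: H.awalk_def)
    from 1 have i1: "inn a = tl (map (tail H) (P a))" by (simp add: inn_def)
    have "hd (map (tail H) (P a)) = \<phi> (tail T a)"
      using 1 2 w(2) by (metis hd_append list.map_disc_iff list.sel(1))
    then show t: "map (tail H) (P a) = \<phi> (tail T a) # inn a"
      using i1 w(2) by (metis hd_Cons_tl list.map_disc_iff)
    show "map (head H) (P a) = inn a @ [\<phi> (head T a)]"
      using 1 2 t by simp
  qed
  have dist: "distinct (map (tail H) (P a))" "distinct (map (head H) (P a))" if a: "a \<in> arcs T" for a
  proof -
    have d: "distinct (inn a)" using P a by (simp add: inn_def)
    have "\<phi> (tail T a) \<notin> set (inn a)" "\<phi> (head T a) \<notin> set (inn a)"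
      using Iphi[OF a] T.wellformed[OF a] by (auto simp: I_def)
    then show "distinct (map (tail H) (P a))" "distinct (map (head H) (P a))"
      unfolding tails[OF a] heads[OF a] using d by auto
  qed
  have tailP: "tail H e \<in> insert (\<phi> (tail T a)) (I a)"
    and headP: "head H e \<in> insert (\<phi> (head T a)) (I a)" if "a \<in> arcs T" "e \<in> set (P a)" for a e
    using arg_cong[OF tails[OF that(1)], of set] arg_cong[OF heads[OF that(1)], of set] that(2)
    by (auto simp: I_def)
  have same_tail: "e = e'" if "a \<in> arcs T" "e \<in> set (P a)" "e' \<in> set (P a)" "tail H e = tail H e'" for a e e'
    using dist(1)[OF that(1)] that by (auto simp: distinct_map dest: inj_onD)
  have same_head: "e = e'" if "a \<in> arcs T" "e \<in> set (P a)" "e' \<in> set (P a)" "head H e = head H e'" for a e e'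
    using dist(2)[OF that(1)] that by (auto simp: distinct_map dest: inj_onD)
  define LL where "LL = \<phi> ` (verts T - RV) \<union> (\<Union>a\<in>arcs T - RA. I a)"
  define RR where "RR = \<phi> ` (RV - G) \<union> (\<Union>a\<in>arcs T \<inter> RA. I a)"
  have tail_LL: "a \<notin> RA \<and> (tail H e \<in> I a \<or> tail H e = \<phi> (tail T a) \<and> tail T a \<notin> RV)"
    if h: "a \<in> arcs T" "e \<in> set (P a)" "tail H e \<in> LL" for a e
  proof (cases "tail H e \<in> I a")
    case True
    then have "a \<notin> RA"
      using h(1,3) Iphi[OF h(1)] II[OF h(1)] unfolding LL_def by blast
    then show ?thesis using True by blast
  next
    case False
    then have t: "tail H e = \<phi> (tail T a)" using tailP[OF h(1,2)] by blast
    then have "tail H e \<notin> I a'" if "a' \<in> arcs T" for a'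
      using Iphi[OF that] T.tail_in_verts[OF \<open>a \<in> arcs T\<close>] by auto
    then obtain w where "w \<in> verts T - RV" "\<phi> w = \<phi> (tail T a)"
      using h(3) t by (auto simp: LL_def)
    then have "tail T a \<notin> RV"
      using inj T.tail_in_verts[OF h(1)] by (metis DiffE inj_onD)
    then show ?thesis using RA t by blast
  qed
  have head_RR: "a \<in> RA \<and> (head H e \<in> I a \<or> head H e = \<phi> (head T a) \<and> head T a \<in> RV - G)"
    if h: "a \<in> arcs T" "e \<in> set (P a)" "head H e \<in> RR" for a e
  proof (cases "head H e \<in> I a")
    case True
    then have "a \<in> RA"
      using h(1,3) Iphi[OF h(1)] II[OF h(1)] G(4) unfolding RR_def by blast
    then show ?thesis using True by blast
  next
    case False
    then have t: "head H e = \<phi> (head T a)" using headP[OF h(1,2)] by blast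
    then have "head H e \<notin> I a'" if "a' \<in> arcs T" for a'
      using Iphi[OF that] T.head_in_verts[OF \<open>a \<in> arcs T\<close>] by auto
    then obtain w where "w \<in> RV - G" "\<phi> w = \<phi> (head T a)"
      using h(3) t by (auto simp: RR_def)
    then have "head T a \<in> RV - G"
      using inj T.head_in_verts[OF h(1)] G(4) by (metis DiffD1 inj_onD subsetD)
    then show ?thesis using inRA h(1) t by blast
  qed
  show thesis
  proof (rule that[of LL RR "\<phi> ` G"])
    show "verts H = LL \<union> RR \<union> \<phi> ` G"
      unfolding vH' LL_def RR_def using G(3,4) by blast
    show "finite (\<phi> ` G)" using G(1) by simp
    show "card (\<phi> ` G) \<le> 3" using card_image_le[OF G(1), of \<phi>] G(2) by simp
    have sub: "G \<subseteq> verts T" "RV - G \<subseteq> verts T" "verts T - RV \<subseteq> verts T" using G(3,4) by auto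
    have img: "\<phi> ` X \<inter> \<phi> ` Y = {}" if "X \<subseteq> verts T" "Y \<subseteq> verts T" "X \<inter> Y = {}" for X Y
      using inj_on_image_Int[OF inj that(1,2)] that(3) by simp
    have im: "\<phi> ` X \<inter> (\<Union>a\<in>Y. I a) = {}" "(\<Union>a\<in>Y. I a) \<inter> \<phi> ` X = {}"
      if "X \<subseteq> verts T" "Y \<subseteq> arcs T" for X Y
      using Iphi that by blast+
    have ii: "(\<Union>a\<in>arcs T - RA. I a) \<inter> (\<Union>a\<in>arcs T \<inter> RA. I a) = {}"
    proof (rule equals0I)
      fix x
      assume "x \<in> (\<Union>a\<in>arcs T - RA. I a) \<inter> (\<Union>a\<in>arcs T \<inter> RA. I a)"
      then obtain a a' where "a \<in> arcs T" "a \<notin> RA" "x \<in> I a" "a' \<in> arcs T" "a' \<in> RA" "x \<in> I a'"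
        by blast
      then show False using II[of a a' x] by simp
    qed
    have "G \<inter> (verts T - RV) = {}" "G \<inter> (RV - G) = {}" "(verts T - RV) \<inter> (RV - G) = {}"
      using G(3) by auto
    then show "\<phi> ` G \<inter> (LL \<union> RR) = {}" "LL \<inter> RR = {}"
      unfolding LL_def RR_def by (simp_all add: Int_Un_distrib Int_Un_distrib2 img im ii sub)
    show "e = e'" if h: "e \<in> arcs H" "e' \<in> arcs H" "tail H e = tail H e'" "tail H e \<in> LL" for e e'
    proof -
      obtain a a' where a: "a \<in> arcs T" "e \<in> set (P a)" and a': "a' \<in> arcs T" "e' \<in> set (P a')"
        using h aH by blast
      \<comment> \<open>A common tail is either an inner vertex, which belongs to one path only, or
        the image of a vertex of \<open>T\<close> outside \<open>RV\<close>, where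
        \<open>outT\<close> applies.\<close>
      have "a = a'"
        using tail_LL[OF a h(4)] tail_LL[OF a'] h(3,4) II[OF a(1) a'(1)] outT[OF a(1) a'(1)]
          Iphi[OF a(1)] Iphi[OF a'(1)] T.tail_in_verts[OF a(1)] T.tail_in_verts[OF a'(1)]
          inj_onD[OF inj, of "tail T a" "tail T a'"]
        by (metis IntI empty_iff imageI)
      then show ?thesis using same_tail a a' h(3) by blast
    qed
    show "e = e'" if h: "e \<in> arcs H" "e' \<in> arcs H" "head H e = head H e'" "head H e \<in> RR" for e e'
    proof -
      obtain a a' where a: "a \<in> arcs T" "e \<in> set (P a)" and a': "a' \<in> arcs T" "e' \<in> set (P a')"
        using h aH by blast
      have "a = a'"
        using head_RR[OF a h(4)] head_RR[OF a'] h(3,4) II[OF a(1) a'(1)] inT[OF a(1) a'(1)]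
          Iphi[OF a(1)] Iphi[OF a'(1)] T.head_in_verts[OF a(1)] T.head_in_verts[OF a'(1)]
          inj_onD[OF inj, of "head T a" "head T a'"]
        by (metis IntI empty_iff imageI)
      then show ?thesis using same_head a a' h(3) by blast
    qed
    show "head H e \<notin> RR" if "e \<in> arcs H" "tail H e \<in> LL" for e
      using that aH tail_LL head_RR by blast
  qed
qed

section \<open>Correctness of the output\<close>

definition src_of :: "(nat \<times> nat) list \<Rightarrow> nat \<Rightarrow> nat" where
  "src_of es e = (if e < length es then fst (es ! e) else snd (es ! (e - length es)))"

definition tgt_of :: "(nat \<times> nat) list \<Rightarrow> nat \<Rightarrow> nat" where
  "tgt_of es e = (if e < length es then snd (es ! e) else fst (es ! (e - length es)))"

locale arc_list =
  fixes n :: nat and es :: "(nat \<times> nat) list"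
  assumes es: "set es \<subseteq> {..<n} \<times> {..<n}"
begin

abbreviation m :: nat where "m \<equiv> length es"
abbreviation D :: "(nat, nat) pre_digraph" where "D \<equiv> digraph_of n es"

lemma ends_less: "e < m \<Longrightarrow> fst (es ! e) < n \<and> snd (es ! e) < n"
  using es nth_mem[of e es] by (metis SigmaE fst_conv lessThan_iff snd_conv subsetD)

sublocale doubled_arcs n m "src_of es" "tgt_of es"
  by unfold_locales (auto simp: src_of_def tgt_of_def ends_less)

lemma D_simps: "verts D = {..<n}" "arcs D = {..<m}"
  by (auto simp: digraph_of_def)

lemma D_ends: "e < m \<Longrightarrow> tail D e = src_of es e" "e < m \<Longrightarrow> head D e = tgt_of es e"
  by (auto simp: digraph_of_def src_of_def tgt_of_def)

sublocale D: wf_digraph D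
  by unfold_locales (auto simp: digraph_of_def ends_less)

lemma awalk_of_path:
  assumes "\<And>i. i \<le> k \<Longrightarrow> B i < m" "\<And>i. i < k \<Longrightarrow> tgt_of es (B i) = src_of es (B (Suc i))"
  shows "D.awalk (src_of es (B 0)) (map B [0..<Suc k]) (tgt_of es (B k))"
  using assms
proof (induction k)
  case 0
  then show ?case
    using D.arc_implies_awalk[of "B 0"] by (simp add: D_simps D_ends)
next
  case (Suc k)
  have "D.awalk (src_of es (B (Suc k))) [B (Suc k)] (tgt_of es (B (Suc k)))"
    using D.arc_implies_awalk[of "B (Suc k)"] Suc.prems(1)[of "Suc k"] by (simp add: D_simps D_ends)
  moreover have "D.awalk (src_of es (B 0)) (map B [0..<Suc k]) (src_of es (B (Suc k)))"
    using Suc.IH Suc.prems Suc.prems(2)[of k] by simp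
  ultimately have "D.awalk (src_of es (B 0)) (map B [0..<Suc k] @ [B (Suc k)]) (tgt_of es (B (Suc k)))"
    by (rule D.awalk_appendI[rotated])
  then show ?case by simp
qed

lemma cycle_of_dicycle_in:
  assumes "dicycle_in W B l"
  shows "D.cycle (map B [0..<l])" "tail D ` set (map B [0..<l]) \<subseteq> W"
proof -
  obtain a pv pa k where a: "a \<in> inside W" "spath (inside W) pv pa k (tgt_of es a) (src_of es a)"
    and l: "l = Suc k" and B: "B 0 = a" "\<forall>i<k. B (Suc i) = pa i"
    using assms unfolding dicycle_in_def by blast
  note p = a(2)[unfolded simple_path_def]
  have ins: "B i \<in> inside W" if "i \<le> k" for i
    using that a B p by (cases i) auto
  then have less: "B i < m" if "i \<le> k" for i
    using that by (auto simp: inside_def)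
  \<comment> \<open>Arc \<open>a\<close> comes first, so entry \<open>i\<close> of \<open>B\<close>
    ends in vertex \<open>i\<close> of the path.\<close>
  have tgt: "tgt_of es (B i) = pv i" if "i \<le> k" for i
    using that a B p by (cases i) auto
  have w: "D.awalk (src_of es a) (map B [0..<l]) (tgt_of es (B k))"
    unfolding l B(1)[symmetric] by (rule awalk_of_path) (use less tgt B p in auto)
  have "tgt_of es (B k) = src_of es a" using tgt p by simp
  then have w': "D.awalk (src_of es a) (map B [0..<l]) (src_of es a)" using w by simp
  have "D.awalk_verts (src_of es a) (map B [0..<l]) =
      src_of es a # map (head D) (map B [0..<l])"
    using D.awalk_verts_conv'[of "src_of es a" "map B [0..<l]" "src_of es a"] w' l B(1) less[of 0]
    by (auto simp: D.awalk_def D_ends hd_map simp del: upt_Suc)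
  moreover have "map (head D) (map B [0..<l]) = map pv [0..<l]"
    using tgt less l by (auto simp: D_ends)
  ultimately have "tl (D.awalk_verts (src_of es a) (map B [0..<l])) = map pv [0..<l]"
    by (simp only: list.sel)
  moreover have "distinct (map pv [0..<l])"
    using p l by (auto simp: distinct_map atLeast0LessThan lessThan_Suc_atMost simp del: upt_Suc)
  ultimately have "distinct (tl (D.awalk_verts (src_of es a) (map B [0..<l])))"
    by (simp only:)
  moreover have "map B [0..<l] \<noteq> []" using l by simp
  ultimately show "D.cycle (map B [0..<l])"
    unfolding D.cycle_def using w' by blast
  show "tail D ` set (map B [0..<l]) \<subseteq> W"
    using ins less l by (auto simp: inside_def D_ends)
qed

lemma ucycle_of_cycle_off:
  assumes "cycle_off W vs fs l"
  shows "ucycle (UG D) (map vs [0..<l]) (map fs [0..<l])" "set (map vs [0..<l]) \<inter> W = {}"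
proof -
  obtain f pv pa k where f: "f < m" "src_of es f \<notin> W" "tgt_of es f \<notin> W"
    and path: "spath (outside W f) pv pa k (tgt_of es f) (src_of es f)"
    and l: "l = Suc k" and vs: "\<forall>i\<le>k. vs i = pv i" and fs: "fs k = f"
      "\<forall>i<k. fs i = (if pa i < m then pa i else pa i - m)"
    using assms unfolding cycle_off_def by blast
  note p = path[unfolded simple_path_def]
  have out: "outside W f \<subseteq> {..<2 * m}" by (auto simp: outside_def)
  have pa: "pa i < 2 * m" "pa i \<noteq> f" "pa i \<noteq> m + f" "src_of es (pa i) \<notin> W" if "i < k" for i
    using p that by (auto simp: outside_def)
  have arc: "fs i < m" "fs i \<noteq> f" "{tail D (fs i), head D (fs i)} = {pv i, pv (Suc i)}" if "i < k" for i
  proof -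
    have *: "src_of es (pa i) = pv i" "tgt_of es (pa i) = pv (Suc i)" using p that by auto
    show "fs i < m" "fs i \<noteq> f" using pa[OF that] fs(2) that f(1) by (auto split: if_splits)
    then show "{tail D (fs i), head D (fs i)} = {pv i, pv (Suc i)}"
      using pa[OF that] fs(2) that * by (auto simp: D_ends src_of_def tgt_of_def split: if_splits)
  qed
  have less: "pv i < n" if "i \<le> k" for i
    by (rule spath_bounded(2)[OF path out tgt_less that]) (use f in simp)
  have notW: "pv i \<notin> W" if "i \<le> k" for i
    using that p pa(4)[of i] f(2) by (cases "i = k") auto
  have inj: "inj_on pv {..k}" using p by simp
  \<comment> \<open>Equal edges have equal ends, so \<open>pv i\<close> would be \<open>pv j\<close>
    or \<open>pv (Suc j)\<close>, and \<open>i \<le> j\<close> leaves \<open>i = j\<close>. This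
    also excludes that an arc and its reversed copy are both used. The closing edge differs from the
    others by \<open>outside\<close>.\<close>
  have injfs: "i = j" if "i \<le> j" "j \<le> k" "fs i = fs j" for i j
  proof (cases "j = k")
    case True
    then show ?thesis using arc(2)[of i] fs(1) that by (cases "i = k") auto
  next
    case False
    then have "{pv i, pv (Suc i)} = {pv j, pv (Suc j)}"
      using arc(3)[of i] arc(3)[of j] that by auto
    then have "pv i = pv j \<or> pv i = pv (Suc j)" by blast
    then show ?thesis
      using inj_onD[OF inj, of i j] inj_onD[OF inj, of i "Suc j"] that False by auto
  qed
  have "inj_on fs {..<l}"
  proof (rule inj_onI)
    fix i j assume "i \<in> {..<l}" "j \<in> {..<l}" "fs i = fs j"
    then show "i = j" using injfs[of i j] injfs[of j i] l by (cases "i \<le> j") auto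
  qed
  moreover have "inj_on vs {..<l}"
    using inj vs l by (simp add: lessThan_Suc_atMost inj_on_def)
  moreover have "fs i < m" if "i < l" for i
    using that arc(1)[of i] f(1) fs(1) l by (cases "i = k") auto
  moreover have "uends (UG D) (fs i) = {vs i, vs (Suc i mod l)}" if "i < l" for i
  proof (cases "i = k")
    case True
    then show ?thesis
      using f(1) fs(1) l p vs by (auto simp: UG_def D_ends)
  next
    case False
    then have "i < k" using that l by simp
    then show ?thesis
      using arc(3)[OF \<open>i < k\<close>] l vs by (simp add: UG_def)
  qed
  ultimately show "ucycle (UG D) (map vs [0..<l]) (map fs [0..<l])"
    using l less vs unfolding ucycle_def
    by (auto simp: distinct_map atLeast0LessThan UG_def D_simps simp del: upt_Suc)
  show "set (map vs [0..<l]) \<inter> W = {}"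
    using notW vs l by auto
qed

lemma correct_output_sound:
  assumes "correct_output s"
  shows "disjoint_dicycle_cycle D (array_prefix s 0 (reg s 1)) (array_prefix s 1 (reg s 2))
    (array_prefix s 2 (reg s 2))"
proof -
  obtain W where W: "dicycle_in W (arr s 0) (reg s 1)" "cycle_off W (arr s 1) (arr s 2) (reg s 2)"
    using assms unfolding correct_output_def by blast
  show ?thesis
    unfolding disjoint_dicycle_cycle_def array_prefix_def
    using cycle_of_dicycle_in[OF W(1)] ucycle_of_cycle_off[OF W(2)] by blast
qed

section \<open>Completeness of the search\<close>

text \<open>Written with the arc set that \<open>mark_paths\<close> switches on, so that being
  joined in it is membership in \<open>E\<^sup>*\<close>.\<close>

abbreviation "E \<equiv> arc_rel {e. e < 2 * m \<and> e < m} (src_of es) (tgt_of es)"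

lemma E_iff: "(x, y) \<in> E \<longleftrightarrow> (\<exists>e<m. src_of es e = x \<and> tgt_of es e = y)"
  by (force simp: arc_rel_def)

lemma arcs_ends_D: "arcs_ends D = E"
  by (force simp: arcs_ends_conv E_iff D_simps D_ends)

lemma cyclic_list_of_cycle:
  assumes "D.cycle B"
  shows "cyclic_list E (map (head D) B)" "set (map (head D) B) = tail D ` set B"
proof -
  obtain u where u: "D.awalk u B u" "distinct (tl (D.awalk_verts u B))" "B \<noteq> []"
    using assms unfolding D.cycle_def by blast
  have B: "set B \<subseteq> {..<m}" using u(1) by (auto simp: D.awalk_def D_simps)
  have 1: "D.awalk_verts u B = map (tail D) B @ [u]"
    using u D.awalk_verts_conv[of u B] by (cases B rule: rev_cases) (auto simp: D.awalk_def)
  have 2: "D.awalk_verts u B = u # map (head D) B"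
    using u D.awalk_verts_conv'[of u B u] by (cases B) (auto simp: D.awalk_def)
  \<comment> \<open>Comparing the two forms entry by entry shows that each arc starts where the
    previous one ends; first and last entries close the cycle at \<open>u\<close>.\<close>
  have eq: "map (tail D) B @ [u] = u # map (head D) B" using 1 2 by simp
  have nth: "tail D (B ! Suc i) = head D (B ! i)" if "Suc i < length B" for i
    using arg_cong[OF eq, of "\<lambda>xs. xs ! Suc i"] that by (simp add: nth_append)
  have E: "(tail D e, head D e) \<in> E" if "e \<in> set B" for e
    using that B D_ends[of e] unfolding E_iff by (metis lessThan_iff subsetD)
  have last: "last (map (head D) B) = u"
    using arg_cong[OF eq, of last] u(3) by simp
  have hd: "tail D (hd B) = u"
    using arg_cong[OF eq, of List.hd] u(3) by (simp add: hd_append hd_map)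
  show "cyclic_list E (map (head D) B)"
    unfolding cyclic_list_def
  proof (intro conjI)
    show "distinct (map (head D) B)" using u(2) 2 by simp
    show "successively (\<lambda>x y. (x, y) \<in> E) (map (head D) B)"
      unfolding successively_conv_nth using nth E by (auto simp flip: nth)
    show "(last (map (head D) B), List.hd (map (head D) B)) \<in> E"
      using E[of "List.hd B"] hd last u(3) by (simp add: hd_map)
  qed (use u(3) in simp)
  have "set (map (tail D) B) = set (map (head D) B)"
  proof -
    have "u \<in> set (map (tail D) B)" "u \<in> set (map (head D) B)"
      using hd hd_in_set[OF u(3)] last last_in_set[of "map (head D) B"] u(3) by force+
    moreover have "insert u (set (map (tail D) B)) = insert u (set (map (head D) B))"
      using arg_cong[OF eq, of set] by simp
    ultimately show ?thesis by (metis insert_absorb)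
  qed
  then show "set (map (head D) B) = tail D ` set B" by simp
qed

text \<open>A dicycle with at least two vertices makes its strong component nontrivial, so this
  component is the given \<open>S\<close>. As \<open>S\<close> is induced, its colouring controls
  all arcs of \<open>D\<close> between its vertices.\<close>

lemma segmentation_of_cycle:
  assumes comp: "unique_component_trivault D" and c: "cyclic_list E zs"
  shows "\<exists>segs. segs \<noteq> [] \<and> length segs \<le> 3 \<and> segmentation E (set zs) segs"
proof (cases "length zs \<le> 1")
  case True
  then obtain x where zs: "zs = [x]"
    using c by (cases zs) (auto simp: cyclic_list_def)
  \<comment> \<open>A loop may lie in any component, so no colouring is at hand here.\<close>
  have "segmentation E (set zs) [(x, x)]"
    unfolding segmentation_def using c tight_refl zs by (auto simp: cyclic_list_def joined_in_def)
  then show ?thesis by (intro exI[of _ "[(x, x)]"]) simp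
next
  case False
  obtain S T where S: "{S' \<in> D.sccs. card (verts S') > 1} = {S}"
    and T: "trivault (T :: (nat, nat) pre_digraph)" "is_subdivision_of S T"
    using comp unfolding unique_component_trivault_def by blast
  have zsn: "set zs \<subseteq> verts D"
  proof
    fix x assume "x \<in> set zs"
    then have "\<exists>y\<in>set zs \<union> {hd zs}. (x, y) \<in> E"
      using successively_successor[of "\<lambda>x y. (x, y) \<in> E" zs "hd zs" x] c
      by (auto simp: cyclic_list_def successively_append_iff)
    then show "x \<in> verts D"
      using src_less by (auto simp: E_iff D_simps)
  qed
  have joined: "(x, y) \<in> E\<^sup>*" if xy: "x \<in> set zs" "y \<in> set zs" for x y
  proof -
    obtain as bs where zs: "zs = as @ x # bs" using xy(1) by (meson split_list)
    have c': "cyclic_list E ((x # bs) @ as)" using c cyclic_list_rotate zs by blast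
    have "y \<in> set (x # bs @ as)" using xy(2) zs by auto
    then obtain cs ds where split: "(x # bs) @ as = cs @ y # ds" by (metis append_Cons split_list)
    then have "successively (\<lambda>x y. (x, y) \<in> E) (cs @ [y])"
      using c' by (auto simp: cyclic_list_def successively_append_iff)
    then have "joined_in E (set (cs @ [y])) (hd (cs @ [y])) (last (cs @ [y]))"
      by (intro joined_in_successively) auto
    moreover have "hd (cs @ [y]) = x"
      using arg_cong[OF split, of hd] by (cases cs) auto
    ultimately have "(x, y) \<in> (E \<inter> set (cs @ [y]) \<times> set (cs @ [y]))\<^sup>*"
      by (simp add: joined_in_def)
    then show ?thesis by (rule rtrancl_mono[THEN subsetD, rotated]) auto
  qed
  define z where "z = hd zs"
  have z: "z \<in> set zs" using c by (simp add: z_def cyclic_list_def)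
  \<comment> \<open>The strong component of \<open>z\<close> as a class of mutual reachability; in
    this form convexity is mere transitivity.\<close>
  define V where "V = {v. (z, v) \<in> E\<^sup>* \<and> (v, z) \<in> E\<^sup>*}"
  have VD: "V \<subseteq> verts D"
  proof
    fix v assume v: "v \<in> V"
    then have "(v, z) \<in> E\<^sup>*" by (simp add: V_def)
    then show "v \<in> verts D"
      by (rule converse_rtranclE) (use z zsn src_less in \<open>auto simp: E_iff D_simps\<close>)
  qed
  have reach: "u \<rightarrow>\<^sup>*\<^bsub>D\<^esub> v \<longleftrightarrow> (u, v) \<in> E\<^sup>*" if "u \<in> verts D" for u v
    using D.reachable_conv'[OF that] by (simp add: arcs_ends_D)
  have "V \<in> D.sccs_verts"
    unfolding D.in_sccs_verts_conv_reachable
  proof (intro conjI ballI allI impI)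
    show "V \<noteq> {}" using z by (auto simp: V_def)
    show "u \<rightarrow>\<^sup>*\<^bsub>D\<^esub> v" if "u \<in> V" "v \<in> V" for u v
    proof -
      have "(u, v) \<in> E\<^sup>*" using that by (auto simp: V_def intro: rtrancl_trans)
      then show ?thesis using reach[of u v] that(1) VD by blast
    qed
    show "\<not> u \<rightarrow>\<^sup>*\<^bsub>D\<^esub> v \<or> \<not> v \<rightarrow>\<^sup>*\<^bsub>D\<^esub> u" if "u \<in> V" "v \<notin> V" for u v
    proof (rule ccontr)
      assume "\<not> ?thesis"
      then have uv: "u \<rightarrow>\<^sup>*\<^bsub>D\<^esub> v" "v \<rightarrow>\<^sup>*\<^bsub>D\<^esub> u" by auto
      then have "u \<in> verts D" "v \<in> verts D" by (auto dest: D.reachable_in_verts)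
      then have "(u, v) \<in> E\<^sup>*" "(v, u) \<in> E\<^sup>*" using uv reach by auto
      then have "v \<in> V" using that(1) by (auto simp: V_def intro: rtrancl_trans)
      then show False using that(2) by simp
    qed
  qed
  then have "V \<in> verts ` D.sccs" by (simp add: D.sccs_verts_conv)
  then obtain S' where S': "S' \<in> D.sccs" "verts S' = V" by blast
  have zV: "set zs \<subseteq> V" using joined z by (auto simp: V_def)
  have "finite V" using VD by (rule finite_subset) (simp add: D_simps)
  then have "card (set zs) \<le> card V" using zV by (rule card_mono)
  moreover have "card (set zs) = length zs"
    using c by (simp add: cyclic_list_def distinct_card)
  ultimately have "S' \<in> {S' \<in> D.sccs. card (verts S') > 1}"
    using False S' by simp
  then have "S' = S" unfolding S by simp
  then have VS: "verts S = V" using S' by simp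
  have "induced_subgraph S D"
    using S'(1) \<open>S' = S\<close> by (simp add: D.in_sccs_imp_induced)
  then have sub: "subgraph S D" "arcs S = {e \<in> arcs D. tail D e \<in> verts S \<and> head D e \<in> verts S}"
    by (auto simp: induced_subgraph_def)
  note ends = subgraph_same_ends[OF sub(1)]
  obtain LL RR G where H: "verts S = LL \<union> RR \<union> G" "finite G" "card G \<le> 3" "G \<inter> (LL \<union> RR) = {}"
    "LL \<inter> RR = {}"
    and HL: "\<And>e e'. e \<in> arcs S \<Longrightarrow> e' \<in> arcs S \<Longrightarrow> tail S e = tail S e' \<Longrightarrow> tail S e \<in> LL \<Longrightarrow> e = e'"
    and HR: "\<And>e e'. e \<in> arcs S \<Longrightarrow> e' \<in> arcs S \<Longrightarrow> head S e = head S e' \<Longrightarrow> head S e \<in> RR \<Longrightarrow> e = e'"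
    and HLR: "\<And>e. e \<in> arcs S \<Longrightarrow> tail S e \<in> LL \<Longrightarrow> head S e \<notin> RR"
    by (rule subdivided_trivault_turning[OF T]) blast
  have arcS: "\<exists>e\<in>arcs S. tail S e = x \<and> head S e = y" if h: "(x, y) \<in> E" "x \<in> verts S" "y \<in> verts S" for x y
  proof -
    obtain e where "e < m" "src_of es e = x" "tgt_of es e = y"
      using h(1) by (auto simp: E_iff)
    then show ?thesis
      using h(2,3) ends(1,2) by (intro bexI[of _ e]) (auto simp: sub(2) D_simps D_ends)
  qed
  interpret turning E "verts S" LL RR G
  proof
    show "verts S = LL \<union> RR \<union> G" "finite G" "card G \<le> 3" "G \<inter> (LL \<union> RR) = {}" "LL \<inter> RR = {}"
      by fact+
    show "y = y'" if h: "x \<in> LL" "(x, y) \<in> E" "y \<in> verts S" "(x, y') \<in> E" "y' \<in> verts S" for x y y'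
    proof -
      have "x \<in> verts S" using h(1) H(1) by blast
      with arcS[OF h(2)] arcS[OF h(4)] h(3,5) obtain e e' where
        "e \<in> arcs S" "tail S e = x" "head S e = y" "e' \<in> arcs S" "tail S e' = x" "head S e' = y'"
        by blast
      then show ?thesis using HL[of e e'] h(1) by auto
    qed
    show "y \<notin> RR" if h: "x \<in> LL" "(x, y) \<in> E" for x y
    proof
      assume "y \<in> RR"
      then obtain e where "e \<in> arcs S" "tail S e = x" "head S e = y"
        using arcS[OF h(2)] h(1) H(1) by blast
      then show False using HLR[of e] h(1) \<open>y \<in> RR\<close> by auto
    qed
    show "x = x'" if h: "y \<in> RR" "(x, y) \<in> E" "x \<in> verts S" "(x', y) \<in> E" "x' \<in> verts S" for x x' y
    proof -
      have "y \<in> verts S" using h(1) H(1) by blast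
      with arcS[OF h(2)] arcS[OF h(4)] h(3,5) obtain e e' where
        "e \<in> arcs S" "tail S e = x" "head S e = y" "e' \<in> arcs S" "tail S e' = x'" "head S e' = y"
        by blast
      then show ?thesis using HR[of e e'] h(1) by auto
    qed
    show "x \<in> verts S" if "v \<in> verts S" "u \<in> verts S" "(v, x) \<in> E\<^sup>*" "(x, u) \<in> E\<^sup>*" for v u x
      using that unfolding VS V_def by (auto intro: rtrancl_trans)
  qed
  show ?thesis
    using segments_of_cycle[OF c] zV VS by simp
qed

lemma path_set_tight: "path_set v u X \<Longrightarrow> tight E Z v u \<Longrightarrow> X \<subseteq> Z"
  unfolding path_set_def
proof (elim exE conjE)
  fix pv pa k
  assume t: "tight E Z v u"
    and p: "spath {e. e < 2 * m \<and> e < m} pv pa k v u" and X: "X = pv ` {..k}"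
  have "(pv i, pv (Suc i)) \<in> E" if "i < k" for i
    using p that unfolding simple_path_def E_iff by blast
  then show "X \<subseteq> Z"
    using t p X by (simp add: tight_def simple_path_def)
qed

lemma path_set_joined: "path_set v u X \<Longrightarrow> joined_in E X v u"
  unfolding path_set_def
proof (elim exE conjE)
  fix pv pa k
  assume p: "spath {e. e < 2 * m \<and> e < m} pv pa k v u" and X: "X = pv ` {..k}"
  have "(pv 0, pv i) \<in> (E \<inter> X \<times> X)\<^sup>*" if "i \<le> k" for i
    using that
  proof (induction i)
    case (Suc i)
    have "(pv i, pv (Suc i)) \<in> E"
      using p Suc.prems unfolding simple_path_def E_iff by (metis (lifting) Suc_le_eq mem_Collect_eq)
    then have "(pv i, pv (Suc i)) \<in> E \<inter> X \<times> X" using Suc.prems X by auto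
    then show ?case using Suc by (auto intro: rtrancl_into_rtrancl)
  qed simp
  then show "joined_in E X v u"
    using p X by (auto simp: joined_in_def simple_path_def)
qed

text \<open>The last edge is the one to be closed up. Its orientation in \<open>D\<close> is
  unrelated to the direction of the cycle, so the remaining edges are followed both ways, which the
  reversed copies permit.\<close>

lemma cycle_via_of_ucycle:
  assumes u: "ucycle (UG D) vs fs" and W: "W \<inter> set vs = {}"
  shows "\<exists>f. cycle_via W f"
proof -
  define k where "k = length fs - 1"
  have len: "length fs = Suc k" "length vs = Suc k"
    using u by (auto simp: ucycle_def k_def)
  have fs: "fs ! i < m" if "i \<le> k" for i
  proof -
    have "fs ! i \<in> set fs" using that len by simp
    then show ?thesis using u by (auto simp: ucycle_def UG_def D_simps)
  qed
  have ends: "{src_of es (fs ! i), tgt_of es (fs ! i)} = {vs ! i, vs ! (Suc i mod Suc k)}" if "i \<le> k" for i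
  proof -
    have "uends (UG D) (fs ! i) = {vs ! i, vs ! (Suc i mod Suc k)}"
      using u that len by (simp add: ucycle_def)
    then show ?thesis using D_ends[OF fs[OF that]] by (simp add: UG_def)
  qed
  define f where "f = fs ! k"
  have f: "f < m" using fs[of k] by (simp add: f_def)
  have vsW: "vs ! i \<notin> W" if "i \<le> k" for i
    using W that len nth_mem[of i vs] by auto
  let ?R = "arc_rel (outside W f) (src_of es) (tgt_of es)"
  have step: "(vs ! i, vs ! Suc i) \<in> ?R \<and> (vs ! Suc i, vs ! i) \<in> ?R" if i: "i < k" for i
  proof -
    define e where "e = fs ! i"
    have e: "e < m" "{src_of es e, tgt_of es e} = {vs ! i, vs ! Suc i}"
      using fs[of i] ends[of i] i by (auto simp: e_def)
    have "e \<noteq> f" using u i len by (simp add: ucycle_def e_def f_def nth_eq_iff_index_eq)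
    moreover have "src_of es e \<notin> W" "tgt_of es e \<notin> W"
      using e(2) vsW[of i] vsW[of "Suc i"] i by (metis doubleton_eq_iff less_or_eq_imp_le Suc_le_eq)+
    ultimately have "e \<in> outside W f" "m + e \<in> outside W f"
      using e(1) f src_reverse[of e] tgt_reverse[of e] by (auto simp: outside_def)
    then have "(src_of es e, tgt_of es e) \<in> ?R" "(tgt_of es e, src_of es e) \<in> ?R"
      using src_reverse[of e] tgt_reverse[of e] e(1) unfolding arc_rel_def
      by (force, metis (no_types, lifting) image_eqI)
    then show ?thesis using e(2) by (metis doubleton_eq_iff)
  qed
  have "joined (outside W f) (vs ! 0) (vs ! i) \<and> joined (outside W f) (vs ! i) (vs ! 0)" if "i \<le> k" for i
    using that
  proof (induction i)
    case (Suc i)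
    then show ?case
      using step[of i] by (auto intro: rtrancl_into_rtrancl converse_rtrancl_into_rtrancl)
  qed simp
  then have "joined (outside W f) (vs ! 0) (vs ! k)" "joined (outside W f) (vs ! k) (vs ! 0)"
    by auto
  moreover have fe: "{src_of es f, tgt_of es f} = {vs ! k, vs ! 0}"
    using ends[of k] by (simp add: f_def)
  ultimately have "joined (outside W f) (tgt_of es f) (src_of es f)"
    by (metis doubleton_eq_iff)
  moreover have "src_of es f \<notin> W" "tgt_of es f \<notin> W"
    using fe vsW[of k] vsW[of 0] by (metis doubleton_eq_iff le0 order_refl)+
  ultimately show ?thesis
    using f unfolding cycle_via_def by blast
qed

text \<open>Shorter lists are padded by repetition, because the program always joins three
  pairs.\<close>

lemma triple_of_list:
  assumes "xs \<noteq> []" "length xs \<le> 3"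
  obtains a b c where "set xs = {a, b, c}"
proof -
  consider a where "xs = [a]" | a b where "xs = [a, b]" | a b c where "xs = [a, b, c]"
    using assms by (auto simp: neq_Nil_conv le_Suc_eq length_Suc_conv eval_nat_numeral)
  then show thesis
    by cases (use that in \<open>auto simp: insert_commute\<close>)
qed

text \<open>Tightness keeps the marked vertices \<open>W\<close> inside the given dicycle, so the
  given cycle avoids them, and the segmentation yields an arc that closes up inside
  \<open>W\<close>. The resulting dicycle may differ from \<open>B\<close>, but its vertices are
  among those of \<open>B\<close>.\<close>

lemma good_tuple_exists:
  assumes comp: "unique_component_trivault D" and sol: "disjoint_dicycle_cycle D B vs fs"
  shows "\<exists>v1<n. \<exists>u1<n. \<exists>v2<n. \<exists>u2<n. \<exists>v3<n. \<exists>u3<n. good_tuple v1 u1 v2 u2 v3 u3"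
proof -
  define zs where "zs = map (head D) B"
  have "D.cycle B" and uc: "ucycle (UG D) vs fs" and dis: "tail D ` set B \<inter> set vs = {}"
    using sol by (auto simp: disjoint_dicycle_cycle_def)
  then have c: "cyclic_list E zs" and set: "set zs = tail D ` set B"
    using cyclic_list_of_cycle by (auto simp: zs_def)
  have zsn: "set zs \<subseteq> {..<n}"
  proof -
    have "set B \<subseteq> arcs D" using \<open>D.cycle B\<close> by (auto simp: D.cycle_def D.awalk_def)
    then show ?thesis using D.tail_in_verts unfolding set D_simps by blast
  qed
  obtain segs where segs: "segs \<noteq> []" "length segs \<le> 3" "segmentation E (set zs) segs"
    using segmentation_of_cycle[OF comp c] by blast
  obtain p1 p2 p3 where triple: "set segs = {p1, p2, p3}"
    by (rule triple_of_list[OF segs(1,2)])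
  obtain v1 u1 v2 u2 v3 u3 where p: "p1 = (v1, u1)" "p2 = (v2, u2)" "p3 = (v3, u3)"
    by (metis surj_pair)
  have seg: "tight E (set zs) v u" "joined_in E (set zs) v u" if "(v, u) \<in> set segs" for v u
    using segs(3) that unfolding segmentation_def by blast+
  have closed: "\<exists>x y. (x, y) \<in> E \<and> joined_in E W y x"
    if "joined_in E W v1 u1" "joined_in E W v2 u2" "joined_in E W v3 u3" for W
    using segs(3) that unfolding segmentation_def triple p by auto
  have mem: "(v1, u1) \<in> set segs" "(v2, u2) \<in> set segs" "(v3, u3) \<in> set segs"
    using triple p by auto
  have less: "v < n" "u < n" and join: "(v, u) \<in> E\<^sup>*" if "(v, u) \<in> set segs" for v u
  proof -
    show "v < n" "u < n" using seg(2)[OF that] zsn by (auto simp: joined_in_def)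
    have "(v, u) \<in> (E \<inter> set zs \<times> set zs)\<^sup>*" using seg(2)[OF that] by (simp add: joined_in_def)
    then show "(v, u) \<in> E\<^sup>*" by (rule rtrancl_mono[THEN subsetD, rotated]) auto
  qed
  have "good_set (X1 \<union> X2 \<union> X3)"
    if X: "path_set v1 u1 X1" "path_set v2 u2 X2" "path_set v3 u3 X3" for X1 X2 X3
  proof -
    define W where "W = X1 \<union> X2 \<union> X3"
    have "W \<subseteq> set zs"
      using path_set_tight[OF X(1) seg(1)[OF mem(1)]] path_set_tight[OF X(2) seg(1)[OF mem(2)]]
        path_set_tight[OF X(3) seg(1)[OF mem(3)]] by (simp add: W_def)
    then have "W \<inter> set vs = {}" using dis set by blast
    then have cv: "\<exists>f. cycle_via W f" by (rule cycle_via_of_ucycle[OF uc])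
    have "joined_in E W v1 u1" "joined_in E W v2 u2" "joined_in E W v3 u3"
      using X[THEN path_set_joined] by (auto elim!: joined_in_mono simp: W_def)
    then obtain x y where xy: "(x, y) \<in> E" "joined_in E W y x"
      using closed by blast
    then obtain a where a: "a < m" "src_of es a = x" "tgt_of es a = y" by (auto simp: E_iff)
    have "E \<inter> W \<times> W \<subseteq> arc_rel (inside W) (src_of es) (tgt_of es)"
    proof
      fix q assume "q \<in> E \<inter> W \<times> W"
      then obtain e where "e < m" "q = (src_of es e, tgt_of es e)" "src_of es e \<in> W" "tgt_of es e \<in> W"
        by (auto simp: arc_rel_def)
      then show "q \<in> arc_rel (inside W) (src_of es) (tgt_of es)"
        by (auto simp: arc_rel_def inside_def)
    qed
    then have "joined (inside W) y x"
      using xy(2) rtrancl_mono unfolding joined_in_def by blast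
    moreover have "a \<in> inside W"
      using a xy(2) by (auto simp: inside_def joined_in_def)
    ultimately have "dicycle_via W a" using a by (simp add: dicycle_via_def)
    then show ?thesis using cv unfolding good_set_def W_def by blast
  qed
  then have "good_tuple v1 u1 v2 u2 v3 u3"
    unfolding good_tuple_def using join[OF mem(1)] join[OF mem(2)] join[OF mem(3)] by blast
  then show ?thesis
    using less[OF mem(1)] less[OF mem(2)] less[OF mem(3)] by blast
qed

lemma solve_correct:
  assumes "unique_component_trivault D"
  shows "\<exists>t s. exec solve (input_state n es) t s \<and> t \<le> solve_time N \<and>
    (if \<exists>B vs fs. disjoint_dicycle_cycle D B vs fs
     then reg s 0 = 1 \<and>
       disjoint_dicycle_cycle D
         (array_prefix s 0 (reg s 1)) (array_prefix s 1 (reg s 2)) (array_prefix s 2 (reg s 2))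
     else reg s 0 = 0)"
proof -
  have "runs solve (input_state n es) (\<lambda>s' t. t \<le> solve_time N \<and>
    (reg s' 0 = 1 \<and> correct_output s' \<or>
     reg s' 0 = 0 \<and> \<not> (\<exists>v1<n. \<exists>u1<n. \<exists>v2<n. \<exists>u2<n. \<exists>v3<n. \<exists>u3<n. good_tuple v1 u1 v2 u2 v3 u3)))"
    by (rule runs_solve) (auto simp: input_state_def src_of_def tgt_of_def)
  then obtain t s where ts: "exec solve (input_state n es) t s" "t \<le> solve_time N"
    and r: "reg s 0 = 1 \<and> correct_output s \<or>
     reg s 0 = 0 \<and> \<not> (\<exists>v1<n. \<exists>u1<n. \<exists>v2<n. \<exists>u2<n. \<exists>v3<n. \<exists>u3<n. good_tuple v1 u1 v2 u2 v3 u3)"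
    unfolding runs_def by blast
  have "if \<exists>B vs fs. disjoint_dicycle_cycle D B vs fs
     then reg s 0 = 1 \<and>
       disjoint_dicycle_cycle D
         (array_prefix s 0 (reg s 1)) (array_prefix s 1 (reg s 2)) (array_prefix s 2 (reg s 2))
     else reg s 0 = 0"
  \<comment> \<open>A positive answer itself witnesses that a solution exists, so the split is on
    the answer rather than on existence.\<close>
  proof (cases "reg s 0 = 1")
    case True
    then have "correct_output s" using r by simp
    note sol = correct_output_sound[OF this]
    then have "\<exists>B vs fs. disjoint_dicycle_cycle D B vs fs" by blast
    then show ?thesis using sol True by simp
  next
    case False
    then have "\<nexists>B vs fs. disjoint_dicycle_cycle D B vs fs"
      using r good_tuple_exists[OF assms] by blast
    moreover have "reg s 0 = 0" using r False by blast
    ultimately show ?thesis by simp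
  qed
  then show ?thesis using ts by blast
qed

end

lemma poly_nat_mono: "x \<le> y \<Longrightarrow> poly p x \<le> poly p (y :: nat)"
  by (induction p) (auto intro!: mult_le_mono)

theorem theorem9:
  shows "\<exists>(prog :: com) (p :: nat poly). \<forall>(n :: nat) (es :: (nat \<times> nat) list).
    set es \<subseteq> {..<n} \<times> {..<n} \<and> unique_component_trivault (digraph_of n es) \<longrightarrow>
    (\<exists>t s. exec prog (input_state n es) t s \<and> t \<le> poly p (n + length es) \<and>
       (if \<exists>B vs fs. disjoint_dicycle_cycle (digraph_of n es) B vs fs
        then reg s 0 = 1 \<and>
          disjoint_dicycle_cycle (digraph_of n es)
            (array_prefix s 0 (reg s 1)) (array_prefix s 1 (reg s 2)) (array_prefix s 2 (reg s 2))
        else reg s 0 = 0))"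
proof -
  obtain p where p: "\<And>N. solve_time N \<le> poly p N"
    using poly_bounded_solve_time unfolding poly_bounded_def by blast
  show ?thesis
  \<comment> \<open>Time is bounded in terms of \<open>n + 2 * length es\<close>, whereas the size
    is \<open>n + length es\<close>; composing \<open>p\<close> with doubling makes up for the
    reversed copies.\<close>
  proof (rule exI[of _ solve], rule exI[of _ "pcompose p [:0, 2:]"], intro allI impI)
    fix n :: nat and es :: "(nat \<times> nat) list"
    assume h: "set es \<subseteq> {..<n} \<times> {..<n} \<and> unique_component_trivault (digraph_of n es)"
    then interpret arc_list n es by unfold_locales simp
    have "solve_time (n + 2 * length es) \<le> poly p (n + 2 * length es)" by (rule p)
    also have "\<dots> \<le> poly p (2 * (n + length es))" by (rule poly_nat_mono) simp
    also have "\<dots> = poly (pcompose p [:0, 2:]) (n + length es)"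
      by (simp add: poly_pcompose mult.commute)
    finally have time: "solve_time (n + 2 * length es) \<le> poly (pcompose p [:0, 2:]) (n + length es)" .
    obtain t s where ts: "exec solve (input_state n es) t s" "t \<le> solve_time (n + 2 * length es)"
      "if \<exists>B vs fs. disjoint_dicycle_cycle (digraph_of n es) B vs fs
        then reg s 0 = 1 \<and>
          disjoint_dicycle_cycle (digraph_of n es)
            (array_prefix s 0 (reg s 1)) (array_prefix s 1 (reg s 2)) (array_prefix s 2 (reg s 2))
        else reg s 0 = 0"
      using solve_correct h by blast
    then show "\<exists>t s. exec solve (input_state n es) t s \<and>
       t \<le> poly (pcompose p [:0, 2:]) (n + length es) \<and>
       (if \<exists>B vs fs. disjoint_dicycle_cycle (digraph_of n es) B vs fs
        then reg s 0 = 1 \<and>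
          disjoint_dicycle_cycle (digraph_of n es)
            (array_prefix s 0 (reg s 1)) (array_prefix s 1 (reg s 2)) (array_prefix s 2 (reg s 2))
        else reg s 0 = 0)"
      using time by (intro exI[of _ t] exI[of _ s]) simp
  qed
qed

end
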